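(* For every simple matroid $M$ on a finite ground set, the Chow ring $\underline{\mathrm{CH}}(M)$ is a Koszul $\mathbb{Q}$-algebra.
   Context: Let $M$ be a simple matroid (no loops, no parallel elements) on a finite set $E$. The Chow ring of $M$ is the quotient ring $$\underline{\mathrm{CH}}(M) = \mathbb{Q}[x_F \mid F \text{ a nonempty flat of } M]\,/\,(\underline{I}_M + \underline{J}_M),$$ where $\underline{I}_M = \left(\sum_{F \ni i} x_F \mid i \in E\right)$ (for each $i$, the sum is over all flats $F$ containing $i$) and $\underline{J}_M = (x_F x_G \mid F, G \text{ incomparable nonempty flats of } M)$. It is graded with every $x_F$ in degree $1$. A standard graded $\mathbb{K}$-algebra is a commutative graded $\mathbb{K}$-algebra $R = \bigoplus_{i\ge 0} R_i$ with $R_0=\mathbb{K}$ a field, finitely generated as a $\mathbb{K}$-algebra by elements of degree one; $R_+ = \bigoplus_{i \geq 1} R_i$. Such an $R$ is Koszul if $\mathbb{K} = R/R_+$ has a linear minimal graded free resolution over $R$, i.e. $\mathrm{Tor}^R_i(\mathbb{K},\mathbb{K})_j = 0$ whenever $i \neq j$. *)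

theory Defs
  imports
    "HOL-Algebra.Algebra"
    "HOL-Algebra.Algebraic_Closure_Type"
    "HOL-Library.Poly_Mapping"
begin

section \<open>Matroids\<close>

locale matroid =
  fixes E :: "'a set" and indep :: "'a set \<Rightarrow> bool"
  assumes finite_ground: "finite E"
    and indep_subset_ground: "indep A \<Longrightarrow> A \<subseteq> E"
    and indep_empty: "indep {}"
    and indep_subset: "indep A \<Longrightarrow> B \<subseteq> A \<Longrightarrow> indep B"
    and augment: "indep A \<Longrightarrow> indep B \<Longrightarrow> card A < card B \<Longrightarrow> \<exists>y \<in> B - A. indep (insert y A)"

definition loop :: "'a set \<Rightarrow> ('a set \<Rightarrow> bool) \<Rightarrow> 'a \<Rightarrow> bool" where
  "loop E indep e \<longleftrightarrow> e \<in> E \<and> \<not> indep {e}"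

definition parallel :: "'a set \<Rightarrow> ('a set \<Rightarrow> bool) \<Rightarrow> 'a \<Rightarrow> 'a \<Rightarrow> bool" where
  "parallel E indep e f \<longleftrightarrow> e \<in> E \<and> f \<in> E \<and> e \<noteq> f \<and>
     \<not> loop E indep e \<and> \<not> loop E indep f \<and> \<not> indep {e, f}"

locale simple_matroid = matroid E indep for E :: "'a set" and indep +
  assumes no_loops: "\<not> loop E indep e"
    and no_parallel: "\<not> parallel E indep e f"

definition matroid_rank :: "('a set \<Rightarrow> bool) \<Rightarrow> 'a set \<Rightarrow> nat" where
  "matroid_rank indep A = Max (card ` {B. B \<subseteq> A \<and> indep B})"

definition flat :: "'a set \<Rightarrow> ('a set \<Rightarrow> bool) \<Rightarrow> 'a set \<Rightarrow> bool" where
  "flat E indep F \<longleftrightarrow> F \<subseteq> E \<and>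
     (\<forall>e \<in> E - F. matroid_rank indep F < matroid_rank indep (insert e F))"

definition nonempty_flats :: "'a set \<Rightarrow> ('a set \<Rightarrow> bool) \<Rightarrow> 'a set set" where
  "nonempty_flats E indep = {F. flat E indep F \<and> F \<noteq> {}}"


section \<open>Polynomial rings in a set of variables\<close>

text \<open>A monomial is a finitely supported exponent vector \<^typ>\<open>'v \<Rightarrow>\<^sub>0 nat\<close>; a polynomial is a
  finitely supported family of coefficients, with the convolution product of
  \<^theory>\<open>HOL-Library.Poly_Mapping\<close>.\<close>

type_synonym ('v, 'k) mpoly = "('v \<Rightarrow>\<^sub>0 nat) \<Rightarrow>\<^sub>0 'k"

definition mpoly_ring :: "'v set \<Rightarrow> ('v, 'k :: comm_ring_1) mpoly ring" where
  "mpoly_ring V =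
     ring_of_type_algebra \<lparr>carrier := {p. \<forall>m \<in> Poly_Mapping.keys p. Poly_Mapping.keys m \<subseteq> V}\<rparr>"

definition mpoly_var :: "'v \<Rightarrow> ('v, 'k :: comm_ring_1) mpoly" where
  "mpoly_var v = Poly_Mapping.single (Poly_Mapping.single v 1) 1"

definition mpoly_const :: "'k :: comm_ring_1 \<Rightarrow> ('v, 'k) mpoly" where
  "mpoly_const c = Poly_Mapping.single 0 c"

definition monomial_degree :: "('v \<Rightarrow>\<^sub>0 nat) \<Rightarrow> nat" where
  "monomial_degree m = (\<Sum>v \<in> Poly_Mapping.keys m. Poly_Mapping.lookup m v)"

definition mpoly_homogeneous :: "nat \<Rightarrow> ('v, 'k :: comm_ring_1) mpoly \<Rightarrow> bool" where
  "mpoly_homogeneous d p \<longleftrightarrow> (\<forall>m \<in> Poly_Mapping.keys p. monomial_degree m = d)"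


section \<open>The Chow ring of a matroid\<close>

definition chow_poly_ring :: "'a set \<Rightarrow> ('a set \<Rightarrow> bool) \<Rightarrow> ('a set, rat) mpoly ring" where
  "chow_poly_ring E indep = mpoly_ring (nonempty_flats E indep)"

definition chow_linear_ideal :: "'a set \<Rightarrow> ('a set \<Rightarrow> bool) \<Rightarrow> ('a set, rat) mpoly set" where
  "chow_linear_ideal E indep =
     Idl\<^bsub>chow_poly_ring E indep\<^esub>
       {(\<Sum>F \<in> {F \<in> nonempty_flats E indep. i \<in> F}. mpoly_var F) | i. i \<in> E}"

definition chow_incomparable_ideal :: "'a set \<Rightarrow> ('a set \<Rightarrow> bool) \<Rightarrow> ('a set, rat) mpoly set" where
  "chow_incomparable_ideal E indep =
     Idl\<^bsub>chow_poly_ring E indep\<^esub>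
       {mpoly_var F * mpoly_var G | F G.
          F \<in> nonempty_flats E indep \<and> G \<in> nonempty_flats E indep \<and> \<not> F \<subseteq> G \<and> \<not> G \<subseteq> F}"

definition chow_ideal :: "'a set \<Rightarrow> ('a set \<Rightarrow> bool) \<Rightarrow> ('a set, rat) mpoly set" where
  "chow_ideal E indep =
     chow_linear_ideal E indep <+>\<^bsub>chow_poly_ring E indep\<^esub> chow_incomparable_ideal E indep"

text \<open>The quotient ring together with its scalar multiplication by rational numbers.\<close>

definition chow_ring ::
    "'a set \<Rightarrow> ('a set \<Rightarrow> bool) \<Rightarrow> (rat, ('a set, rat) mpoly set) module" where
  "chow_ring E indep =
     (let P = chow_poly_ring E indep; I = chow_ideal E indep; Q = P Quot I
      in ring.extend Q
           (module.fields (\<lambda>c C. (I +>\<^bsub>P\<^esub> mpoly_const c) \<otimes>\<^bsub>Q\<^esub> C)))"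

definition chow_grading ::
    "'a set \<Rightarrow> ('a set \<Rightarrow> bool) \<Rightarrow> nat \<Rightarrow> ('a set, rat) mpoly set set" where
  "chow_grading E indep d =
     {chow_ideal E indep +>\<^bsub>chow_poly_ring E indep\<^esub> p | p.
        p \<in> carrier (chow_poly_ring E indep) \<and> mpoly_homogeneous d p}"


section \<open>Standard graded algebras\<close>

locale graded_ring = cring R for R (structure) +
  fixes gr :: "nat \<Rightarrow> 'a set"
  assumes gr_subgroup: "additive_subgroup (gr i) R"
    and gr_mult: "x \<in> gr i \<Longrightarrow> y \<in> gr j \<Longrightarrow> x \<otimes> y \<in> gr (i + j)"
    and gr_direct_sum: "x \<in> carrier R \<Longrightarrow>
      \<exists>!f. (\<forall>i. f i \<in> gr i) \<and> finite {i. f i \<noteq> \<zero>} \<and> x = (\<Oplus>i \<in> {i. f i \<noteq> \<zero>}. f i)"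

text \<open>The condition \<open>R\<^sub>0 = K\<close> says that \<open>R\<^sub>0\<close> is the image of the structure map \<open>c \<mapsto> c \<odot> \<one>\<close>
  and that this map is injective.\<close>

locale standard_graded_algebra =
  K: field K + algebra K R + graded_ring R gr
  for K (structure) and R (structure) and gr +
  assumes gr_0: "bij_betw (\<lambda>c. c \<odot>\<^bsub>R\<^esub> \<one>\<^bsub>R\<^esub>) (carrier K) (gr 0)"
    and generated_in_degree_1:
      "\<exists>S. finite S \<and> S \<subseteq> gr 1 \<and> carrier R = generate_ring R (gr 0 \<union> S)"

definition irrelevant_ideal :: "('r, 'm) ring_scheme \<Rightarrow> (nat \<Rightarrow> 'r set) \<Rightarrow> 'r set" where
  "irrelevant_ideal R gr = {finsum R f {1..n} | f n. \<forall>i \<in> {1..n}. f i \<in> gr i}"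

text \<open>\<open>R / R\<^sub>+\<close> as a graded \<open>R\<close>-module, concentrated in degree \<open>0\<close>.\<close>

definition residue_module ::
    "('r, 'm) ring_scheme \<Rightarrow> (nat \<Rightarrow> 'r set) \<Rightarrow> ('r, 'r set) module" where
  "residue_module R gr =
     (let Q = R Quot (irrelevant_ideal R gr)
      in ring.extend Q
           (module.fields (\<lambda>r C. (irrelevant_ideal R gr +>\<^bsub>R\<^esub> r) \<otimes>\<^bsub>Q\<^esub> C)))"

definition residue_grading ::
    "('r, 'm) ring_scheme \<Rightarrow> (nat \<Rightarrow> 'r set) \<Rightarrow> nat \<Rightarrow> 'r set set" where
  "residue_grading R gr j =
     (if j = 0 then carrier (residue_module R gr) else {\<zero>\<^bsub>residue_module R gr\<^esub>})"


section \<open>Minimal graded free resolutions\<close>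

text \<open>The free module \<open>R\<^sup>n\<close>. The ring-multiplicative fields of the record play no role for a
  module.\<close>

definition free_module :: "('r, 'm) ring_scheme \<Rightarrow> nat \<Rightarrow> ('r, nat \<Rightarrow> 'r) module" where
  "free_module R n =
     \<lparr>carrier = {..<n} \<rightarrow>\<^sub>E carrier R, monoid.mult = undefined, monoid.one = undefined,
      ring.zero = (\<lambda>k \<in> {..<n}. \<zero>\<^bsub>R\<^esub>),
      ring.add = (\<lambda>v w. \<lambda>k \<in> {..<n}. v k \<oplus>\<^bsub>R\<^esub> w k),
      module.smult = (\<lambda>r v. \<lambda>k \<in> {..<n}. r \<otimes>\<^bsub>R\<^esub> v k)\<rparr>"

text \<open>The degree-\<open>j\<close> component of the shifted module \<open>R(-s)\<close>, which is generated in degree \<open>s\<close>.\<close>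

definition shifted_grading ::
    "('r, 'm) ring_scheme \<Rightarrow> (nat \<Rightarrow> 'r set) \<Rightarrow> nat \<Rightarrow> nat \<Rightarrow> 'r set" where
  "shifted_grading R gr s j = (if s \<le> j then gr (j - s) else {\<zero>\<^bsub>R\<^esub>})"

text \<open>A list \<open>[s\<^sub>1, \<dots>, s\<^sub>n]\<close> encodes the graded free module \<open>R(-s\<^sub>1) \<oplus> \<dots> \<oplus> R(-s\<^sub>n)\<close>.\<close>

definition free_grading ::
    "('r, 'm) ring_scheme \<Rightarrow> (nat \<Rightarrow> 'r set) \<Rightarrow> nat list \<Rightarrow> nat \<Rightarrow> (nat \<Rightarrow> 'r) set" where
  "free_grading R gr s j =
     {v \<in> carrier (free_module R (length s)).
        \<forall>k < length s. v k \<in> shifted_grading R gr (s ! k) j}"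

definition graded_module_hom ::
    "('r, 'm) ring_scheme \<Rightarrow> ('r, 'x, 'p) module_scheme \<Rightarrow> (nat \<Rightarrow> 'x set) \<Rightarrow>
     ('r, 'y, 'q) module_scheme \<Rightarrow> (nat \<Rightarrow> 'y set) \<Rightarrow> ('x \<Rightarrow> 'y) \<Rightarrow> bool" where
  "graded_module_hom R M grM N grN h \<longleftrightarrow>
     h \<in> carrier M \<rightarrow> carrier N \<and>
     (\<forall>x \<in> carrier M. \<forall>y \<in> carrier M. h (x \<oplus>\<^bsub>M\<^esub> y) = h x \<oplus>\<^bsub>N\<^esub> h y) \<and>
     (\<forall>r \<in> carrier R. \<forall>x \<in> carrier M. h (r \<odot>\<^bsub>M\<^esub> x) = r \<odot>\<^bsub>N\<^esub> h x) \<and>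
     (\<forall>j. h ` grM j \<subseteq> grN j)"

text \<open>The complex \<open>\<dots> \<rightarrow> F\<^sub>2 \<rightarrow> F\<^sub>1 \<rightarrow> F\<^sub>0 \<rightarrow> M \<rightarrow> 0\<close>, where \<open>F\<^sub>i\<close> is the graded free module with
  generator degrees \<open>s i\<close>, \<open>d i\<close> maps \<open>F\<^bsub>i+1\<^esub>\<close> to \<open>F\<^sub>i\<close>, and \<open>\<epsilon>\<close> is the augmentation. Minimality
  is \<open>d i (F\<^bsub>i+1\<^esub>) \<subseteq> R\<^sub>+ F\<^sub>i\<close>; an element of a free module lies in \<open>R\<^sub>+ F\<^sub>i\<close> iff all its coordinates
  lie in \<open>R\<^sub>+\<close>.\<close>

definition minimal_graded_free_resolution ::
    "('r, 'm) ring_scheme \<Rightarrow> (nat \<Rightarrow> 'r set) \<Rightarrow> ('r, 'x, 'p) module_scheme \<Rightarrow> (nat \<Rightarrow> 'x set) \<Rightarrow>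
     (nat \<Rightarrow> nat list) \<Rightarrow> (nat \<Rightarrow> (nat \<Rightarrow> 'r) \<Rightarrow> nat \<Rightarrow> 'r) \<Rightarrow> ((nat \<Rightarrow> 'r) \<Rightarrow> 'x) \<Rightarrow> bool" where
  "minimal_graded_free_resolution R gr M grM s d \<epsilon> \<longleftrightarrow>
     (let F = (\<lambda>i. free_module R (length (s i))); grF = (\<lambda>i. free_grading R gr (s i)) in
       graded_module_hom R (F 0) (grF 0) M grM \<epsilon> \<and>
       (\<forall>i. graded_module_hom R (F (Suc i)) (grF (Suc i)) (F i) (grF i) (d i)) \<and>
       \<epsilon> ` carrier (F 0) = carrier M \<and>
       d 0 ` carrier (F 1) = a_kernel (F 0) M \<epsilon> \<and>
       (\<forall>i. d (Suc i) ` carrier (F (Suc (Suc i))) = a_kernel (F (Suc i)) (F i) (d i)) \<and>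
       (\<forall>i. \<forall>v \<in> carrier (F (Suc i)). \<forall>k < length (s i). d i v k \<in> irrelevant_ideal R gr))"


section \<open>Koszul algebras\<close>

text \<open>The resolution is linear when \<open>F\<^sub>i\<close> is generated in degree \<open>i\<close>, that is, \<open>F\<^sub>i = R(-i)\<^bsup>b i\<^esup>\<close>.\<close>

definition koszul_algebra ::
    "('k, 'n) ring_scheme \<Rightarrow> ('k, 'r, 'm) module_scheme \<Rightarrow> (nat \<Rightarrow> 'r set) \<Rightarrow> bool" where
  "koszul_algebra K R gr \<longleftrightarrow>
     standard_graded_algebra K R gr \<and>
     (\<exists>s d \<epsilon>. minimal_graded_free_resolution R gr (residue_module R gr) (residue_grading R gr) s d \<epsilon> \<and>
              (\<forall>i. set (s i) \<subseteq> {i}))"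

end

theory Submission
  imports Defs
begin

text \<open>
  An ideal with generators \<open>l\<^sub>1, \<dots>, l\<^sub>n\<close> of degree one has a linear resolution as soon as all colon
  ideals \<open>(l\<^sub>1, \<dots>, l\<^bsub>i-1\<^esub>) : l\<^sub>i\<close> belong to a family of ideals with the same property: the syzygies then
  form a submodule of a free module whose ideals of leading coefficients are these colon ideals, so the
  argument repeats. For the Chow ring such a family consists of the irrelevant ideal and the ideals
  generated by the \<open>x\<^sub>G\<close> with \<open>\<not> G \<subseteq> F\<close> together with the \<open>x\<^sub>Y\<close> for the coatoms \<open>Y\<close> of \<open>F\<close>
  that contain a given set \<open>Z\<close>.

  The colon ideals are found by duality. In the variables \<open>h\<^sub>G = - (\<Sum>H \<supseteq> G. x\<^sub>H)\<close> the degree map of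
  the truncation of the restriction to \<open>F\<close> takes the value one on the monomials that satisfy the dragon
  Hall--Rado condition and zero on all others. These functionals vanish on the relations by an uncrossing
  argument, multiplication by \<open>x\<^sub>F\<close> or by \<open>x\<^sub>Y\<close> for a coatom \<open>Y\<close> leads to the functional of a truncation
  or of a restriction, and so an induction on the rank shows that the pairings they define are perfect.
\<close>

section \<open>Polynomials\<close>

text \<open>Dividing by \<open>x_F\<close> brings in the coatoms of \<open>F\<close>, and these can
  be adjoined one at a time only in a suitable order. The set \<open>Z\<close> encodes it: coatoms
  containing \<open>Z\<close> and a further element \<open>a\<close> come before those containing
  \<open>Z\<close> but not \<open>a\<close>. When a coatom \<open>Y\<close> without \<open>a\<close>
  is adjoined, each coatom \<open>G\<close> of \<open>Y\<close> above \<open>Z\<close> has a join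
  with \<open>a\<close> that is already present, and the linear relations turn
  \<open>x_G x_Y\<close> into \<open>x_G\<close> times the variable of that join. So the colon ideal
  has the same shape, for \<open>Y\<close> and the same \<open>Z\<close>. The intermediate ideals
  may leave the family; only the colon ideals have to stay in it.

  That a colon ideal is no larger than expected cannot be read off generators; membership has to be
  detected by functionals. Perfect pairings on truncations suffice when all coatoms occur; for the
  coatoms above \<open>Z\<close> alone the induction must prove a stronger statement about
  annihilators. In the variables \<open>h\<close> the linear relations become the vanishing of
  single variables, so the incomparability relations are all that is left for the uncrossing
  argument.\<close>

lemma poly_mapping_add_induct [case_names zero add]:
  fixes p :: "'b \<Rightarrow>\<^sub>0 'c::comm_monoid_add"
  assumes "P 0" and "\<And>m c p. m \<notin> Poly_Mapping.keys p \<Longrightarrow> c \<noteq> 0 \<Longrightarrow> P p \<Longrightarrow> P (Poly_Mapping.single m c + p)"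
  shows "P p"
proof (induction p rule: Poly_Mapping.update_induct)
  case const
  then show ?case using assms(1) by simp
next
  case (update f a b)
  have "Poly_Mapping.update a b f = Poly_Mapping.single a b + f"
    using update by (intro poly_mapping_eqI) (auto simp: lookup_update lookup_add lookup_single when_def in_keys_iff)
  then show ?case using update assms(2) by auto
qed

definition linear_ext :: "('b \<Rightarrow> 'k) \<Rightarrow> ('b \<Rightarrow>\<^sub>0 'k::comm_ring_1) \<Rightarrow> 'k" where
  "linear_ext f p = (\<Sum>m \<in> Poly_Mapping.keys p. Poly_Mapping.lookup p m * f m)"

lemma linear_ext_zero [simp]: "linear_ext f 0 = 0"
  by (simp add: linear_ext_def)

lemma linear_ext_single [simp]: "linear_ext f (Poly_Mapping.single m c) = c * f m"
  by (cases "c = 0") (auto simp: linear_ext_def)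

lemma linear_ext_add [simp]: "linear_ext f (p + q) = linear_ext f p + linear_ext f q"
  unfolding linear_ext_def
  by (rule setsum_keys_plus_distrib) (auto simp: algebra_simps)

lemma linear_ext_minus [simp]: "linear_ext f (- p) = - linear_ext f p"
  using linear_ext_add[of f p "- p"] by (simp add: eq_neg_iff_add_eq_0 add.commute)

lemma linear_ext_diff [simp]: "linear_ext f (p - q) = linear_ext f p - linear_ext f q"
  using linear_ext_add[of f p "- q"] by simp

lemma linear_ext_sum: "linear_ext f (sum g A) = (\<Sum>a\<in>A. linear_ext f (g a))"
  by (induction A rule: infinite_finite_induct) auto

text \<open>One weighted degree covers the total degree and, with weights zero and one, the number
  of variables below a flat counted with multiplicity (\<open>below\<close>).\<close>

definition weight :: "('v \<Rightarrow> nat) \<Rightarrow> ('v \<Rightarrow>\<^sub>0 nat) \<Rightarrow> nat" where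
  "weight f m = (\<Sum>v \<in> Poly_Mapping.keys m. Poly_Mapping.lookup m v * f v)"

lemma weight_zero [simp]: "weight f 0 = 0"
  by (simp add: weight_def)

lemma weight_single [simp]: "weight f (Poly_Mapping.single v k) = k * f v"
  by (cases "k = 0") (auto simp: weight_def)

lemma weight_add [simp]: "weight f (m + k) = weight f m + weight f k"
  unfolding weight_def
  by (rule setsum_keys_plus_distrib) (auto simp: algebra_simps)

lemma weight_mono: "(\<And>v. v \<in> Poly_Mapping.keys m \<Longrightarrow> f v \<le> g v) \<Longrightarrow> weight f m \<le> weight g m"
  unfolding weight_def by (intro sum_mono) auto

lemma weight_fun_add: "weight (\<lambda>v. f v + g v) m = weight f m + weight g m"
  unfolding weight_def by (simp add: algebra_simps sum.distrib)

lemma monomial_degree_weight: "monomial_degree m = weight (\<lambda>_. 1) m"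
  by (simp add: monomial_degree_def weight_def)

lemma monomial_degree_simps [simp]:
  "monomial_degree 0 = 0" "monomial_degree (Poly_Mapping.single v k) = k"
  "monomial_degree (m + m') = monomial_degree m + monomial_degree m'"
  by (simp_all add: monomial_degree_weight)

lemma weight_eq_0_iff: "weight f m = 0 \<longleftrightarrow> (\<forall>v \<in> Poly_Mapping.keys m. f v = 0)"
  by (auto simp: weight_def in_keys_iff)

lemma monomial_degree_eq_0_iff: "monomial_degree m = 0 \<longleftrightarrow> m = 0"
  by (auto simp: monomial_degree_weight weight_eq_0_iff)

definition monomial_subst :: "('v \<Rightarrow> 'b::comm_ring_1) \<Rightarrow> ('v \<Rightarrow>\<^sub>0 nat) \<Rightarrow> 'b" where
  "monomial_subst g m = (\<Prod>v \<in> Poly_Mapping.keys m. g v ^ Poly_Mapping.lookup m v)"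

lemma monomial_subst_superset:
  "finite A \<Longrightarrow> Poly_Mapping.keys m \<subseteq> A \<Longrightarrow> monomial_subst g m = (\<Prod>v\<in>A. g v ^ Poly_Mapping.lookup m v)"
  unfolding monomial_subst_def
  by (rule prod.mono_neutral_left) (auto simp: in_keys_iff)

lemma monomial_subst_simps [simp]:
  "monomial_subst g 0 = 1"
  "monomial_subst g (Poly_Mapping.single v k) = g v ^ k"
  "monomial_subst g (m + m') = monomial_subst g m * monomial_subst g m'"
proof -
  let ?A = "Poly_Mapping.keys m \<union> Poly_Mapping.keys m'"
  have "monomial_subst g (m + m') = (\<Prod>v\<in>?A. g v ^ Poly_Mapping.lookup (m + m') v)"
    by (intro monomial_subst_superset keys_add) auto
  also have "\<dots> = (\<Prod>v\<in>?A. g v ^ Poly_Mapping.lookup m v) * (\<Prod>v\<in>?A. g v ^ Poly_Mapping.lookup m' v)"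
    by (simp add: lookup_add power_add prod.distrib)
  also have "\<dots> = monomial_subst g m * monomial_subst g m'"
    by (subst (1 2) monomial_subst_superset[of ?A]) auto
  finally show "monomial_subst g (m + m') = monomial_subst g m * monomial_subst g m'" .
qed (cases "k = 0"; auto simp: monomial_subst_def)+

definition mpoly_subst :: "('v \<Rightarrow> ('w, 'k) mpoly) \<Rightarrow> ('v, 'k::comm_ring_1) mpoly \<Rightarrow> ('w, 'k) mpoly" where
  "mpoly_subst g p = (\<Sum>m \<in> Poly_Mapping.keys p. mpoly_const (Poly_Mapping.lookup p m) * monomial_subst g m)"

lemma mpoly_const_simps:
  "mpoly_const 0 = 0" "mpoly_const 1 = 1" "mpoly_const (a + b) = mpoly_const a + mpoly_const b"
  "mpoly_const (a * b) = mpoly_const a * mpoly_const b"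
  by (auto simp: mpoly_const_def single_add mult_single)

lemma mpoly_subst_zero [simp]: "mpoly_subst g 0 = 0"
  by (simp add: mpoly_subst_def)

lemma mpoly_subst_single [simp]: "mpoly_subst g (Poly_Mapping.single m c) = mpoly_const c * monomial_subst g m"
  by (cases "c = 0") (auto simp: mpoly_subst_def mpoly_const_simps)

lemma mpoly_subst_add [simp]: "mpoly_subst g (p + q) = mpoly_subst g p + mpoly_subst g q"
  unfolding mpoly_subst_def
  by (rule setsum_keys_plus_distrib) (auto simp: algebra_simps mpoly_const_simps)

lemma mpoly_subst_minus [simp]: "mpoly_subst g (- p) = - mpoly_subst g p"
  using mpoly_subst_add[of g p "- p"] by (simp add: eq_neg_iff_add_eq_0 add.commute)

lemma mpoly_subst_diff [simp]: "mpoly_subst g (p - q) = mpoly_subst g p - mpoly_subst g q"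
  using mpoly_subst_add[of g p "- q"] by simp

lemma mpoly_subst_sum: "mpoly_subst g (sum h A) = (\<Sum>a\<in>A. mpoly_subst g (h a))"
  by (induction A rule: infinite_finite_induct) auto

lemma mpoly_subst_mult [simp]: "mpoly_subst g (p * q) = mpoly_subst g p * mpoly_subst g q"
proof (induction p rule: poly_mapping_add_induct)
  case (add m c p)
  have "mpoly_subst g (Poly_Mapping.single m c * q) = mpoly_const c * monomial_subst g m * mpoly_subst g q"
    by (induction q rule: poly_mapping_add_induct)
      (auto simp: algebra_simps mult_single mpoly_const_simps)
  then show ?case using add by (simp add: algebra_simps)
qed auto

lemma mpoly_subst_var [simp]: "mpoly_subst g (mpoly_var v) = g v"
  by (simp add: mpoly_var_def mpoly_const_simps)

section \<open>Rank, closure and flats\<close>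

context matroid
begin

abbreviation rk :: "'a set \<Rightarrow> nat" where
  "rk \<equiv> matroid_rank indep"

abbreviation is_flat :: "'a set \<Rightarrow> bool" where
  "is_flat \<equiv> flat E indep"

lemma finite_indep_subsets: "finite {B. B \<subseteq> A \<and> indep B}"
  by (rule finite_subset[of _ "Pow E"]) (auto dest: indep_subset_ground simp: finite_ground)

lemma indep_finite: "indep B \<Longrightarrow> finite B"
  using finite_ground finite_subset indep_subset_ground by blast

lemma rk_attained: "\<exists>B. B \<subseteq> A \<and> indep B \<and> card B = rk A"
proof -
  have "rk A \<in> card ` {B. B \<subseteq> A \<and> indep B}"
    unfolding matroid_rank_def using finite_indep_subsets indep_empty by (intro Max_in) auto
  then show ?thesis by auto
qed

lemma card_le_rk: "indep B \<Longrightarrow> B \<subseteq> A \<Longrightarrow> card B \<le> rk A"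
  unfolding matroid_rank_def using finite_indep_subsets by (intro Max_ge) auto

lemma rk_mono: "A \<subseteq> B \<Longrightarrow> rk A \<le> rk B"
  using rk_attained[of A] card_le_rk by (metis subset_trans)

lemma rk_empty [simp]: "rk {} = 0"
  using rk_attained[of "{}"] by auto

lemma indep_extend:
  assumes "indep B" "B \<subseteq> A"
  shows "\<exists>C. B \<subseteq> C \<and> C \<subseteq> A \<and> indep C \<and> card C = rk A"
  using assms
proof (induction "rk A - card B" arbitrary: B rule: less_induct)
  case less
  show ?case
  proof (cases "card B < rk A")
    case True
    obtain C where C: "C \<subseteq> A" "indep C" "card C = rk A" using rk_attained by blast
    then obtain y where y: "y \<in> C - B" "indep (insert y B)" using augment[OF less.prems(1) C(2)] True by auto
    have "card (insert y B) = Suc (card B)" using y indep_finite[OF less.prems(1)] by auto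
    then have "rk A - card (insert y B) < rk A - card B" using True by simp
    moreover have "insert y B \<subseteq> A" using y C(1) less.prems by blast
    ultimately obtain D where "insert y B \<subseteq> D" "D \<subseteq> A" "indep D" "card D = rk A"
      using less.hyps[of "insert y B"] y by blast
    then show ?thesis by blast
  next
    case False
    then have "card B = rk A" using card_le_rk less.prems by (simp add: le_antisym not_less)
    then show ?thesis using less.prems by blast
  qed
qed

text \<open>A maximal independent set of the intersection is extended inside \<open>A\<close> and
  then inside the union. The resulting set \<open>K\<close> meets \<open>B\<close> in an independent
  set, and counting \<open>K\<close> through its parts in \<open>A\<close> and in \<open>B\<close>
  gives the bound.\<close>

lemma rk_submodular: "rk (A \<union> B) + rk (A \<inter> B) \<le> rk A + rk B"
proof -
  obtain I where I: "I \<subseteq> A \<inter> B" "indep I" "card I = rk (A \<inter> B)" using rk_attained by blast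
  then obtain J where J: "I \<subseteq> J" "J \<subseteq> A" "indep J" "card J = rk A"
    using indep_extend[of I A] by auto
  then obtain K where K: "J \<subseteq> K" "K \<subseteq> A \<union> B" "indep K" "card K = rk (A \<union> B)"
    using indep_extend[of J "A \<union> B"] by auto
  have finK: "finite K" using K indep_finite by auto
  \<comment> \<open>\<open>J\<close> already has the largest possible size inside \<open>A\<close>,
    so extending it to \<open>K\<close> adds nothing from \<open>A\<close>.\<close>
  have KA: "K \<inter> A = J"
  proof -
    have "card (K \<inter> A) \<le> rk A" using card_le_rk[of "K \<inter> A" A] K indep_subset by auto
    then show ?thesis using J K finK by (intro card_seteq[symmetric]) auto
  qed
  have "indep (K \<inter> B)" using K indep_subset by auto
  then have "card (K \<inter> B) \<le> rk B" using card_le_rk by auto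
  moreover have "card (K \<inter> A \<inter> (K \<inter> B)) \<ge> card I"
    using I J K finK by (intro card_mono) auto
  moreover have "card (K \<inter> A) + card (K \<inter> B) = card ((K \<inter> A) \<union> (K \<inter> B)) + card (K \<inter> A \<inter> (K \<inter> B))"
    using finK by (intro card_Un_Int) auto
  moreover have "(K \<inter> A) \<union> (K \<inter> B) = K" using K by auto
  ultimately show ?thesis using I J K KA by auto
qed

lemma rk_insert_le: "rk (insert e A) \<le> Suc (rk A)"
proof -
  have "rk {e} \<le> 1"
  proof -
    obtain B where "B \<subseteq> {e}" "card B = rk {e}" using rk_attained by blast
    then show ?thesis using card_mono[of "{e}" B] by auto
  qed
  then show ?thesis using rk_submodular[of A "{e}"] by auto
qed

section \<open>Closure, covers and intermediate flats\<close>

definition closure :: "'a set \<Rightarrow> 'a set" where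
  "closure A = {e \<in> E. rk (insert e A) = rk A}"

lemma closure_subset_ground: "closure A \<subseteq> E"
  by (auto simp: closure_def)

lemma subset_closure: "A \<subseteq> E \<Longrightarrow> A \<subseteq> closure A"
  by (auto simp: closure_def insert_absorb)

lemma rk_Un_closure:
  assumes "B \<subseteq> closure A"
  shows "rk (A \<union> B) = rk A"
proof -
  have "finite B" using assms closure_subset_ground finite_ground finite_subset by metis
  then show ?thesis using assms
  proof (induction B rule: finite_induct)
    case (insert x B)
    have "rk (A \<union> insert x B) + rk ((A \<union> B) \<inter> insert x A) \<le> rk (A \<union> B) + rk (insert x A)"
      using rk_submodular[of "A \<union> B" "insert x A"] by (simp add: Un_ac)
    moreover have "rk (insert x A) = rk A" using insert by (auto simp: closure_def)
    moreover have "rk A \<le> rk ((A \<union> B) \<inter> insert x A)" by (intro rk_mono) auto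
    moreover have "rk A \<le> rk (A \<union> insert x B)" by (intro rk_mono) auto
    ultimately show ?case using insert by auto
  qed auto
qed

lemma rk_closure: "A \<subseteq> E \<Longrightarrow> rk (closure A) = rk A"
  using rk_Un_closure[of "closure A" A] subset_closure by (simp add: Un_absorb1)

lemma flat_subset: "is_flat F \<Longrightarrow> F \<subseteq> E"
  by (auto simp: flat_def)

lemma flat_closure: 
  assumes "A \<subseteq> E" shows "is_flat (closure A)"
  unfolding flat_def
proof (intro conjI ballI closure_subset_ground)
  fix e assume e: "e \<in> E - closure A"
  then have "rk A < rk (insert e A)"
    using rk_mono[of A "insert e A"] by (auto simp: closure_def subset_insertI)
  also have "\<dots> \<le> rk (insert e (closure A))" using subset_closure[OF assms] by (intro rk_mono) auto
  finally show "rk (closure A) < rk (insert e (closure A))" using rk_closure[OF assms] by simp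
qed

lemma rk_insert_flat:
  assumes "is_flat F" "e \<in> E - F"
  shows "rk (insert e F) = Suc (rk F)"
proof -
  have "rk F < rk (insert e F)" using assms by (auto simp: flat_def)
  then show ?thesis using rk_insert_le[of e F] by simp
qed

text \<open>By submodularity rank increments shrink on larger sets: an element that does not raise
  the rank of \<open>A\<close> cannot raise that of a flat containing \<open>A\<close>.\<close>

lemma closure_minimal:
  assumes "is_flat F" "A \<subseteq> F"
  shows "closure A \<subseteq> F"
proof
  fix e assume e: "e \<in> closure A"
  show "e \<in> F"
  proof (rule ccontr)
    assume "e \<notin> F"
    then have "rk (insert e F) = Suc (rk F)" using rk_insert_flat assms e closure_subset_ground by blast
    moreover have "rk (F \<union> insert e A) + rk (F \<inter> insert e A) \<le> rk F + rk (insert e A)"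
      by (rule rk_submodular)
    moreover have "F \<union> insert e A = insert e F" "F \<inter> insert e A = A" using assms \<open>e \<notin> F\<close> by auto
    ultimately show False using e by (auto simp: closure_def)
  qed
qed

lemma flat_Int:
  assumes "is_flat F" "is_flat G"
  shows "is_flat (F \<inter> G)"
proof -
  have "closure (F \<inter> G) \<subseteq> F \<inter> G" using closure_minimal assms by auto
  then have "closure (F \<inter> G) = F \<inter> G" using subset_closure[of "F \<inter> G"] flat_subset[OF assms(1)] by auto
  then show ?thesis using flat_closure[of "F \<inter> G"] flat_subset[OF assms(1)] by auto
qed

lemma flat_psubset_rk:
  assumes "is_flat F" "F \<subset> G" "G \<subseteq> E"
  shows "rk F < rk G"
proof -
  obtain e where e: "e \<in> G - F" using assms by auto
  then have "rk F < rk (insert e F)" using assms by (auto simp: flat_def)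
  also have "\<dots> \<le> rk G" using e assms by (intro rk_mono) auto
  finally show ?thesis .
qed

lemma flat_eq_of_rk: "is_flat F \<Longrightarrow> is_flat G \<Longrightarrow> F \<subseteq> G \<Longrightarrow> rk G \<le> rk F \<Longrightarrow> F = G"
  using flat_psubset_rk[of F G] flat_subset by (meson leD psubsetI)

lemma rk_closure_insert:
  "is_flat F \<Longrightarrow> e \<in> E - F \<Longrightarrow> rk (closure (insert e F)) = Suc (rk F)"
  using rk_insert_flat rk_closure flat_subset by (metis Diff_iff insert_subset)

text \<open>\<open>Y\<close> is the closure of \<open>H\<close> together with \<open>i\<close>,
  since the two flats have equal rank. In a sum over the flats through \<open>H\<close> and
  \<open>i\<close>, \<open>Y\<close> is therefore the smallest index, and all others lie strictly
  above it.\<close>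

lemma cover_minimal:
  assumes "is_flat H" "is_flat Y" "H \<subseteq> Y" "rk Y = Suc (rk H)" "i \<in> Y - H"
    and "is_flat G" "H \<subseteq> G" "i \<in> G"
  shows "Y \<subseteq> G"
proof -
  have i: "i \<in> E - H" using assms flat_subset by blast
  have sub: "insert i H \<subseteq> E" using i flat_subset assms by auto
  have "closure (insert i H) = Y"
    using closure_minimal[of Y "insert i H"] rk_closure_insert[OF assms(1) i] assms sub
    by (intro flat_eq_of_rk flat_closure) auto
  then show ?thesis using closure_minimal[of G "insert i H"] assms by auto
qed

lemma flat_between:
  assumes "is_flat H" "is_flat Y" "H \<subseteq> Y" "rk H \<le> k" "k \<le> rk Y"
  shows "\<exists>G. is_flat G \<and> H \<subseteq> G \<and> G \<subseteq> Y \<and> rk G = k"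
  using assms(4,5)
proof (induction k rule: dec_induct)
  case base
  show ?case using assms by blast
next
  case (step k)
  then obtain G where G: "is_flat G" "H \<subseteq> G" "G \<subseteq> Y" "rk G = k" by auto
  then have "G \<noteq> Y" using step by auto
  then obtain e where e: "e \<in> Y - G" using G by auto
  then have eE: "e \<in> E - G" using flat_subset assms by blast
  have sub: "insert e G \<subseteq> E" using eE flat_subset[OF G(1)] by auto
  have "rk (closure (insert e G)) = Suc k" using rk_closure_insert[OF G(1) eE] G by simp
  moreover have "closure (insert e G) \<subseteq> Y" using e G by (intro closure_minimal assms) auto
  moreover have "H \<subseteq> closure (insert e G)" using subset_closure[OF sub] G by auto
  ultimately show ?case using flat_closure[OF sub] by auto
qed

lemma flats_finite: "finite {F. is_flat F}"
  by (rule finite_subset[of _ "Pow E"]) (auto simp: finite_ground dest: flat_subset)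

lemma nonempty_flats_iff: "F \<in> nonempty_flats E indep \<longleftrightarrow> is_flat F \<and> F \<noteq> {}"
  by (auto simp: nonempty_flats_def)

lemma finite_nonempty_flats: "finite (nonempty_flats E indep)"
  using flats_finite by (auto simp: nonempty_flats_def)

end

context simple_matroid
begin

lemma rk_singleton: "e \<in> E \<Longrightarrow> rk {e} = 1"
  using card_le_rk[of "{e}" "{e}"] rk_insert_le[of e "{}"] no_loops[of e] by (auto simp: loop_def)

lemma flat_empty: "is_flat {}"
  using rk_singleton by (auto simp: flat_def)

lemma rk_pos: "is_flat F \<Longrightarrow> F \<noteq> {} \<Longrightarrow> 0 < rk F"
  using flat_psubset_rk[of "{}" F] flat_empty flat_subset[of F] by (simp add: psubset_eq)

end

section \<open>Degree functionals\<close>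

context simple_matroid
begin

abbreviation NF :: "'a set set" where
  "NF \<equiv> nonempty_flats E indep"

abbreviation flat_var :: "'a set \<Rightarrow> ('a set, rat) mpoly" where
  "flat_var \<equiv> mpoly_var"

section \<open>The dragon Hall-Rado condition and uncrossing\<close>

definition below :: "'a set \<Rightarrow> ('a set \<Rightarrow>\<^sub>0 nat) \<Rightarrow> nat" where
  "below Z m = weight (\<lambda>G. of_bool (G \<subseteq> Z)) m"

lemma below_simps [simp]:
  "below Z 0 = 0" "below Z (Poly_Mapping.single G k) = k * of_bool (G \<subseteq> Z)"
  "below Z (m + m') = below Z m + below Z m'"
  by (simp_all add: below_def)

lemma below_le_degree: "below Z m \<le> monomial_degree m"
  unfolding below_def monomial_degree_weight by (rule weight_mono) auto

lemma below_mono: "Z \<subseteq> Z' \<Longrightarrow> below Z m \<le> below Z' m"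
  unfolding below_def by (rule weight_mono) auto

lemma below_supermodular:
  assumes "A \<union> B \<subseteq> C"
  shows "below A m + below B m \<le> below C m + below (A \<inter> B) m"
  unfolding below_def weight_fun_add[symmetric] using assms by (intro weight_mono) auto

text \<open>The dragon Hall--Rado condition of Postnikov, in the form of Backman, Eur and Simpson.\<close>

definition hall_rado :: "('a set \<Rightarrow>\<^sub>0 nat) \<Rightarrow> bool" where
  "hall_rado m \<longleftrightarrow> (\<forall>Z. is_flat Z \<longrightarrow> below Z m = 0 \<or> below Z m < rk Z)"

lemma hall_rado_antimono:
  "hall_rado m' \<Longrightarrow> (\<And>Z. is_flat Z \<Longrightarrow> below Z m \<le> below Z m') \<Longrightarrow> hall_rado m"
  unfolding hall_rado_def by (metis le_0_eq le_less_trans)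

text \<open>Only flats above \<open>G\<close> see the extra variable; they have rank above
  \<open>n\<close>, while the enlarged monomial has degree at most \<open>n\<close>.\<close>

lemma hall_rado_iff_large:
  assumes "monomial_degree m < n" "\<And>Z. is_flat Z \<Longrightarrow> G \<subseteq> Z \<Longrightarrow> n < rk Z"
  shows "hall_rado (Poly_Mapping.single G 1 + m) \<longleftrightarrow> hall_rado m"
proof
  assume m: "hall_rado m"
  show "hall_rado (Poly_Mapping.single G 1 + m)"
    unfolding hall_rado_def
  proof (intro allI impI)
    fix Z assume Z: "is_flat Z"
    show "below Z (Poly_Mapping.single G 1 + m) = 0 \<or> below Z (Poly_Mapping.single G 1 + m) < rk Z"
    proof (cases "G \<subseteq> Z")
      case True
      then have "n < rk Z" using assms Z by auto
      moreover have "below Z m < n" using assms below_le_degree le_less_trans by blast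
      ultimately show ?thesis using True by simp
    next
      case False
      then show ?thesis using m Z by (auto simp: hall_rado_def)
    qed
  qed
qed (erule hall_rado_antimono, simp)

text \<open>The uncrossing argument: two flats that violate the condition for \<open>{J, F}\<close> and for \<open>{J, G}\<close>
  have a join that violates it for \<open>{J, J}\<close>.\<close>

lemma hall_rado_exchange:
  fixes m :: "'a set \<Rightarrow>\<^sub>0 nat"
  assumes F: "is_flat F" and G: "is_flat G"
  defines "J \<equiv> closure (F \<union> G)"
  defines "e \<equiv> \<lambda>A. Poly_Mapping.single A (1::nat)"
  shows "(of_bool (hall_rado (e F + (e G + m))) + of_bool (hall_rado (e J + (e J + m))) :: rat)
       = of_bool (hall_rado (e J + (e F + m))) + of_bool (hall_rado (e J + (e G + m)))"
proof -
  have sub: "F \<union> G \<subseteq> E" using F G flat_subset by auto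
  have FJ: "F \<subseteq> J" "G \<subseteq> J" using subset_closure[OF sub] by (auto simp: J_def)
  have Jmin: "J \<subseteq> Z" if "is_flat Z" "F \<subseteq> Z" "G \<subseteq> Z" for Z
    unfolding J_def using that by (intro closure_minimal) auto
  \<comment> \<open>Write a and b for the conditions on \<open>{J, F}\<close> and
    \<open>{J, G}\<close>. Facts 1 and 2 say that the condition on \<open>{F, G}\<close> is "a and
    b", facts 1 and 3 that the one on \<open>{J, J}\<close> is "a or b"; the identity counts truth
    values.\<close>
  have 1: "hall_rado (e J + (e F + m)) \<Longrightarrow> hall_rado (e J + (e J + m))"
          "hall_rado (e J + (e G + m)) \<Longrightarrow> hall_rado (e J + (e J + m))"
          "hall_rado (e F + (e G + m)) \<Longrightarrow> hall_rado (e J + (e F + m))"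
          "hall_rado (e F + (e G + m)) \<Longrightarrow> hall_rado (e J + (e G + m))"
    by (erule hall_rado_antimono; use FJ in \<open>auto simp: e_def\<close>)+
  have 2: "hall_rado (e F + (e G + m))"
    if a: "hall_rado (e J + (e F + m))" and b: "hall_rado (e J + (e G + m))"
    unfolding hall_rado_def
  proof (intro allI impI)
    fix Z assume Z: "is_flat Z"
    have "below Z (e J + (e F + m)) = 0 \<or> below Z (e J + (e F + m)) < rk Z"
      "below Z (e J + (e G + m)) = 0 \<or> below Z (e J + (e G + m)) < rk Z"
      using a b Z by (auto simp: hall_rado_def)
    moreover have "\<not> J \<subseteq> Z" if "\<not> F \<subseteq> Z \<or> \<not> G \<subseteq> Z" using that FJ by auto
    ultimately show "below Z (e F + (e G + m)) = 0 \<or> below Z (e F + (e G + m)) < rk Z"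
      using Jmin[OF Z] by (cases "F \<subseteq> Z"; cases "G \<subseteq> Z") (auto simp: e_def)
  qed
  have 3: "hall_rado (e J + (e F + m)) \<or> hall_rado (e J + (e G + m))"
    if JJ: "hall_rado (e J + (e J + m))"
  proof (rule ccontr)
    assume neg: "\<not> ?thesis"
    have viol: "\<exists>Z. is_flat Z \<and> A \<subseteq> Z \<and> \<not> J \<subseteq> Z \<and> rk Z \<le> below Z m + 1"
      if "\<not> hall_rado (e J + (e A + m))" "A \<subseteq> J" for A
    proof -
      obtain Z where Z: "is_flat Z" "below Z (e J + (e A + m)) \<noteq> 0" "rk Z \<le> below Z (e J + (e A + m))"
        using \<open>\<not> hall_rado (e J + (e A + m))\<close> unfolding hall_rado_def by auto
      have jj: "below Z (e J + (e J + m)) = 0 \<or> below Z (e J + (e J + m)) < rk Z"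
        using JJ Z by (auto simp: hall_rado_def)
      \<comment> \<open>Above \<open>J\<close> the variables of \<open>A\<close> and
        \<open>J\<close> count alike, so \<open>Z\<close> would also violate the condition for
        \<open>{J, J}\<close>. Likewise, if \<open>Z\<close> contained neither \<open>J\<close> nor
        \<open>A\<close>, both counts would be \<open>below Z m\<close>.\<close>
      have nJ: "\<not> J \<subseteq> Z" using Z jj by (cases "A \<subseteq> Z") (auto simp: e_def)
      moreover have "A \<subseteq> Z" using Z jj nJ by (cases "A \<subseteq> Z") (auto simp: e_def)
      ultimately show ?thesis using Z by (auto simp: e_def)
    qed
    obtain U where U: "is_flat U" "F \<subseteq> U" "\<not> J \<subseteq> U" "rk U \<le> below U m + 1"
      using viol[of F] neg FJ by auto
    obtain Y where Y: "is_flat Y" "G \<subseteq> Y" "\<not> J \<subseteq> Y" "rk Y \<le> below Y m + 1"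
      using viol[of G] neg FJ by auto
    have XY: "U \<union> Y \<subseteq> E" using U Y flat_subset by auto
    let ?C = "closure (U \<union> Y)"
    have C: "is_flat ?C" "U \<union> Y \<subseteq> ?C" using flat_closure[OF XY] subset_closure[OF XY] by auto
    have "J \<subseteq> ?C" using Jmin[OF C(1)] U Y C(2) by auto
    \<comment> \<open>Both copies of \<open>J\<close> lie below the join, so the count is positive
      and the strict bound applies. At the intersection a weak bound is enough, and it holds in the
      zero case too.\<close>
    then have "below ?C m + 2 < rk ?C"
      using JJ C(1) unfolding hall_rado_def by (auto simp: e_def)
    moreover have "below (U \<inter> Y) m \<le> rk (U \<inter> Y)"
      using JJ flat_Int[OF U(1) Y(1)] unfolding hall_rado_def by fastforce
    moreover have "below U m + below Y m \<le> below ?C m + below (U \<inter> Y) m"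
      using below_supermodular C(2) by blast
    moreover have "rk ?C = rk (U \<union> Y)" using rk_closure[OF XY] .
    ultimately show False using U(4) Y(4) rk_submodular[of U Y] by linarith
  qed
  show ?thesis using 1 2 3 by (auto simp: of_bool_def)
qed

text \<open>If \<open>flat_var G\<close> stands for \<open>h\<^sub>G\<close>, this is the degree map of the restriction to \<open>F\<close>, truncated to
  rank \<open>n + 1\<close>.\<close>

definition degree_form :: "'a set \<Rightarrow> nat \<Rightarrow> ('a set, rat) mpoly \<Rightarrow> rat" where
  "degree_form F n = linear_ext (\<lambda>m. of_bool (monomial_degree m = n \<and> below F m = n \<and> hall_rado m))"

lemma degree_form_simps [simp]:
  "degree_form F n 0 = 0" "degree_form F n (p + q) = degree_form F n p + degree_form F n q"
  "degree_form F n (- p) = - degree_form F n p" "degree_form F n (p - q) = degree_form F n p - degree_form F n q"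
  by (simp_all add: degree_form_def)

lemma degree_form_sum: "degree_form F n (sum f A) = (\<Sum>a\<in>A. degree_form F n (f a))"
  by (simp add: degree_form_def linear_ext_sum)

text \<open>Both sides are linear in \<open>q\<close>. Two flats and two degrees appear because
  degree maps of different restrictions and truncations will be compared.\<close>

lemma degree_form_monomial_induct:
  assumes "\<And>m. degree_form F n (u * Poly_Mapping.single m 1) = degree_form F' n' (v * Poly_Mapping.single m 1)"
  shows "degree_form F n (u * q) = degree_form F' n' (v * q)"
proof (induction q rule: poly_mapping_add_induct)
  case (add m c q)
  have scale: "degree_form A k (mpoly_const c * x) = c * degree_form A k x" for A k x
    by (induction x rule: poly_mapping_add_induct)
      (auto simp: degree_form_def mpoly_const_def mult_single algebra_simps)
  have "w * Poly_Mapping.single m c = mpoly_const c * (w * Poly_Mapping.single m 1)" for w :: "('a set, rat) mpoly"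
    by (simp add: mpoly_const_def mult_single mult.left_commute)
  then have "degree_form F n (u * Poly_Mapping.single m c) = degree_form F' n' (v * Poly_Mapping.single m c)"
    by (simp only: scale assms)
  then show ?case using add by (simp add: algebra_simps)
qed auto

lemma degree_form_var_monomial:
  "degree_form F n (flat_var A * Poly_Mapping.single m 1) =
    of_bool (monomial_degree m + 1 = n \<and> A \<subseteq> F \<and> below F m + 1 = n \<and> hall_rado (Poly_Mapping.single A 1 + m))"
  using below_le_degree[of F m]
  by (auto simp: degree_form_def mpoly_var_def mult_single of_bool_def)

lemma degree_form_monomial:
  "degree_form F n (Poly_Mapping.single m 1) = of_bool (monomial_degree m = n \<and> below F m = n \<and> hall_rado m)"
  by (auto simp: degree_form_def)

lemma degree_form_not_below:
  assumes "\<not> G \<subseteq> F" shows "degree_form F n (flat_var G * q) = 0"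
  using degree_form_monomial_induct[of F n "flat_var G" F n 0 q] assms
  by (simp add: degree_form_var_monomial)

text \<open>A flat of rank at most one violates the condition as soon as its own variable occurs.
  This is the form that the linear relations take in the variables \<open>h\<close>.\<close>

lemma degree_form_atom:
  assumes "is_flat G" "rk G \<le> 1" shows "degree_form F n (flat_var G * q) = 0"
proof -
  have "\<not> hall_rado (Poly_Mapping.single G 1 + m)" for m
    using assms unfolding hall_rado_def by auto
  then show ?thesis
    using degree_form_monomial_induct[of F n "flat_var G" F n 0 q]
    by (simp add: degree_form_var_monomial)
qed

text \<open>Truncation to rank \<open>n + 1\<close> identifies every flat of rank above
  \<open>n\<close> with the top, so \<open>h_G\<close> imposes no condition and only lowers the
  degree. The factor \<open>of_bool\<close> makes the value zero for \<open>n = 0\<close>, where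
  \<open>n - 1\<close> is cut off.\<close>

lemma degree_form_large:
  assumes "is_flat F" "is_flat G" "G \<subseteq> F" "n < rk G"
  shows "degree_form F n (flat_var G * q) = degree_form F (n - 1) (of_bool (n \<noteq> 0) * q)"
proof (rule degree_form_monomial_induct)
  fix m
  have "rk G \<le> rk Z" if "G \<subseteq> Z" for Z using that by (rule rk_mono)
  then have "hall_rado (Poly_Mapping.single G 1 + m) \<longleftrightarrow> hall_rado m" if "monomial_degree m < n"
    using hall_rado_iff_large[of m n G] that assms by (meson less_le_trans)
  then show "degree_form F n (flat_var G * Poly_Mapping.single m 1) =
    degree_form F (n - 1) (of_bool (n \<noteq> 0) * Poly_Mapping.single m 1)"
    using assms by (cases n) (auto simp: degree_form_var_monomial degree_form_monomial)
qed

lemma degree_form_top: "is_flat F \<Longrightarrow> n < rk F \<Longrightarrow> n \<noteq> 0 \<Longrightarrow> degree_form F n (flat_var F * q) = degree_form F (n - 1) q"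
  using degree_form_large[of F F n q] by simp

text \<open>Multiplying by \<open>h_F\<close> costs nothing, while multiplying by \<open>h_Y\<close>
  excludes exactly the monomials all of whose variables lie below \<open>Y\<close>, since
  \<open>Y\<close> has rank \<open>n\<close>. The difference counts these monomials, and they are
  the ones that the restriction to \<open>Y\<close> sees.\<close>

lemma degree_form_coatom:
  assumes F: "is_flat F" and Y: "is_flat Y" "Y \<subset> F" "rk Y = n" "n \<noteq> 0"
  shows "degree_form F n ((flat_var F - flat_var Y) * q) = degree_form Y (n - 1) (1 * q)"
proof (rule degree_form_monomial_induct)
  fix m
  have nF: "n < rk F" using flat_psubset_rk[OF Y(1,2)] flat_subset[OF F] Y by simp
  have "degree_form F n (flat_var F * Poly_Mapping.single m 1) = degree_form F (n - 1) (Poly_Mapping.single m 1)"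
    using degree_form_top F nF Y by blast
  then have top: "degree_form F n (flat_var F * Poly_Mapping.single m 1)
      = of_bool (monomial_degree m = n - 1 \<and> below F m = n - 1 \<and> hall_rado m)"
    by (simp add: degree_form_monomial)
  have bb: "below Y m \<le> below F m" "below F m \<le> monomial_degree m"
    using Y below_mono below_le_degree by auto
  have key: "hall_rado (Poly_Mapping.single Y 1 + m) \<longleftrightarrow> below Y m \<noteq> n - 1"
    if m: "hall_rado m" "monomial_degree m = n - 1"
  proof
    assume "hall_rado (Poly_Mapping.single Y 1 + m)"
    then show "below Y m \<noteq> n - 1" using Y unfolding hall_rado_def by auto
  next
    assume ne: "below Y m \<noteq> n - 1"
    show "hall_rado (Poly_Mapping.single Y 1 + m)"
      unfolding hall_rado_def
    proof (intro allI impI)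
      fix Z assume Z: "is_flat Z"
      show "below Z (Poly_Mapping.single Y 1 + m) = 0 \<or> below Z (Poly_Mapping.single Y 1 + m) < rk Z"
      proof (cases "Y \<subseteq> Z")
        case True
        then have "n \<le> rk Z" using Y(3) rk_mono[OF True] by simp
        moreover have "below Z m \<le> n - 1" using below_le_degree[of Z m] m(2) by simp
        \<comment> \<open>A flat of rank \<open>n\<close> above \<open>Y\<close> is \<open>Y\<close>
          itself, where \<open>ne\<close> applies. Any other flat above \<open>Y\<close> has rank
          over \<open>n\<close> and cannot be violated in total degree \<open>n\<close>.\<close>
        moreover have "below Z m \<noteq> n - 1 \<or> rk Z \<noteq> n"
        proof (rule ccontr)
          assume "\<not> ?thesis"
          then have "Y = Z" "below Z m = n - 1" using flat_eq_of_rk[OF Y(1) Z True] Y(3) by simp_all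
          then show False using ne by simp
        qed
        moreover have "below Z (Poly_Mapping.single Y 1 + m) = below Z m + 1" using True by simp
        ultimately show ?thesis using Y(4) by linarith
      next
        case False
        then show ?thesis using m Z by (auto simp: hall_rado_def)
      qed
    qed
  qed
  have anti: "hall_rado (Poly_Mapping.single Y 1 + m) \<Longrightarrow> hall_rado m"
    by (erule hall_rado_antimono) simp
  have "degree_form F n ((flat_var F - flat_var Y) * Poly_Mapping.single m 1) =
      of_bool (monomial_degree m = n - 1 \<and> below F m = n - 1 \<and> hall_rado m)
      - of_bool (monomial_degree m = n - 1 \<and> below F m = n - 1 \<and> hall_rado (Poly_Mapping.single Y 1 + m))"
    using top Y by (cases n) (auto simp: left_diff_distrib degree_form_var_monomial)
  also have "\<dots> = of_bool (monomial_degree m = n - 1 \<and> below Y m = n - 1 \<and> hall_rado m)"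
    using key anti bb by auto
  finally show "degree_form F n ((flat_var F - flat_var Y) * Poly_Mapping.single m 1) =
      degree_form Y (n - 1) (1 * Poly_Mapping.single m 1)"
    by (simp add: degree_form_monomial)
qed

text \<open>On a single monomial this is \<open>hall_rado_exchange\<close>. A flat \<open>A\<close>
  contains the join exactly if it contains both \<open>F\<close> and \<open>G\<close>, so in all
  other cases each of the four terms is zero.\<close>

lemma degree_form_exchange:
  assumes A: "is_flat A" and F: "is_flat F" and G: "is_flat G"
  defines "J \<equiv> closure (F \<union> G)"
  shows "degree_form A n ((flat_var F - flat_var J) * (flat_var G - flat_var J) * q) = 0"
proof -
  have sub: "F \<union> G \<subseteq> E" using F G flat_subset by auto
  have FJ: "F \<subseteq> J" "G \<subseteq> J" using subset_closure[OF sub] by (auto simp: J_def)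
  have pair: "degree_form A n (flat_var U * flat_var Y * Poly_Mapping.single m 1) =
      of_bool (monomial_degree m + 2 = n \<and> U \<subseteq> A \<and> Y \<subseteq> A \<and> below A m + 2 = n) *
      of_bool (hall_rado (Poly_Mapping.single U 1 + (Poly_Mapping.single Y 1 + m)))" for U Y m
  proof -
    have eq: "flat_var U * flat_var Y * Poly_Mapping.single m 1
        = Poly_Mapping.single (Poly_Mapping.single U 1 + (Poly_Mapping.single Y 1 + m)) 1"
      by (simp add: mpoly_var_def mult_single add.assoc)
    show ?thesis
      unfolding eq degree_form_monomial using below_le_degree[of A m]
      by (cases "U \<subseteq> A"; cases "Y \<subseteq> A") auto
  qed
  have "degree_form A n ((flat_var F - flat_var J) * (flat_var G - flat_var J) * q) = degree_form A n (0 * q)"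
  proof (rule degree_form_monomial_induct)
    fix m
    let ?f = "\<lambda>U Y. degree_form A n (flat_var U * flat_var Y * Poly_Mapping.single m 1)"
    let ?h = "\<lambda>U Y. of_bool (hall_rado (Poly_Mapping.single U 1 + (Poly_Mapping.single Y 1 + m))) :: rat"
    have "(flat_var F - flat_var J) * (flat_var G - flat_var J) * Poly_Mapping.single m 1 =
      flat_var F * flat_var G * Poly_Mapping.single m 1 + flat_var J * flat_var J * Poly_Mapping.single m 1
      - flat_var J * flat_var F * Poly_Mapping.single m 1 - flat_var J * flat_var G * Poly_Mapping.single m 1"
      by (simp add: algebra_simps)
    then have "degree_form A n ((flat_var F - flat_var J) * (flat_var G - flat_var J) * Poly_Mapping.single m 1)
      = ?f F G + ?f J J - ?f J F - ?f J G" by simp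
    also have "\<dots> = 0"
    proof (cases "F \<subseteq> A \<and> G \<subseteq> A \<and> J \<subseteq> A")
      case True
      have "?h F G + ?h J J = ?h J F + ?h J G"
        using hall_rado_exchange[OF F G, of m] by (simp add: J_def)
      then show ?thesis using True unfolding pair by (auto simp: algebra_simps)
    next
      case False
      then have "\<not> (F \<subseteq> A \<and> G \<subseteq> A)" "\<not> J \<subseteq> A"
        using closure_minimal[OF A, of "F \<union> G"] FJ by (auto simp: J_def)
      then show ?thesis unfolding pair by auto
    qed
    finally show "degree_form A n ((flat_var F - flat_var J) * (flat_var G - flat_var J) * Poly_Mapping.single m 1)
      = degree_form A n (0 * Poly_Mapping.single m 1)" by simp
  qed
  then show ?thesis by simp
qed

end

section \<open>Ideals spanned over a subring\<close>

text \<open>The inductive form gives one induction over generators for every statement about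
  members. The coefficients are restricted to \<open>C\<close> because polynomials in the flats form
  only a subset of the type of all polynomials.\<close>

inductive_set ideal_span :: "'b::comm_ring_1 set \<Rightarrow> 'b set \<Rightarrow> 'b set" for C S where
  zero: "0 \<in> ideal_span C S"
| step: "p \<in> ideal_span C S \<Longrightarrow> q \<in> C \<Longrightarrow> g \<in> S \<Longrightarrow> p + q * g \<in> ideal_span C S"

lemma ideal_span_add:
  assumes "p \<in> ideal_span C S" "p' \<in> ideal_span C S"
  shows "p + p' \<in> ideal_span C S"
  using assms(2,1)
  by (induction p' rule: ideal_span.induct)
    (auto simp: add.assoc[symmetric] intro: ideal_span.intros)

lemma ideal_span_mult:
  assumes "\<And>a b. a \<in> C \<Longrightarrow> b \<in> C \<Longrightarrow> a * b \<in> C" and "p \<in> ideal_span C S" "r \<in> C"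
  shows "r * p \<in> ideal_span C S"
  using assms(2)
proof (induction p rule: ideal_span.induct)
  case (step p q g)
  have "r * p + (r * q) * g \<in> ideal_span C S" using step assms by (intro ideal_span.step) auto
  then show ?case by (simp add: algebra_simps)
qed (simp add: ideal_span.zero)

lemma ideal_span_functional_zero:
  fixes L :: "'b::comm_ring_1 \<Rightarrow> 'c::ab_group_add"
  assumes "L 0 = 0" "\<And>a b. L (a + b) = L a + L b" "\<And>q g. q \<in> C \<Longrightarrow> g \<in> S \<Longrightarrow> L (q * g) = 0"
    and "p \<in> ideal_span C S"
  shows "L p = 0"
  using assms(4) by (induction p rule: ideal_span.induct) (auto simp: assms)

section \<open>Functionals on the polynomial ring of the flats\<close>

context simple_matroid
begin

text \<open>The expression of \<open>x\<^sub>G\<close> in the variables \<open>h\<^sub>H\<close>, for which \<open>flat_var H\<close> stands on the right-hand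
  side; the recursion replaces Moebius inversion.\<close>

function dual_var :: "'a set \<Rightarrow> ('a set, rat) mpoly" where
  "dual_var G = - flat_var G - (\<Sum>H \<in> {H \<in> NF. G \<subset> H}. dual_var H)"
  by auto
termination
proof (relation "measure (\<lambda>G. card E - card G)")
  fix G H assume "H \<in> {H \<in> NF. G \<subset> H}"
  then have "H \<subseteq> E" "G \<subset> H" by (auto simp: nonempty_flats_iff flat_subset)
  then have "card G < card H" "card H \<le> card E"
    using finite_ground by (meson finite_subset psubset_card_mono card_mono)+
  then show "(H, G) \<in> measure (\<lambda>G. card E - card G)" by auto
qed auto

declare dual_var.simps [simp del]

lemma sum_dual_var:
  assumes "G \<in> NF" shows "(\<Sum>H \<in> {H \<in> NF. G \<subseteq> H}. dual_var H) = - flat_var G"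
proof -
  have "{H \<in> NF. G \<subseteq> H} = insert G {H \<in> NF. G \<subset> H}" using assms by auto
  then show ?thesis using finite_nonempty_flats by (simp add: dual_var.simps[of G])
qed

section \<open>The variables x under the degree maps\<close>

lemma degree_form_dual_not_below:
  "\<not> G \<subseteq> F \<Longrightarrow> degree_form F n (dual_var G * r) = 0"
proof (induction G rule: dual_var.induct)
  case (1 G)
  have "degree_form F n (dual_var H * r) = 0" if "H \<in> {H \<in> NF. G \<subset> H}" for H
    using 1 that by auto
  then show ?case
    using 1 by (subst dual_var.simps) (simp add: left_diff_distrib sum_distrib_right degree_form_sum degree_form_not_below)
qed

lemma degree_form_dual_self: "degree_form F n (dual_var F * r) = - degree_form F n (flat_var F * r)"
proof -
  have "degree_form F n (dual_var H * r) = 0" if "H \<in> {H \<in> NF. F \<subset> H}" for H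
    using that by (intro degree_form_dual_not_below) auto
  then show ?thesis
    by (subst dual_var.simps) (simp add: left_diff_distrib sum_distrib_right degree_form_sum)
qed

text \<open>Of the sum over the larger flats only the term of \<open>F\<close> survives. There
  \<open>dual_var F\<close> acts as minus \<open>flat_var F\<close>, and the two signs produce the
  difference.\<close>

lemma degree_form_dual_recursion:
  assumes F: "F \<in> NF" and G: "G \<subset> F"
    and mid: "\<And>H. H \<in> NF \<Longrightarrow> G \<subset> H \<Longrightarrow> H \<subset> F \<Longrightarrow> degree_form F n (dual_var H * r) = 0"
  shows "degree_form F n (dual_var G * r) = degree_form F n ((flat_var F - flat_var G) * r)"
proof -
  have "(\<Sum>H \<in> {H \<in> NF. G \<subset> H}. degree_form F n (dual_var H * r)) =
      (\<Sum>H \<in> {F}. degree_form F n (dual_var H * r))"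
    using finite_nonempty_flats F G mid
    by (intro sum.mono_neutral_right) (auto simp: psubset_eq intro: degree_form_dual_not_below)
  then show ?thesis
    by (subst dual_var.simps) (simp add: left_diff_distrib sum_distrib_right degree_form_sum degree_form_dual_self)
qed

lemma degree_form_dual_top:
  assumes "F \<in> NF" "n < rk F" "n \<noteq> 0"
  shows "degree_form F n (dual_var F * r) = - degree_form F (n - 1) r"
proof -
  show ?thesis using degree_form_top assms nonempty_flats_iff by (simp add: degree_form_dual_self)
qed

text \<open>Going down from the largest flats, all flats strictly between \<open>G\<close> and
  \<open>F\<close> act as zero already; so \<open>dual_var G\<close> acts as the difference of two
  variables that the truncation identifies.\<close>

lemma degree_form_dual_large:
  assumes F: "F \<in> NF" "n < rk F" and "G \<in> NF" "G \<subset> F" "n < rk G"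
  shows "degree_form F n (dual_var G * r) = 0"
  using assms(3-)
proof (induction G rule: dual_var.induct)
  case (1 G)
  have "degree_form F n (dual_var H * r) = 0" if "H \<in> NF" "G \<subset> H" "H \<subset> F" for H
    using that rk_mono[of G H] 1(4) by (intro "1.IH") auto
  then have "degree_form F n (dual_var G * r) = degree_form F n ((flat_var F - flat_var G) * r)"
    using "1.prems" by (intro degree_form_dual_recursion[OF F(1)]) blast+
  also have "\<dots> = 0"
    using F "1.prems" degree_form_large[of F F n r] degree_form_large[of F G n r]
    by (simp add: left_diff_distrib nonempty_flats_iff)
  finally show ?case .
qed

lemma degree_form_dual_coatom:
  assumes F: "F \<in> NF" and Y: "Y \<in> NF" "Y \<subset> F" "rk Y = n"
  shows "degree_form F n (dual_var Y * r) = degree_form Y (n - 1) r"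
proof -
  have flats: "is_flat F" "is_flat Y" "n \<noteq> 0" using F Y rk_pos nonempty_flats_iff by force+
  have nF: "n < rk F" using flat_psubset_rk Y flats flat_subset by metis
  have "n < rk H" if "H \<in> NF" "Y \<subset> H" for H
    using flat_psubset_rk that flats flat_subset Y nonempty_flats_iff by metis
  then have "degree_form F n (dual_var Y * r) = degree_form F n ((flat_var F - flat_var Y) * r)"
    using degree_form_dual_large[OF F nF] F Y by (intro degree_form_dual_recursion) auto
  then show ?thesis using degree_form_coatom[of F Y n r] flats Y by simp
qed

text \<open>Let \<open>?S\<close> be the flats above \<open>F\<close> but not \<open>G\<close>, and
  \<open>?T\<close> those above \<open>G\<close> but not \<open>F\<close>. Their sums are
  \<open>h_J - h_F\<close> and \<open>h_J - h_G\<close>, whose product vanishes by the exchange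
  identity. All pairs in \<open>?S \<times> ?T\<close> are incomparable and all but
  \<open>(F, G)\<close> are strictly larger, so induction from large flats to small ones isolates
  that pair.\<close>

lemma degree_form_dual_incomparable:
  assumes A: "is_flat A" and "F \<in> NF" "G \<in> NF" "\<not> F \<subseteq> G" "\<not> G \<subseteq> F"
  shows "degree_form A n (dual_var F * dual_var G * r) = 0"
  using assms(2-)
proof (induction "(card E - card F) + (card E - card G)" arbitrary: F G rule: less_induct)
  case less
  let ?J = "closure (F \<union> G)"
  let ?S = "{H \<in> NF. F \<subseteq> H \<and> \<not> G \<subseteq> H}" and ?T = "{H \<in> NF. G \<subseteq> H \<and> \<not> F \<subseteq> H}"
  have flats: "is_flat F" "is_flat G" using less by (auto simp: nonempty_flats_iff)
  have sub: "F \<union> G \<subseteq> E" using flats flat_subset by auto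
  have J: "?J \<in> NF" "F \<subseteq> ?J" "G \<subseteq> ?J"
    using flat_closure[OF sub] subset_closure[OF sub] less by (auto simp: nonempty_flats_iff)
  have J_iff: "?J \<subseteq> H \<longleftrightarrow> F \<subseteq> H \<and> G \<subseteq> H" if "H \<in> NF" for H
    using J closure_minimal[of H "F \<union> G"] that by (auto simp: nonempty_flats_iff)
  have part: "(\<Sum>H \<in> {H \<in> NF. B \<subseteq> H \<and> \<not> B' \<subseteq> H}. dual_var H) = flat_var ?J - flat_var B"
    if "B \<in> NF" "\<And>H. H \<in> NF \<Longrightarrow> ?J \<subseteq> H \<longleftrightarrow> B \<subseteq> H \<and> B' \<subseteq> H" for B B'
  proof -
    have "{H \<in> NF. B \<subseteq> H \<and> \<not> B' \<subseteq> H} = {H \<in> NF. B \<subseteq> H} - {H \<in> NF. ?J \<subseteq> H}"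
      using that(2) by auto
    moreover have "{H \<in> NF. ?J \<subseteq> H} \<subseteq> {H \<in> NF. B \<subseteq> H}" using that by auto
    ultimately show ?thesis
      using finite_nonempty_flats that(1) J(1) by (simp add: sum_diff sum_dual_var)
  qed
  have S: "(\<Sum>H\<in>?S. dual_var H) = flat_var ?J - flat_var F"
    and T: "(\<Sum>H\<in>?T. dual_var H) = flat_var ?J - flat_var G"
    using part[of F G] part[of G F] less J_iff by auto
  have fin: "finite (?S \<times> ?T)" using finite_nonempty_flats by auto
  have mem: "(F, G) \<in> ?S \<times> ?T" using less by auto
  have zero: "degree_form A n (dual_var (fst U) * dual_var (snd U) * r) = 0" if U: "U \<in> ?S \<times> ?T - {(F, G)}" for U
  proof (rule less.hyps)
    have U': "fst U \<in> NF" "snd U \<in> NF" "F \<subseteq> fst U" "\<not> G \<subseteq> fst U" "G \<subseteq> snd U" "\<not> F \<subseteq> snd U" "U \<noteq> (F, G)"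
      using U by (simp_all add: mem_Times_iff)
    then have FU: "F \<subseteq> fst U" "G \<subseteq> snd U" "fst U \<subseteq> E" "snd U \<subseteq> E"
      using flat_subset nonempty_flats_iff by metis+
    then have le: "card F \<le> card (fst U)" "card G \<le> card (snd U)" "card (fst U) \<le> card E" "card (snd U) \<le> card E"
      using finite_ground by (meson card_mono finite_subset)+
    have "F \<subset> fst U \<or> G \<subset> snd U" using FU(1,2) U'(7) by (metis prod.collapse psubsetI)
    then have "card F < card (fst U) \<or> card G < card (snd U)"
      using FU finite_ground by (meson psubset_card_mono finite_subset)
    then show "card E - card (fst U) + (card E - card (snd U)) < card E - card F + (card E - card G)"
      using le by linarith
    show "fst U \<in> NF" "snd U \<in> NF" "\<not> fst U \<subseteq> snd U" "\<not> snd U \<subseteq> fst U" using U' by blast+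
  qed
  have "0 = degree_form A n ((flat_var F - flat_var ?J) * (flat_var G - flat_var ?J) * r)"
    using degree_form_exchange[OF A flats] by simp
  also have "(flat_var F - flat_var ?J) * (flat_var G - flat_var ?J) = (\<Sum>H\<in>?S. dual_var H) * (\<Sum>H\<in>?T. dual_var H)"
    unfolding S T by (simp add: algebra_simps)
  also have "\<dots> * r = (\<Sum>U\<in>?S \<times> ?T. dual_var (fst U) * dual_var (snd U) * r)"
    by (subst sum_product, subst sum.cartesian_product, subst sum_distrib_right) (simp only: case_prod_unfold)
  also have "degree_form A n \<dots> = (\<Sum>U\<in>?S \<times> ?T. degree_form A n (dual_var (fst U) * dual_var (snd U) * r))"
    by (rule degree_form_sum)
  also have "\<dots> = degree_form A n (dual_var F * dual_var G * r) +
      (\<Sum>U\<in>?S \<times> ?T - {(F, G)}. degree_form A n (dual_var (fst U) * dual_var (snd U) * r))"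
    by (subst sum.remove[OF fin mem]) simp
  also have "(\<Sum>U\<in>?S \<times> ?T - {(F, G)}. degree_form A n (dual_var (fst U) * dual_var (snd U) * r)) = 0"
    by (rule sum.neutral) (use zero in blast)
  finally show ?case by simp
qed

definition chow_form :: "'a set \<Rightarrow> nat \<Rightarrow> ('a set, rat) mpoly \<Rightarrow> rat" where
  "chow_form F n p = degree_form F n (mpoly_subst dual_var p)"

lemma chow_form_simps [simp]:
  "chow_form F n 0 = 0" "chow_form F n (p + q) = chow_form F n p + chow_form F n q"
  "chow_form F n (- p) = - chow_form F n p" "chow_form F n (p - q) = chow_form F n p - chow_form F n q"
  by (simp_all add: chow_form_def)

lemma chow_form_const: "chow_form F 0 (mpoly_const c) = c"
proof -
  have "mpoly_subst dual_var (mpoly_const c) = Poly_Mapping.single 0 c"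
    by (simp add: mpoly_const_def)
  then show ?thesis
    by (simp add: chow_form_def degree_form_def hall_rado_def)
qed

lemma chow_form_top:
  "F \<in> NF \<Longrightarrow> n < rk F \<Longrightarrow> n \<noteq> 0 \<Longrightarrow> chow_form F n (flat_var F * p) = - chow_form F (n - 1) p"
  by (simp add: chow_form_def degree_form_dual_top)

lemma chow_form_coatom:
  "F \<in> NF \<Longrightarrow> Y \<in> NF \<Longrightarrow> Y \<subset> F \<Longrightarrow> chow_form F (rk Y) (flat_var Y * p) = chow_form Y (rk Y - 1) p"
  by (simp add: chow_form_def degree_form_dual_coatom)

section \<open>The ideals of the filtration\<close>

text \<open>The carrier of the polynomial ring of the flats, kept as a plain set so that
  calculations use the arithmetic of the type.\<close>

definition flat_polys :: "('a set, rat) mpoly set" where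
  "flat_polys = {p. \<forall>m \<in> Poly_Mapping.keys p. Poly_Mapping.keys m \<subseteq> NF}"

lemma flat_polys_simps [simp, intro]:
  "0 \<in> flat_polys" "1 \<in> flat_polys" "mpoly_const c \<in> flat_polys" "F \<in> NF \<Longrightarrow> flat_var F \<in> flat_polys"
  by (auto simp: flat_polys_def mpoly_const_def mpoly_var_def split: if_splits)

lemma flat_polys_add [simp, intro]: "p \<in> flat_polys \<Longrightarrow> q \<in> flat_polys \<Longrightarrow> p + q \<in> flat_polys"
  using keys_add[of p q] by (auto simp: flat_polys_def)

lemma flat_polys_uminus [simp, intro]: "p \<in> flat_polys \<Longrightarrow> - p \<in> flat_polys"
  by (auto simp: flat_polys_def)

lemma flat_polys_diff [simp, intro]: "p \<in> flat_polys \<Longrightarrow> q \<in> flat_polys \<Longrightarrow> p - q \<in> flat_polys"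
  using flat_polys_add[of p "- q"] by auto

lemma flat_polys_mult [simp, intro]: "p \<in> flat_polys \<Longrightarrow> q \<in> flat_polys \<Longrightarrow> p * q \<in> flat_polys"
proof -
  assume p: "p \<in> flat_polys" and q: "q \<in> flat_polys"
  show "p * q \<in> flat_polys"
    unfolding flat_polys_def
  proof (intro CollectI ballI)
    fix m assume "m \<in> Poly_Mapping.keys (p * q)"
    then obtain a b where "m = a + b" "a \<in> Poly_Mapping.keys p" "b \<in> Poly_Mapping.keys q"
      using keys_mult by blast
    then show "Poly_Mapping.keys m \<subseteq> NF" using p q keys_add[of a b] unfolding flat_polys_def by blast
  qed
qed

lemma flat_polys_sum [simp, intro]: "(\<And>a. a \<in> A \<Longrightarrow> f a \<in> flat_polys) \<Longrightarrow> sum f A \<in> flat_polys"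
  by (induction A rule: infinite_finite_induct) auto

definition linear_relations :: "('a set, rat) mpoly set" where
  "linear_relations = {(\<Sum>F \<in> {F \<in> NF. i \<in> F}. flat_var F) | i. i \<in> E}"

definition incomparable_products :: "('a set, rat) mpoly set" where
  "incomparable_products = {flat_var F * flat_var G | F G. F \<in> NF \<and> G \<in> NF \<and> \<not> F \<subseteq> G \<and> \<not> G \<subseteq> F}"

text \<open>Setting the variable of the empty flat to \<open>1\<close> lets statements about the coatoms of a flat
  include the flats of rank one.\<close>

definition unit_var :: "'a set \<Rightarrow> ('a set, rat) mpoly" where
  "unit_var G = (if G = {} then 1 else flat_var G)"

text \<open>The relations are always included, so for sets of nonempty flats this is the preimage of
  an ideal of the Chow ring, and colon ideals can be computed with polynomials. For empty
  \<open>V\<close> it is the ideal that defines the Chow ring.\<close>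

definition flat_ideal :: "'a set set \<Rightarrow> ('a set, rat) mpoly set" where
  "flat_ideal V = ideal_span flat_polys (linear_relations \<union> incomparable_products \<union> unit_var ` V)"

lemma unit_var_NF: "G \<in> NF \<Longrightarrow> unit_var G = flat_var G"
  by (auto simp: unit_var_def nonempty_flats_iff)

lemma unit_var_mem [simp, intro]: "is_flat G \<Longrightarrow> unit_var G \<in> flat_polys"
  by (auto simp: unit_var_def nonempty_flats_iff)

lemma flat_ideal_zero [simp, intro]: "0 \<in> flat_ideal V"
  by (simp add: flat_ideal_def ideal_span.zero)

lemma flat_ideal_add [simp, intro]: "p \<in> flat_ideal V \<Longrightarrow> q \<in> flat_ideal V \<Longrightarrow> p + q \<in> flat_ideal V"
  by (simp add: flat_ideal_def ideal_span_add)

lemma flat_ideal_mult: "p \<in> flat_ideal V \<Longrightarrow> r \<in> flat_polys \<Longrightarrow> r * p \<in> flat_ideal V"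
  unfolding flat_ideal_def by (rule ideal_span_mult) auto

lemma flat_ideal_mult_right: "p \<in> flat_ideal V \<Longrightarrow> r \<in> flat_polys \<Longrightarrow> p * r \<in> flat_ideal V"
  using flat_ideal_mult by (simp add: mult.commute)

lemma flat_ideal_uminus [simp, intro]: "p \<in> flat_ideal V \<Longrightarrow> - p \<in> flat_ideal V"
  using flat_ideal_mult[of p V "- 1"] by auto

lemma flat_ideal_diff [simp, intro]: "p \<in> flat_ideal V \<Longrightarrow> q \<in> flat_ideal V \<Longrightarrow> p - q \<in> flat_ideal V"
  using flat_ideal_add[of p V "- q"] by auto

lemma flat_ideal_diff_iff: "p - q \<in> flat_ideal V \<Longrightarrow> p \<in> flat_ideal V \<longleftrightarrow> q \<in> flat_ideal V"
  using flat_ideal_add[of "p - q" V q] flat_ideal_diff[of p V "p - q"] by auto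

lemma flat_ideal_sum [intro]: "(\<And>a. a \<in> A \<Longrightarrow> f a \<in> flat_ideal V) \<Longrightarrow> sum f A \<in> flat_ideal V"
  by (induction A rule: infinite_finite_induct) auto

lemma flat_ideal_gen:
  "g \<in> linear_relations \<union> incomparable_products \<union> unit_var ` V \<Longrightarrow> g \<in> flat_ideal V"
  unfolding flat_ideal_def using ideal_span.step[OF ideal_span.zero, of 1 flat_polys g] by auto

lemma flat_ideal_unit_var: "G \<in> V \<Longrightarrow> unit_var G \<in> flat_ideal V"
  by (rule flat_ideal_gen) auto

lemma flat_ideal_var: "G \<in> V \<Longrightarrow> G \<in> NF \<Longrightarrow> flat_var G \<in> flat_ideal V"
  using flat_ideal_unit_var unit_var_NF by metis

lemma flat_ideal_incomparable:
  "F \<in> NF \<Longrightarrow> G \<in> NF \<Longrightarrow> \<not> F \<subseteq> G \<Longrightarrow> \<not> G \<subseteq> F \<Longrightarrow> flat_var F * flat_var G \<in> flat_ideal V"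
  by (rule flat_ideal_gen) (auto simp: incomparable_products_def)

lemma flat_ideal_linear: "i \<in> E \<Longrightarrow> (\<Sum>F \<in> {F \<in> NF. i \<in> F}. flat_var F) \<in> flat_ideal V"
  by (rule flat_ideal_gen) (auto simp: linear_relations_def)

text \<open>The relations belong to every such ideal, so only the variables of \<open>V\<close>
  remain to be checked. The easy inclusions for colon ideals all have this shape.\<close>

lemma flat_ideal_mult_into:
  assumes "a \<in> flat_polys" "\<And>G. G \<in> V \<Longrightarrow> a * unit_var G \<in> flat_ideal V'" and "p \<in> flat_ideal V"
  shows "a * p \<in> flat_ideal V'"
  using assms(3) unfolding flat_ideal_def
proof (induction p rule: ideal_span.induct)
  case (step p q g)
  have "a * g \<in> flat_ideal V'"
  proof (cases "g \<in> unit_var ` V")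
    case False
    then show ?thesis using step flat_ideal_gen[of g V'] assms(1) flat_ideal_mult by blast
  qed (use assms in auto)
  then have "q * (a * g) \<in> flat_ideal V'" using step flat_ideal_mult by blast
  then have "a * p + q * (a * g) \<in> flat_ideal V'" using step by (auto simp: flat_ideal_def ideal_span_add)
  then show ?case by (simp add: algebra_simps flat_ideal_def)
qed (auto simp: ideal_span.zero)

lemma flat_ideal_subset:
  assumes "\<And>G. G \<in> V \<Longrightarrow> unit_var G \<in> flat_ideal V'"
  shows "flat_ideal V \<subseteq> flat_ideal V'"
  using flat_ideal_mult_into[of 1 V V'] assms by auto

lemma flat_ideal_mono: "V \<subseteq> V' \<Longrightarrow> flat_ideal V \<subseteq> flat_ideal V'"
  using flat_ideal_subset flat_ideal_unit_var by blast

lemma flat_ideal_carrier: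
  assumes "\<And>G. G \<in> V \<Longrightarrow> is_flat G" shows "flat_ideal V \<subseteq> flat_polys"
proof
  fix p assume "p \<in> flat_ideal V"
  then show "p \<in> flat_polys"
    unfolding flat_ideal_def
  proof (induction p rule: ideal_span.induct)
    case (step p q g)
    then have "g \<in> flat_polys" using assms by (auto simp: linear_relations_def incomparable_products_def)
    then show ?case using step by auto
  qed auto
qed

lemma flat_ideal_insert:
  assumes "p \<in> flat_ideal (insert G V)"
  shows "\<exists>q \<in> flat_polys. p - q * unit_var G \<in> flat_ideal V"
  using assms unfolding flat_ideal_def
proof (induction p rule: ideal_span.induct)
  case zero
  show ?case by (intro bexI[of _ 0]) (auto intro: ideal_span.zero)
next
  case (step p q g)
  then obtain r where r: "r \<in> flat_polys" "p - r * unit_var G \<in> flat_ideal V"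
    by (auto simp: flat_ideal_def)
  show ?case
  proof (cases "g = unit_var G")
    case True
    then have eq: "p + q * g - (r + q) * unit_var G = p - r * unit_var G" by (simp add: algebra_simps)
    show ?thesis using r step(2) unfolding flat_ideal_def[symmetric] by (intro bexI[of _ "r + q"]) (simp_all only: eq flat_polys_add)
  next
    case False
    then have "g \<in> flat_ideal V" using step by (intro flat_ideal_gen) auto
    then have "(p - r * unit_var G) + q * g \<in> flat_ideal V" using r step flat_ideal_mult by blast
    moreover have "(p - r * unit_var G) + q * g = p + q * g - r * unit_var G" by simp
    ultimately show ?thesis using r unfolding flat_ideal_def[symmetric] by metis
  qed
qed

lemma flat_ideal_Un:
  assumes "finite W" "p \<in> flat_ideal (V \<union> W)"
  shows "\<exists>f. (\<forall>Y. f Y \<in> flat_polys) \<and> p - (\<Sum>Y\<in>W. f Y * unit_var Y) \<in> flat_ideal V"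
  using assms
proof (induction W arbitrary: p rule: finite_induct)
  case empty
  then show ?case by (intro exI[of _ "\<lambda>_. 0"]) auto
next
  case (insert Y W)
  then obtain q where q: "q \<in> flat_polys" "p - q * unit_var Y \<in> flat_ideal (V \<union> W)"
    using flat_ideal_insert[of p Y "V \<union> W"] by auto
  then obtain f where f: "\<forall>Y. f Y \<in> flat_polys" "(p - q * unit_var Y) - (\<Sum>Y\<in>W. f Y * unit_var Y) \<in> flat_ideal V"
    using insert by meson
  have "(\<Sum>H\<in>insert Y W. (f(Y := q)) H * unit_var H) = q * unit_var Y + (\<Sum>H\<in>W. f H * unit_var H)"
  proof -
    have "(\<Sum>H\<in>W. (f(Y := q)) H * unit_var H) = (\<Sum>H\<in>W. f H * unit_var H)"
      using insert by (intro sum.cong) auto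
    then show ?thesis using insert by simp
  qed
  then have "p - (\<Sum>H\<in>insert Y W. (f(Y := q)) H * unit_var H) \<in> flat_ideal V"
    using f(2) by (simp only: diff_diff_eq)
  moreover have "\<forall>H. (f(Y := q)) H \<in> flat_polys" using f(1) q(1) by simp
  ultimately show ?case by blast
qed

end

section \<open>Nondegeneracy and colon ideals\<close>

context simple_matroid
begin

text \<open>The variables that vanish in the Chow ring of the restriction to \<open>F\<close>
  truncated to rank \<open>n + 1\<close>. \<open>F\<close> itself is kept, as the top flat of the
  truncation.\<close>

definition trunc_flats :: "'a set \<Rightarrow> nat \<Rightarrow> 'a set set" where
  "trunc_flats F n = {G \<in> NF. \<not> G \<subseteq> F} \<union> {G \<in> NF. G \<subset> F \<and> n < rk G}"

text \<open>A flat contains \<open>i\<close> exactly if it contains the closure of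
  \<open>{i}\<close>; so the substitution turns the linear relation into minus the variable of a
  flat of rank one.\<close>

lemma chow_form_linear:
  assumes "i \<in> E"
  shows "chow_form F n ((\<Sum>G \<in> {G \<in> NF. i \<in> G}. flat_var G) * p) = 0"
proof -
  let ?A = "closure {i}"
  have A: "is_flat ?A" "i \<in> ?A" using flat_closure[of "{i}"] subset_closure[of "{i}"] assms by auto
  have ANF: "?A \<in> NF" using A by (auto simp: nonempty_flats_iff)
  have "{G \<in> NF. i \<in> G} = {G \<in> NF. ?A \<subseteq> G}"
    using A closure_minimal[of _ "{i}"] by (auto simp: nonempty_flats_iff)
  then have "mpoly_subst dual_var (\<Sum>G \<in> {G \<in> NF. i \<in> G}. flat_var G) = - flat_var ?A"
    using sum_dual_var[OF ANF] by (simp add: mpoly_subst_sum)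
  moreover have "rk ?A \<le> 1" using rk_closure[of "{i}"] rk_singleton assms by auto
  ultimately show ?thesis
    using degree_form_atom[OF A(1), of F n "mpoly_subst dual_var p"] by (simp add: chow_form_def)
qed

lemma chow_form_kills:
  assumes F: "F \<in> NF" "n < rk F" and p: "p \<in> flat_ideal (trunc_flats F n)"
  shows "chow_form F n (p * q) = 0"
proof (rule ideal_span_functional_zero[OF _ _ _ p[unfolded flat_ideal_def], where L = "\<lambda>p. chow_form F n (p * q)"])
  fix r g
  assume g: "g \<in> linear_relations \<union> incomparable_products \<union> unit_var ` trunc_flats F n"
  have "chow_form F n (g * (r * q)) = 0"
  proof -
    consider (a) "g \<in> linear_relations" | (b) "g \<in> incomparable_products" | (c) "g \<in> unit_var ` trunc_flats F n"
      using g by auto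
    then show ?thesis
    proof cases
      case a
      then show ?thesis by (auto simp: linear_relations_def chow_form_linear)
    next
      case b
      then obtain A B where "g = flat_var A * flat_var B" "A \<in> NF" "B \<in> NF" "\<not> A \<subseteq> B" "\<not> B \<subseteq> A"
        by (auto simp: incomparable_products_def)
      then show ?thesis
        using degree_form_dual_incomparable F by (simp add: chow_form_def nonempty_flats_iff)
    next
      case c
      then obtain G where G: "g = flat_var G" "G \<in> NF" "\<not> G \<subseteq> F \<or> G \<subset> F \<and> n < rk G"
        unfolding trunc_flats_def using unit_var_NF by blast
      from G(3) show ?thesis
      proof
        assume "\<not> G \<subseteq> F"
        then show ?thesis using G(1) by (simp add: chow_form_def degree_form_dual_not_below)
      next
        assume "G \<subset> F \<and> n < rk G"
        then show ?thesis using G(1,2) F by (simp add: chow_form_def degree_form_dual_large)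
      qed
    qed
  qed
  then show "chow_form F n (r * g * q) = 0" by (simp add: ac_simps)
qed (simp_all add: algebra_simps)

lemma NF_flat: "G \<in> NF \<Longrightarrow> is_flat G" and NF_subset: "G \<in> NF \<Longrightarrow> G \<subseteq> E"
  using flat_subset by (auto simp: nonempty_flats_iff)

lemma NF_iff_rk: "is_flat G \<Longrightarrow> G \<in> NF \<longleftrightarrow> 0 < rk G"
  using rk_pos[of G] by (cases "G = {}") (simp_all add: nonempty_flats_iff)

lemma rk_psubset: "is_flat F \<Longrightarrow> is_flat G \<Longrightarrow> F \<subset> G \<Longrightarrow> rk F < rk G"
  using flat_psubset_rk flat_subset by blast

text \<open>Multiplying the linear relation at \<open>i\<close> by the variable of \<open>H\<close>
  kills every flat through \<open>i\<close> that does not contain \<open>H\<close>: as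
  \<open>i\<close> is outside \<open>H\<close>, such a flat is incomparable to
  \<open>H\<close>.\<close>

lemma unit_var_star:
  assumes H: "is_flat H" and i: "i \<in> E - H"
  shows "unit_var H * (\<Sum>G \<in> {G \<in> NF. H \<subseteq> G \<and> i \<in> G}. flat_var G) \<in> flat_ideal V"
proof (cases "H = {}")
  case True
  then show ?thesis using flat_ideal_linear[of i V] i by (simp add: unit_var_def)
next
  case False
  then have HNF: "H \<in> NF" using H by (simp add: nonempty_flats_iff)
  have "unit_var H * (\<Sum>G \<in> {G \<in> NF. i \<in> G}. flat_var G) \<in> flat_ideal V"
    using flat_ideal_mult[OF flat_ideal_linear unit_var_mem] i H by auto
  moreover have "(\<Sum>G \<in> {G \<in> NF. i \<in> G}. flat_var G) =
      (\<Sum>G \<in> {G \<in> NF. H \<subseteq> G \<and> i \<in> G}. flat_var G) + (\<Sum>G \<in> {G \<in> NF. \<not> H \<subseteq> G \<and> i \<in> G}. flat_var G)"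
    using finite_nonempty_flats by (subst sum.union_disjoint[symmetric]) (auto intro!: sum.cong)
  moreover have "unit_var H * (\<Sum>G \<in> {G \<in> NF. \<not> H \<subseteq> G \<and> i \<in> G}. flat_var G) \<in> flat_ideal V"
    unfolding sum_distrib_left
  proof (rule flat_ideal_sum)
    fix G assume "G \<in> {G \<in> NF. \<not> H \<subseteq> G \<and> i \<in> G}"
    then show "unit_var H * flat_var G \<in> flat_ideal V"
      using i HNF by (subst unit_var_NF[OF HNF], intro flat_ideal_incomparable) auto
  qed
  ultimately show ?thesis
    using flat_ideal_diff[of "unit_var H * (\<Sum>G \<in> {G \<in> NF. i \<in> G}. flat_var G)" V
        "unit_var H * (\<Sum>G \<in> {G \<in> NF. \<not> H \<subseteq> G \<and> i \<in> G}. flat_var G)"]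
    by (simp add: distrib_left)
qed

lemma unit_var_star_subset:
  assumes H: "is_flat H" and i: "i \<in> E - H" and A: "A \<subseteq> {G \<in> NF. H \<subseteq> G \<and> i \<in> G}"
    and "\<And>G. G \<in> NF \<Longrightarrow> H \<subseteq> G \<Longrightarrow> i \<in> G \<Longrightarrow> G \<notin> A \<Longrightarrow> G \<in> V"
  shows "unit_var H * (\<Sum>G \<in> A. flat_var G) \<in> flat_ideal V"
proof -
  let ?B = "{G \<in> NF. H \<subseteq> G \<and> i \<in> G}"
  have "(\<Sum>G \<in> A. flat_var G) = (\<Sum>G \<in> ?B. flat_var G) - (\<Sum>G \<in> ?B - A. flat_var G)"
    using A finite_nonempty_flats by (simp add: sum_diff)
  moreover have "unit_var H * (\<Sum>G \<in> ?B - A. flat_var G) \<in> flat_ideal V"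
    using assms by (intro flat_ideal_mult flat_ideal_sum flat_ideal_var unit_var_mem) auto
  ultimately show ?thesis
    using unit_var_star[OF H i, of V] by (simp add: right_diff_distrib)
qed

text \<open>Apart from \<open>F\<close>, a flat strictly above \<open>Y\<close> has its variable in
  the ideal, since its rank exceeds \<open>n\<close>. The star relation at a point of
  \<open>F\<close> outside \<open>Y\<close> thus has a single surviving term.\<close>

lemma unit_var_top:
  assumes F: "F \<in> NF" and Y: "is_flat Y" "Y \<subset> F" "n \<le> rk Y"
  shows "unit_var Y * flat_var F \<in> flat_ideal (trunc_flats F n)"
proof -
  obtain i where i: "i \<in> F - Y" using Y by auto
  have iE: "i \<in> E - Y" using i NF_subset F by auto
  have "unit_var Y * (\<Sum>G \<in> {F}. flat_var G) \<in> flat_ideal (trunc_flats F n)"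
  proof (rule unit_var_star_subset[OF Y(1) iE])
    fix G assume G: "G \<in> NF" "Y \<subseteq> G" "i \<in> G" "G \<notin> {F}"
    then have "rk Y < rk G" using rk_psubset[OF Y(1) NF_flat] i by blast
    then show "G \<in> trunc_flats F n" using G Y by (auto simp: trunc_flats_def)
  qed (use F Y i in auto)
  then show ?thesis by simp
qed

text \<open>In the star relation at a point of \<open>Y\<close> outside \<open>H\<close> all flats
  contain \<open>Y\<close>, because \<open>Y\<close> covers \<open>H\<close>; those strictly above
  \<open>Y\<close> vanish except for \<open>F\<close>. Modulo the ideal, \<open>x_H x_Y\<close>
  becomes \<open>- x_H x_F\<close>.\<close>

lemma unit_var_exchange:
  assumes F: "F \<in> NF" and Y: "is_flat Y" "Y \<subset> F" "rk Y = n" and H: "is_flat H" "H \<subseteq> Y" "Suc (rk H) = n"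
  shows "unit_var H * (flat_var Y + flat_var F) \<in> flat_ideal (trunc_flats F n)"
proof -
  have "H \<noteq> Y" using Y H by auto
  then obtain i where i: "i \<in> Y - H" using H by auto
  have YNF: "Y \<in> NF" using Y H NF_iff_rk by auto
  have iE: "i \<in> E - H" using i NF_subset YNF by auto
  have "unit_var H * (\<Sum>G \<in> {Y, F}. flat_var G) \<in> flat_ideal (trunc_flats F n)"
  proof (rule unit_var_star_subset[OF H(1) iE])
    fix G assume G: "G \<in> NF" "H \<subseteq> G" "i \<in> G" "G \<notin> {Y, F}"
    then have "Y \<subseteq> G" using cover_minimal[OF H(1) Y(1) H(2) _ i NF_flat] Y H by auto
    then have "rk Y < rk G" using rk_psubset[OF Y(1) NF_flat] G by blast
    then show "G \<in> trunc_flats F n" using G Y by (auto simp: trunc_flats_def)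
  qed (use F YNF Y H i in auto)
  then show ?thesis using Y by (simp add: psubset_eq)
qed

lemma flat_polys_constant_term:
  assumes "p \<in> flat_polys" "\<And>G. G \<in> NF \<Longrightarrow> flat_var G \<in> flat_ideal V"
  shows "p - mpoly_const (Poly_Mapping.lookup p 0) \<in> flat_ideal V"
  using assms(1)
proof (induction p rule: poly_mapping_add_induct)
  case zero
  then show ?case by (simp add: mpoly_const_simps)
next
  case (add m c p)
  have m: "m \<in> Poly_Mapping.keys (Poly_Mapping.single m c + p)"
    using add by (simp add: in_keys_iff lookup_add)
  have "p \<in> flat_polys"
    using add unfolding flat_polys_def
    by (auto simp: in_keys_iff lookup_add lookup_single when_def split: if_splits)
  then have IH: "p - mpoly_const (Poly_Mapping.lookup p 0) \<in> flat_ideal V" by (rule add.IH)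
  show ?case
  proof (cases "m = 0")
    case True
    then show ?thesis using IH by (simp add: lookup_add mpoly_const_simps, simp add: mpoly_const_def)
  next
    case False
    then obtain G where G: "G \<in> Poly_Mapping.keys m" by fastforce
    then have GNF: "G \<in> NF" using add.prems m by (auto simp: flat_polys_def)
    let ?k = "m - Poly_Mapping.single G 1"
    have "m = Poly_Mapping.single G 1 + ?k"
      using G by (intro poly_mapping_eqI) (auto simp: lookup_add lookup_minus lookup_single when_def in_keys_iff)
    then have eq: "Poly_Mapping.single m c = Poly_Mapping.single ?k c * flat_var G"
      by (metis mpoly_var_def mult_single mult.right_neutral add.commute)
    have "Poly_Mapping.keys ?k \<subseteq> Poly_Mapping.keys m"
      by (auto simp: in_keys_iff lookup_minus)
    then have "Poly_Mapping.single ?k c \<in> flat_polys"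
      using add.prems m by (auto simp: flat_polys_def split: if_splits)
    then have "Poly_Mapping.single m c \<in> flat_ideal V" using eq assms(2)[OF GNF] flat_ideal_mult by metis
    then have "Poly_Mapping.single m c + (p - mpoly_const (Poly_Mapping.lookup p 0)) \<in> flat_ideal V" using IH by blast
    moreover have "Poly_Mapping.lookup (Poly_Mapping.single m c + p) 0 = Poly_Mapping.lookup p 0"
      using False by (simp add: lookup_add lookup_single when_def)
    ultimately show ?thesis by (simp only: add_diff_eq)
  qed
qed

text \<open>Poincare duality for the Chow ring of the restriction to \<open>F\<close> truncated to rank \<open>n + 1\<close>: the
  annihilator of the variables not below \<open>S\<close> is spanned by the coatoms in \<open>S\<close>. For empty \<open>S\<close> the
  choice \<open>G = {}\<close> is allowed, and the statement is that the pairing is perfect.\<close>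

lemma chow_form_nondegenerate:
  assumes "F \<in> NF" "n < rk F" "S \<subseteq> {Y. is_flat Y \<and> Y \<subset> F \<and> rk Y = n}" "p \<in> flat_polys"
    and "\<And>G q. is_flat G \<Longrightarrow> G = F \<or> G \<subset> F \<and> rk G \<le> n \<Longrightarrow> (\<forall>Y\<in>S. \<not> G \<subseteq> Y) \<Longrightarrow>
      chow_form F n (unit_var G * p * q) = 0"
  shows "p \<in> flat_ideal (trunc_flats F n \<union> S)"
  using assms
proof (induction n arbitrary: F S p rule: less_induct)
  case (less n)
  note F = less.prems(1,2) and S = less.prems(3) and p = less.prems(4) and form = less.prems(5)
  have Fflat: "is_flat F" using F NF_flat by auto
  have flat_gen: "is_flat G" if "G \<in> trunc_flats A k" for G A k
    using that by (auto simp: trunc_flats_def NF_flat)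
  show ?case
  proof (cases "n = 0")
    case True
    show ?thesis
    proof (cases "{} \<in> S")
      case True
      \<comment> \<open>In degree zero the empty flat is the only possible member of
        \<open>S\<close>, and its variable \<open>1\<close> generates everything.\<close>
      then show ?thesis
        using flat_ideal_mult[OF flat_ideal_unit_var p, of "{}" "trunc_flats F n \<union> S"] by (simp add: unit_var_def)
    next
      case False
      then have S0: "S = {}" using S \<open>n = 0\<close> NF_iff_rk nonempty_flats_iff by fastforce
      \<comment> \<open>The truncation has rank one: its only variable is \<open>x_F\<close>, which
        vanishes by the linear relation at a point of \<open>F\<close>. So \<open>p\<close> is
        congruent to its constant term, which the degree map reads off.\<close>
      have vars: "flat_var G \<in> flat_ideal (trunc_flats F 0)" if "G \<in> NF" for G
      proof (cases "G = F")
        case True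
        then show ?thesis
          using unit_var_top[OF F(1) flat_empty, of 0] F by (auto simp: unit_var_def nonempty_flats_iff)
      next
        case False
        then have "G \<in> trunc_flats F 0" using that NF_iff_rk NF_flat by (auto simp: trunc_flats_def)
        then show ?thesis using that flat_ideal_var by auto
      qed
      let ?c = "Poly_Mapping.lookup p 0"
      have "p - mpoly_const ?c \<in> flat_ideal (trunc_flats F 0)"
        using flat_polys_constant_term[OF p vars] .
      then have "chow_form F 0 ((p - mpoly_const ?c) * 1) = 0" using chow_form_kills F \<open>n = 0\<close> by blast
      moreover have "chow_form F 0 (unit_var {} * p * 1) = 0"
        using form[of "{}" 1] flat_empty F S0 \<open>n = 0\<close> by (auto simp: nonempty_flats_iff)
      ultimately have "?c = 0" by (simp add: unit_var_def chow_form_const)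
      then show ?thesis
        using flat_polys_constant_term[OF p vars] \<open>n = 0\<close> S0 by (simp add: mpoly_const_simps)
    qed
  next
    case False
    \<comment> \<open>The hypothesis for \<open>G = F\<close> lowers the degree by one, and the
      induction hypothesis then expresses \<open>p\<close> through flats of rank \<open>n\<close>.
      Those outside \<open>S\<close> form \<open>C\<close>; their terms have to be removed.\<close>
    define C where "C = {Y. is_flat Y \<and> Y \<subset> F \<and> rk Y = n} - S"
    have finC: "finite C" using flats_finite by (auto simp: C_def)
    have C_NF: "Y \<in> NF" if "Y \<in> C" for Y using that False NF_iff_rk by (auto simp: C_def)
    let ?V = "trunc_flats F n" and ?VS = "trunc_flats F n \<union> S"
    have top_form: "chow_form F (n - 1) r = - chow_form F n (flat_var F * r)" for r
      using chow_form_top F False by simp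
    have "p \<in> flat_ideal (trunc_flats F (n - 1) \<union> {})"
    proof (rule less.IH)
      fix G q
      have "chow_form F n (unit_var F * p * (unit_var G * q)) = 0"
        using form[of F] Fflat S by auto
      then show "chow_form F (n - 1) (unit_var G * p * q) = 0"
        unfolding top_form unit_var_NF[OF F(1)] by (simp add: ac_simps)
    qed (use F False p in auto)
    then have "p \<in> flat_ideal (?VS \<union> C)"
      by (rule set_mp[OF flat_ideal_mono, rotated])
        (use False in \<open>auto simp: trunc_flats_def C_def NF_flat\<close>)
    then obtain f where f: "\<And>Y. f Y \<in> flat_polys" and pf: "p - (\<Sum>Y\<in>C. f Y * unit_var Y) \<in> flat_ideal ?VS"
      using flat_ideal_Un[OF finC] by metis
    \<comment> \<open>Every term from \<open>C\<close> is a multiple of \<open>x_F\<close>. The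
      hypothesis at \<open>G = Y\<close> shows that \<open>p\<close>, and hence
      \<open>f Y * x_Y\<close>, vanishes on the restriction to \<open>Y\<close>. Duality on its
      truncation writes \<open>f Y\<close> through the coatoms \<open>H\<close> of \<open>Y\<close>,
      and \<open>x_H x_Y\<close> equals \<open>- x_H x_F\<close> modulo the ideal.\<close>
    have "\<exists>g\<in>flat_polys. f Y * unit_var Y - flat_var F * g \<in> flat_ideal ?V" if Y: "Y \<in> C" for Y
    proof -
      have Y': "is_flat Y" "Y \<subset> F" "rk Y = n" "Y \<notin> S" "Y \<in> NF" using Y C_NF by (auto simp: C_def)
      let ?W = "trunc_flats Y (n - 1)"
      have W: "G \<in> ?W \<longleftrightarrow> G \<in> NF \<and> \<not> G \<subseteq> Y" for G
      proof -
        have "rk G < n" if "G \<in> NF" "G \<subset> Y" using rk_psubset[OF NF_flat Y'(1)] that Y'(3) by auto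
        then show ?thesis unfolding trunc_flats_def by fastforce
      qed
      have inW: "G \<in> ?W" if "G \<in> ?VS \<union> C - {Y}" for G
      proof -
        have "G \<in> NF" using that S C_NF NF_iff_rk False by (auto simp: trunc_flats_def)
        moreover have "\<not> G \<subseteq> Y"
        proof
          assume GY: "G \<subseteq> Y"
          then have "rk G = n \<and> G \<noteq> Y" using that S Y' rk_mono[OF GY] by (auto simp: trunc_flats_def C_def)
          then show False using flat_eq_of_rk[OF NF_flat[OF \<open>G \<in> NF\<close>] Y'(1) GY] Y' by simp
        qed
        ultimately show ?thesis using W by simp
      qed
      have sub: "flat_ideal ?VS \<subseteq> flat_ideal ?W"
        using inW Y' by (intro flat_ideal_mono) (auto simp: trunc_flats_def)
      have "p \<in> flat_ideal (?W \<union> {})"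
      proof (rule less.IH)
        fix G q
        have "\<forall>Z\<in>S. \<not> Y \<subseteq> Z"
        proof (intro ballI notI)
          fix Z assume "Z \<in> S" "Y \<subseteq> Z"
          moreover have "is_flat Z" "rk Z = n" using S \<open>Z \<in> S\<close> by blast+
          ultimately have "Y = Z" using flat_eq_of_rk[OF Y'(1)] Y'(3) by simp
          then show False using \<open>Z \<in> S\<close> Y'(4) by simp
        qed
        then have "chow_form F n (unit_var Y * p * (unit_var G * q)) = 0"
          using form[of Y] Y' by auto
        then have "chow_form F (rk Y) (flat_var Y * (unit_var G * p * q)) = 0"
          unfolding unit_var_NF[OF Y'(5)] Y'(3) by (simp add: ac_simps)
        then show "chow_form Y (n - 1) (unit_var G * p * q) = 0"
          using chow_form_coatom[OF F(1) Y'(5,2)] Y'(3) by metis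
      qed (use Y' False p in auto)
      then have pW: "p \<in> flat_ideal ?W" by simp
      have rest: "(\<Sum>H\<in>C - {Y}. f H * unit_var H) \<in> flat_ideal ?W"
        using inW f by (intro flat_ideal_sum flat_ideal_mult flat_ideal_unit_var) auto
      have "(\<Sum>H\<in>C. f H * unit_var H) \<in> flat_ideal ?W"
        using pW pf sub flat_ideal_diff_iff by blast
      then have "f Y * unit_var Y + (\<Sum>H\<in>C - {Y}. f H * unit_var H) \<in> flat_ideal ?W"
        by (simp only: sum.remove[OF finC Y])
      from flat_ideal_diff[OF this rest] have fYW: "f Y * unit_var Y \<in> flat_ideal ?W" by simp
      define K where "K = {H. is_flat H \<and> H \<subset> Y \<and> Suc (rk H) = n}"
      have finK: "finite K" using flats_finite by (auto simp: K_def)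
      have "f Y \<in> flat_ideal (?W \<union> K)"
      proof (cases "n = 1")
        case True
        \<comment> \<open>\<open>Y\<close> has rank one, its coatom is the empty flat with variable
          \<open>1\<close>, and the expansion is trivial. Degree \<open>n - 1 - 1\<close> would be
          cut off at zero here.\<close>
        then have "{} \<in> K" using flat_empty Y' nonempty_flats_iff by (auto simp: K_def)
        then show ?thesis
          using flat_ideal_mult[OF flat_ideal_unit_var f, of "{}" "?W \<union> K"] by (simp add: unit_var_def)
      next
        case n1: False
        have "f Y \<in> flat_ideal (trunc_flats Y (n - 1 - 1) \<union> {})"
        proof (rule less.IH)
          fix G q
          have "chow_form Y (n - 1) (f Y * unit_var Y * (unit_var G * q)) = 0"
            using chow_form_kills[OF Y'(5) _ fYW] Y' False by simp
          then have "chow_form Y (n - 1) (flat_var Y * (unit_var G * f Y * q)) = 0"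
            unfolding unit_var_NF[OF Y'(5)] by (simp add: ac_simps)
          then show "chow_form Y (n - 1 - 1) (unit_var G * f Y * q) = 0"
            using chow_form_top[OF Y'(5), of "n - 1"] Y' n1 False by simp
        qed (use Y' False f n1 in auto)
        then show ?thesis
          by (rule set_mp[OF flat_ideal_mono, rotated])
            (use n1 False in \<open>auto simp: trunc_flats_def K_def NF_flat\<close>)
      qed
      then obtain h where h: "\<And>H. h H \<in> flat_polys" and fh: "f Y - (\<Sum>H\<in>K. h H * unit_var H) \<in> flat_ideal ?W"
        using flat_ideal_Un[OF finK] by metis
      let ?s = "\<Sum>H\<in>K. h H * unit_var H"
      have s: "?s \<in> flat_polys" using h by (intro flat_polys_sum) (auto simp: K_def)
      have "flat_var Y * (f Y - ?s) \<in> flat_ideal ?V"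
      proof (rule flat_ideal_mult_into[OF _ _ fh])
        fix G assume G: "G \<in> ?W"
        then have G': "G \<in> NF" "\<not> G \<subseteq> Y" using W by auto
        show "flat_var Y * unit_var G \<in> flat_ideal ?V"
        proof (cases "Y \<subseteq> G")
          case True
          then have "n < rk G" using rk_psubset[OF Y'(1) NF_flat[OF G'(1)]] Y' G' by auto
          then have "G = F \<or> G \<in> ?V" using G' by (auto simp: trunc_flats_def)
          then show ?thesis
          proof
            assume "G = F"
            then show ?thesis using unit_var_top[OF F(1) Y'(1,2)] Y' F unit_var_NF by simp
          next
            assume "G \<in> ?V"
            then show ?thesis using Y' by (intro flat_ideal_mult flat_ideal_unit_var) auto
          qed
        next
          case False
          then show ?thesis using G' Y' flat_ideal_incomparable unit_var_NF by simp
        qed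
      qed (use Y' in auto)
      moreover have "(flat_var Y + flat_var F) * ?s \<in> flat_ideal ?V"
        unfolding sum_distrib_left
      proof (rule flat_ideal_sum)
        fix H assume "H \<in> K"
        then have "unit_var H * (flat_var Y + flat_var F) \<in> flat_ideal ?V"
          using unit_var_exchange[OF F(1) Y'(1-3)] by (auto simp: K_def)
        then have "h H * (unit_var H * (flat_var Y + flat_var F)) \<in> flat_ideal ?V"
          using h flat_ideal_mult by blast
        then show "(flat_var Y + flat_var F) * (h H * unit_var H) \<in> flat_ideal ?V"
          by (simp add: ac_simps)
      qed
      ultimately have "flat_var Y * (f Y - ?s) + (flat_var Y + flat_var F) * ?s \<in> flat_ideal ?V" by blast
      moreover have "flat_var Y * (f Y - ?s) + (flat_var Y + flat_var F) * ?s = f Y * unit_var Y - flat_var F * (- ?s)"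
        unfolding unit_var_NF[OF Y'(5)] by (simp add: algebra_simps)
      ultimately show ?thesis using s by (intro bexI[of _ "- ?s"]) auto
    qed
    then obtain g where g: "\<And>Y. Y \<in> C \<Longrightarrow> g Y \<in> flat_polys"
      and fg: "\<And>Y. Y \<in> C \<Longrightarrow> f Y * unit_var Y - flat_var F * g Y \<in> flat_ideal ?V"
      by metis
    define p' where "p' = (\<Sum>Y\<in>C. g Y)"
    have p'_mem: "p' \<in> flat_polys" using g by (auto simp: p'_def)
    have "(\<Sum>Y\<in>C. f Y * unit_var Y - flat_var F * g Y) \<in> flat_ideal ?VS"
      using fg flat_ideal_mono[of ?V ?VS] by (intro flat_ideal_sum) auto
    then have "(p - (\<Sum>Y\<in>C. f Y * unit_var Y)) + (\<Sum>Y\<in>C. f Y * unit_var Y - flat_var F * g Y) \<in> flat_ideal ?VS"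
      using pf by blast
    then have pp': "p - flat_var F * p' \<in> flat_ideal ?VS"
      by (simp add: p'_def sum_subtractf sum_distrib_left)
    \<comment> \<open>If \<open>G\<close> has rank at most \<open>n - 1\<close> and lies below a
      member of \<open>S\<close>, then some flat of rank \<open>n - 1\<close> lies between them and
      belongs to \<open>S1\<close>. So a flat below no member of \<open>S1\<close> is below no
      member of \<open>S\<close>, and the hypothesis on \<open>p\<close> can be used for
      \<open>p'\<close>.\<close>
    define S1 where "S1 = {H. is_flat H \<and> H \<subset> F \<and> rk H = n - 1 \<and> (\<exists>Y\<in>S. H \<subseteq> Y)}"
    have S_NF: "Y \<in> NF" if "Y \<in> S" for Y using that S False NF_iff_rk by auto
    have "p' \<in> flat_ideal (trunc_flats F (n - 1) \<union> S1)"
    proof (rule less.IH)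
      fix G q
      assume G: "is_flat G" "G = F \<or> G \<subset> F \<and> rk G \<le> n - 1" "\<forall>Y\<in>S1. \<not> G \<subseteq> Y"
      have GS: "\<not> G \<subseteq> Y" if "Y \<in> S" for Y
      proof
        assume GY: "G \<subseteq> Y"
        have Y: "is_flat Y" "Y \<subset> F" "rk Y = n" using S that by blast+
        then have "rk G \<le> n - 1" using G(2) GY by auto
        then obtain H where "is_flat H" "G \<subseteq> H" "H \<subseteq> Y" "rk H = n - 1"
          using flat_between[OF G(1) Y(1) GY, of "n - 1"] Y by auto
        then show False using G(3) that Y unfolding S1_def by blast
      qed
      \<comment> \<open>A member of \<open>S\<close> is incomparable to \<open>G\<close>, or
        \<open>G = F\<close> and the product vanishes by the top relation. So \<open>x_G\<close>
        moves the error term into the kernel of the degree map.\<close>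
      have "unit_var G * (p - flat_var F * p') \<in> flat_ideal ?V"
      proof (rule flat_ideal_mult_into[OF _ _ pp'])
        fix H assume "H \<in> ?VS"
        then show "unit_var G * unit_var H \<in> flat_ideal ?V"
        proof
          assume "H \<in> ?V"
          then show ?thesis using G by (intro flat_ideal_mult flat_ideal_unit_var) auto
        next
          assume HS: "H \<in> S"
          then have H: "is_flat H" "H \<subset> F" "rk H = n" "H \<in> NF" using S S_NF by auto
          show ?thesis
          proof (cases "G = F")
            case True
            then show ?thesis using unit_var_top[OF F(1) H(1,2), of n] H F by (simp add: unit_var_NF mult.commute)
          next
            case False
            then have "\<not> H \<subseteq> G" using G(2) rk_mono[of H G] H \<open>n \<noteq> 0\<close> by auto
            moreover have "G \<in> NF" using GS[OF HS] G(1) by (auto simp: nonempty_flats_iff)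
            ultimately show ?thesis using GS[OF HS] H by (simp add: unit_var_NF flat_ideal_incomparable)
          qed
        qed
      qed (use G in auto)
      then have "chow_form F n (unit_var G * (p - flat_var F * p') * q) = 0" using chow_form_kills F by blast
      moreover have "G = F \<or> G \<subset> F \<and> rk G \<le> n" using G(2) diff_le_self le_trans by blast
      then have "chow_form F n (unit_var G * p * q) = 0" using form G(1) GS by blast
      moreover have "unit_var G * (p - flat_var F * p') * q = unit_var G * p * q - flat_var F * (unit_var G * p' * q)"
        by (simp add: algebra_simps)
      ultimately have "chow_form F n (flat_var F * (unit_var G * p' * q)) = 0" by simp
      then show "chow_form F (n - 1) (unit_var G * p' * q) = 0" unfolding top_form by simp
    qed (use F False p'_mem in \<open>auto simp: S1_def\<close>)
    \<comment> \<open>Multiplication by \<open>x_F\<close> kills the flats of rank \<open>n\<close>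
      and sends \<open>S1\<close> into the ideal of \<open>S\<close>, because \<open>x_G x_F\<close>
      equals \<open>- x_G x_Y\<close> for a member \<open>Y\<close> of \<open>S\<close> above
      \<open>G\<close>.\<close>
    then have "flat_var F * p' \<in> flat_ideal ?VS"
    proof (rule flat_ideal_mult_into[rotated 2])
      fix G assume "G \<in> trunc_flats F (n - 1) \<union> S1"
      then consider "G \<in> ?V" | "is_flat G" "G \<subset> F" "rk G = n" | "G \<in> S1"
        using NF_flat by (force simp: trunc_flats_def)
      then show "flat_var F * unit_var G \<in> flat_ideal ?VS"
      proof cases
        case 1
        then show ?thesis using F by (intro flat_ideal_mult flat_ideal_unit_var) auto
      next
        case 2
        then show ?thesis
          using unit_var_top[OF F(1), of G n] flat_ideal_mono[of ?V ?VS] by (auto simp: mult.commute)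
      next
        case 3
        then obtain Y where Y: "Y \<in> S" "G \<subseteq> Y" by (auto simp: S1_def)
        have "unit_var G * (flat_var Y + flat_var F) \<in> flat_ideal ?V"
          using unit_var_exchange[OF F(1), of Y n G] 3 Y S False by (auto simp: S1_def)
        then have "unit_var G * (flat_var Y + flat_var F) \<in> flat_ideal ?VS" using flat_ideal_mono[of ?V ?VS] by auto
        moreover have "unit_var G * flat_var Y \<in> flat_ideal ?VS"
          using 3 Y S_NF by (intro flat_ideal_mult flat_ideal_var) (auto simp: S1_def)
        ultimately have "unit_var G * (flat_var Y + flat_var F) - unit_var G * flat_var Y \<in> flat_ideal ?VS" by blast
        then show ?thesis by (simp add: algebra_simps)
      qed
    qed (use F in auto)
    then show ?thesis using pp' flat_ideal_diff_iff by blast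
  qed
qed


section \<open>Colon ideals\<close>

definition not_below :: "'a set \<Rightarrow> 'a set set" where
  "not_below F = {G \<in> NF. \<not> G \<subseteq> F}"

text \<open>\<open>Z\<close> may be any set: the empty set gives all coatoms, a set containing
  \<open>F\<close> gives none, and adding elements one at a time leads from one to the
  other.\<close>

definition coatoms_above :: "'a set \<Rightarrow> 'a set \<Rightarrow> 'a set set" where
  "coatoms_above Z F = {Y. is_flat Y \<and> Y \<subset> F \<and> Suc (rk Y) = rk F \<and> Z \<subseteq> Y}"

lemma trunc_flats_full:
  assumes "F \<in> NF" shows "trunc_flats F (rk F - 1) = not_below F"
proof -
  have "rk G < rk F" if "G \<in> NF" "G \<subset> F" for G
    using rk_psubset[OF NF_flat NF_flat] that assms by blast
  then show ?thesis unfolding trunc_flats_def not_below_def by fastforce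
qed

text \<open>For a coatom \<open>G\<close> of \<open>F\<close>, the star relation at a point of
  \<open>F\<close> outside \<open>G\<close> has \<open>F\<close> as its only term outside
  \<open>U\<close>, so \<open>x_F x_G\<close> lies in the ideal. Conversely, \<open>x_F p\<close>
  pairs to zero with everything on the restriction to \<open>F\<close>; multiplication by
  \<open>x_F\<close> lowers the degree map to the truncation by one rank, where exactly the coatoms
  of \<open>F\<close> vanish in addition.\<close>

lemma colon_upper:
  assumes U: "U \<subseteq> NF" "\<And>G H. G \<in> U \<Longrightarrow> H \<in> NF \<Longrightarrow> G \<subseteq> H \<Longrightarrow> H \<in> U"
    and F: "F \<in> NF" "F \<notin> U" "\<And>H. H \<in> NF \<Longrightarrow> F \<subset> H \<Longrightarrow> H \<in> U" "2 \<le> rk F"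
    and p: "p \<in> flat_polys"
  shows "flat_var F * p \<in> flat_ideal U \<longleftrightarrow> p \<in> flat_ideal (not_below F \<union> coatoms_above {} F)"
proof
  assume "p \<in> flat_ideal (not_below F \<union> coatoms_above {} F)"
  then show "flat_var F * p \<in> flat_ideal U"
  proof (rule flat_ideal_mult_into[rotated 2])
    fix G assume "G \<in> not_below F \<union> coatoms_above {} F"
    then show "flat_var F * unit_var G \<in> flat_ideal U"
    proof
      assume G: "G \<in> not_below F"
      then have GNF: "G \<in> NF" "\<not> G \<subseteq> F" by (auto simp: not_below_def)
      show ?thesis
      proof (cases "F \<subseteq> G")
        case True
        then have "G \<in> U" using GNF F(3) by blast
        then show ?thesis using F by (intro flat_ideal_mult flat_ideal_unit_var) auto
      next
        case False
        then show ?thesis using GNF F by (simp add: unit_var_NF flat_ideal_incomparable)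
      qed
    next
      assume "G \<in> coatoms_above {} F"
      then have G: "is_flat G" "G \<subset> F" "Suc (rk G) = rk F" by (auto simp: coatoms_above_def)
      then obtain i where i: "i \<in> F - G" by auto
      then have iE: "i \<in> E - G" using NF_subset F by auto
      have "unit_var G * (\<Sum>H \<in> {F}. flat_var H) \<in> flat_ideal U"
      proof (rule unit_var_star_subset[OF G(1) iE])
        fix H assume H: "H \<in> NF" "G \<subseteq> H" "i \<in> H" "H \<notin> {F}"
        then have "F \<subseteq> H" using cover_minimal[OF G(1) NF_flat[OF F(1)] _ _ i NF_flat] G by auto
        then show "H \<in> U" using F(3) H by blast
      qed (use F G i in auto)
      then show ?thesis by (simp add: mult.commute)
    qed
  qed (use F in auto)
next
  assume Fp: "flat_var F * p \<in> flat_ideal U"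
  have "U \<subseteq> trunc_flats F (rk F - 1)"
    unfolding trunc_flats_full[OF F(1)] not_below_def using U F by blast
  then have Fp': "flat_var F * p \<in> flat_ideal (trunc_flats F (rk F - 1))" using Fp flat_ideal_mono by blast
  have "p \<in> flat_ideal (trunc_flats F (rk F - 2) \<union> {})"
  proof (rule chow_form_nondegenerate)
    fix G q
    have "chow_form F (rk F - 1) (flat_var F * p * (unit_var G * q)) = 0"
      using chow_form_kills[OF F(1) _ Fp'] F(4) by simp
    then have "chow_form F (rk F - 1) (flat_var F * (unit_var G * p * q)) = 0"
      by (simp add: ac_simps)
    then have "chow_form F (rk F - 1 - 1) (unit_var G * p * q) = 0"
      using chow_form_top[OF F(1), of "rk F - 1"] F(4) by simp
    then show "chow_form F (rk F - 2) (unit_var G * p * q) = 0" by (simp add: numeral_2_eq_2)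
  qed (use F p in auto)
  moreover have "trunc_flats F (rk F - 2) \<subseteq> not_below F \<union> coatoms_above {} F"
  proof -
    have "Suc (rk G) = rk F" if "G \<in> NF" "G \<subset> F" "rk F - 2 < rk G" for G
      using rk_psubset[OF NF_flat[OF that(1)] NF_flat[OF F(1)] that(2)] that by simp
    then show ?thesis using NF_flat by (auto simp: trunc_flats_def not_below_def coatoms_above_def)
  qed
  ultimately show "p \<in> flat_ideal (not_below F \<union> coatoms_above {} F)"
    using flat_ideal_mono by auto
qed

text \<open>The condition on \<open>S\<close> is the order of adjunction: everything above
  \<open>insert a Z\<close> is present, so \<open>Y\<close> misses \<open>a\<close>. The converse
  inclusion is the annihilator form of duality on \<open>Y\<close>.\<close>

lemma colon_coatom:
  assumes F: "F \<in> NF" and a: "a \<in> F"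
    and S: "coatoms_above (insert a Z) F \<subseteq> S" "S \<subseteq> coatoms_above Z F"
    and Y: "Y \<in> coatoms_above Z F" "Y \<notin> S" "Y \<in> NF"
    and p: "p \<in> flat_polys"
  shows "flat_var Y * p \<in> flat_ideal (not_below F \<union> S) \<longleftrightarrow> p \<in> flat_ideal (not_below Y \<union> coatoms_above Z Y)"
proof -
  let ?V = "not_below F \<union> S"
  have Y': "is_flat Y" "Y \<subset> F" "Suc (rk Y) = rk F" "Z \<subseteq> Y" using Y by (auto simp: coatoms_above_def)
  have rkY: "rk F - 1 = rk Y" using Y' by simp
  have trF: "trunc_flats F (rk Y) = not_below F" using trunc_flats_full[OF F] rkY by simp
  have trY: "trunc_flats Y (rk Y - 1) = not_below Y" using trunc_flats_full[OF Y(3)] .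
  have aY: "a \<notin> Y" using Y S Y' by (auto simp: coatoms_above_def)
  have nF: "rk Y < rk F" using Y' by simp
  have S': "is_flat Q" "Q \<subset> F" "rk Q = rk Y" "Z \<subseteq> Q" "Q \<noteq> Y" "Q \<in> NF" if "Q \<in> S" for Q
  proof -
    show Q: "is_flat Q" "Q \<subset> F" "rk Q = rk Y" "Z \<subseteq> Q" "Q \<noteq> Y" using that S Y' Y by (auto simp: coatoms_above_def)
    show "Q \<in> NF" using Q Y(3) NF_iff_rk Y'(1) by simp
  qed
  show ?thesis
  proof
    assume "p \<in> flat_ideal (not_below Y \<union> coatoms_above Z Y)"
    then show "flat_var Y * p \<in> flat_ideal ?V"
    proof (rule flat_ideal_mult_into[rotated 2])
      fix G assume "G \<in> not_below Y \<union> coatoms_above Z Y"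
      then show "flat_var Y * unit_var G \<in> flat_ideal ?V"
      proof
        assume G: "G \<in> not_below Y"
        then have GNF: "G \<in> NF" "\<not> G \<subseteq> Y" by (auto simp: not_below_def)
        show ?thesis
        proof (cases "Y \<subseteq> G")
          case True
          show ?thesis
          proof (cases "G \<subseteq> F")
            case False
            then have "G \<in> ?V" using GNF by (auto simp: not_below_def)
            then show ?thesis using Y by (intro flat_ideal_mult flat_ideal_unit_var) auto
          next
            case GF: True
            have "rk Y < rk G" using rk_psubset[OF Y'(1) NF_flat[OF GNF(1)]] True GNF by blast
            then have "G = F" using flat_eq_of_rk[OF NF_flat[OF GNF(1)] NF_flat[OF F] GF] Y' by simp
            then show ?thesis
              using unit_var_top[OF F Y'(1,2), of "rk Y"] trF flat_ideal_mono[of "not_below F" ?V] Y F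
              by (auto simp: unit_var_NF)
          qed
        next
          case False
          then show ?thesis using GNF Y by (simp add: unit_var_NF flat_ideal_incomparable)
        qed
      next
        assume "G \<in> coatoms_above Z Y"
        then have G: "is_flat G" "G \<subset> Y" "Suc (rk G) = rk Y" "Z \<subseteq> G" by (auto simp: coatoms_above_def)
        \<comment> \<open>The join of \<open>G\<close> with \<open>a\<close> is a coatom of
          \<open>F\<close> above \<open>insert a Z\<close>, hence in \<open>S\<close>. Both
          \<open>x_G x_Y\<close> and \<open>x_G x_Q\<close> are congruent to
          \<open>- x_G x_F\<close>, so the former lies in the ideal with the latter.\<close>
        let ?Q = "closure (insert a G)"
        have aE: "a \<in> E - G" using a aY G NF_subset[OF F] by auto
        have sub: "insert a G \<subseteq> E" using aE flat_subset[OF G(1)] by auto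
        have Q: "is_flat ?Q" "rk ?Q = rk Y" "insert a G \<subseteq> ?Q"
          using flat_closure[OF sub] rk_closure_insert[OF G(1) aE] G subset_closure[OF sub] by auto
        have "?Q \<subseteq> F" using a G Y' by (intro closure_minimal NF_flat F) auto
        then have QF: "?Q \<subset> F" using Q nF by auto
        have "Suc (rk ?Q) = rk F" "insert a Z \<subseteq> ?Q" using Q G Y' by auto
        then have QS: "?Q \<in> S" using S(1) Q(1) QF unfolding coatoms_above_def by blast
        have 1: "unit_var G * (flat_var Y + flat_var F) \<in> flat_ideal ?V"
          using unit_var_exchange[OF F Y'(1,2) refl G(1)] G trF flat_ideal_mono[of "not_below F" ?V] by auto
        have 2: "unit_var G * (flat_var ?Q + flat_var F) \<in> flat_ideal ?V"
          using unit_var_exchange[OF F Q(1) QF Q(2) G(1)] Q G trF flat_ideal_mono[of "not_below F" ?V] by auto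
        have 3: "unit_var G * flat_var ?Q \<in> flat_ideal ?V"
          using QS S'(6) G by (intro flat_ideal_mult flat_ideal_var) auto
        have "unit_var G * (flat_var Y + flat_var F) - unit_var G * (flat_var ?Q + flat_var F)
            + unit_var G * flat_var ?Q \<in> flat_ideal ?V"
          by (rule flat_ideal_add[OF flat_ideal_diff[OF 1 2] 3])
        then show ?thesis by (simp add: algebra_simps)
      qed
    qed (use Y in auto)
  next
    assume Yp: "flat_var Y * p \<in> flat_ideal ?V"
    have "p \<in> flat_ideal (trunc_flats Y (rk Y - 1) \<union> coatoms_above Z Y)"
    proof (rule chow_form_nondegenerate)
      fix G q
      assume G: "is_flat G" "G = Y \<or> G \<subset> Y \<and> rk G \<le> rk Y - 1" "\<forall>H\<in>coatoms_above Z Y. \<not> G \<subseteq> H"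
      have GY: "G \<subseteq> Y" using G by auto
      have GS: "\<not> G \<subseteq> Q" if Q: "Q \<in> S" for Q
      proof
        assume GQ: "G \<subseteq> Q"
        \<comment> \<open>\<open>Y \<inter> Q\<close> is a flat above \<open>Z\<close> and properly
          inside \<open>Y\<close>, so some coatom of \<open>Y\<close> above \<open>Z\<close>
          contains it. A \<open>G\<close> below \<open>Q\<close> would lie below that
          coatom.\<close>
        have "\<not> Y \<subseteq> Q" using flat_eq_of_rk[OF Y'(1) S'(1)[OF Q]] S'[OF Q] by auto
        then have "rk (Y \<inter> Q) < rk Y" using rk_psubset[OF flat_Int[OF Y'(1) S'(1)[OF Q]] Y'(1)] by blast
        then have "rk (Y \<inter> Q) \<le> rk Y - 1" by simp
        from flat_between[OF flat_Int[OF Y'(1) S'(1)[OF Q]] Y'(1) Int_lower1 this diff_le_self]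
        obtain H where "is_flat H" "Y \<inter> Q \<subseteq> H" "H \<subseteq> Y" "rk H = rk Y - 1" by blast
        moreover have "0 < rk Y" using Y(3) NF_iff_rk Y'(1) by simp
        ultimately have "H \<in> coatoms_above Z Y" "G \<subseteq> H"
          using Y' S'(4)[OF Q] GY GQ by (auto simp: coatoms_above_def)
        then show False using G(3) by blast
      qed
      have "unit_var G * (flat_var Y * p) \<in> flat_ideal (not_below F)"
      proof (rule flat_ideal_mult_into[OF _ _ Yp])
        fix H assume "H \<in> ?V"
        then show "unit_var G * unit_var H \<in> flat_ideal (not_below F)"
        proof
          assume "H \<in> not_below F"
          then show ?thesis using G by (intro flat_ideal_mult flat_ideal_unit_var) auto
        next
          assume H: "H \<in> S"
          have "\<not> H \<subseteq> G"
          proof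
            assume "H \<subseteq> G"
            then have "H \<subseteq> Y" using GY by blast
            then show False using flat_eq_of_rk[OF S'(1)[OF H] Y'(1)] S'[OF H] by simp
          qed
          moreover have "G \<in> NF" using GS[OF H] G(1) by (auto simp: nonempty_flats_iff)
          ultimately show ?thesis using GS[OF H] S'(6)[OF H] by (simp add: unit_var_NF flat_ideal_incomparable)
        qed
      qed (use G in auto)
      then have "chow_form F (rk Y) (unit_var G * (flat_var Y * p) * q) = 0"
        using chow_form_kills[OF F nF] trF by simp
      then have "chow_form F (rk Y) (flat_var Y * (unit_var G * p * q)) = 0" by (simp add: ac_simps)
      then show "chow_form Y (rk Y - 1) (unit_var G * p * q) = 0"
        using chow_form_coatom[OF F Y(3) Y'(2)] by simp
    next
      show "rk Y - 1 < rk Y" using Y(3) NF_iff_rk Y'(1) by simp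
      then show "coatoms_above Z Y \<subseteq> {H. is_flat H \<and> H \<subset> Y \<and> rk H = rk Y - 1}"
        by (auto simp: coatoms_above_def)
    qed (use Y p in auto)
    then show "p \<in> flat_ideal (not_below Y \<union> coatoms_above Z Y)" unfolding trY .
  qed
qed

section \<open>Chains of ideals with colon ideals in the family\<close>

definition koszul_family :: "'a set set set" where
  "koszul_family = insert NF {not_below F \<union> coatoms_above Z F | F Z. F \<in> NF \<and> 2 \<le> rk F}"

text \<open>A relaxed form of a Koszul filtration: the ideal grows by one variable at a time with
  colon ideals from the family, but the intermediate ideals may be arbitrary.\<close>

inductive flat_chain :: "('a set, rat) mpoly set \<Rightarrow> bool" where
  base: "flat_chain (flat_ideal {})"
| step: "flat_chain (flat_ideal V) \<Longrightarrow> V \<subseteq> {G. is_flat G} \<Longrightarrow> F \<in> NF \<Longrightarrow> V' \<in> koszul_family \<Longrightarrow>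
    (\<And>p. p \<in> flat_polys \<Longrightarrow> flat_var F * p \<in> flat_ideal V \<longleftrightarrow> p \<in> flat_ideal V') \<Longrightarrow>
    flat_chain (flat_ideal (insert F V))"

text \<open>Removing a minimal flat from an upper set leaves an upper set that contains everything
  strictly above the removed flat, which is the situation of \<open>colon_upper\<close>.\<close>

lemma flat_chain_upper:
  assumes "U \<subseteq> NF" "\<And>G H. G \<in> U \<Longrightarrow> H \<in> NF \<Longrightarrow> G \<subseteq> H \<Longrightarrow> H \<in> U"
  shows "flat_chain (flat_ideal U)"
  using finite_subset[OF assms(1) finite_nonempty_flats] assms
proof (induction U rule: finite_psubset_induct)
  case (psubset U)
  show ?case
  proof (cases "U = {}")
    case True
    then show ?thesis by (simp add: flat_chain.base)
  next
    case False
    then obtain F where F: "F \<in> U" "\<And>G. G \<in> U \<Longrightarrow> G \<subseteq> F \<Longrightarrow> F = G"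
      using finite_has_minimal[OF psubset.hyps] by blast
    have FNF: "F \<in> NF" using F psubset by blast
    have up: "H \<in> U - {F}" if "G \<in> U - {F}" "H \<in> NF" "G \<subseteq> H" for G H
      using that psubset.prems(2)[of G H] F(2)[of G] by auto
    have above: "H \<in> U - {F}" if "H \<in> NF" "F \<subset> H" for H
      using that psubset.prems(2)[of F H] F by auto
    have IH: "flat_chain (flat_ideal (U - {F}))"
    proof (rule psubset.IH)
      show "U - {F} \<subset> U" "U - {F} \<subseteq> NF" using psubset.prems(1) F(1) by blast+
    qed (rule up)
    have U: "insert F (U - {F}) = U" using F by auto
    show ?thesis
    proof (cases "2 \<le> rk F")
      case True
      have "flat_chain (flat_ideal (insert F (U - {F})))"
      proof (rule flat_chain.step[OF IH _ FNF])
        show "not_below F \<union> coatoms_above {} F \<in> koszul_family" using FNF True by (auto simp: koszul_family_def)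
        show "flat_var F * p \<in> flat_ideal (U - {F}) \<longleftrightarrow> p \<in> flat_ideal (not_below F \<union> coatoms_above {} F)"
          if "p \<in> flat_polys" for p
        proof (rule colon_upper)
          show "U - {F} \<subseteq> NF" using psubset.prems(1) by blast
        qed (use up above FNF True that in \<open>blast+\<close>)
      qed (use psubset.prems(1) NF_flat in auto)
      then show ?thesis unfolding U .
    next
      case False
      then have rk: "rk F = 1" using FNF NF_iff_rk NF_flat by fastforce
      obtain i where i: "i \<in> F" using FNF by (auto simp: nonempty_flats_iff)
      \<comment> \<open>For a flat of rank one, the linear relation at one of its points expresses
        \<open>x_F\<close> through larger flats, which are already present; adjoining it does not
        change the ideal.\<close>
      have "unit_var {} * (\<Sum>H \<in> {F}. flat_var H) \<in> flat_ideal (U - {F})"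
      proof (rule unit_var_star_subset[OF flat_empty, of i])
        fix H assume H: "H \<in> NF" "i \<in> H" "H \<notin> {F}"
        then have "F \<subseteq> H" using cover_minimal[OF flat_empty NF_flat[OF FNF], of i H] rk i NF_flat by auto
        then show "H \<in> U - {F}" using above H by blast
      qed (use i FNF NF_subset in auto)
      then have "flat_var F \<in> flat_ideal (U - {F})" by (simp add: unit_var_def)
      then have "flat_ideal U \<subseteq> flat_ideal (U - {F})"
        using FNF by (intro flat_ideal_subset) (metis U insert_iff unit_var_NF flat_ideal_unit_var)
      then have "flat_ideal U = flat_ideal (U - {F})" using flat_ideal_mono[of "U - {F}" U] by auto
      then show ?thesis using IH by simp
    qed
  qed
qed

text \<open>An element \<open>b\<close> of \<open>F\<close> outside \<open>Z\<close> is chosen: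
  coatoms containing \<open>b\<close> come first, by induction, and the rest follow in any order.
  With rank at least three each \<open>Y\<close> has rank at least two, so its colon ideal is in the
  family.\<close>

lemma flat_chain_coatoms:
  assumes F: "F \<in> NF" "3 \<le> rk F"
  shows "flat_chain (flat_ideal (not_below F \<union> coatoms_above Z F))"
proof (induction "card (F - Z)" arbitrary: Z rule: less_induct)
  case less
  have finF: "finite F" using NF_subset[OF F(1)] finite_ground finite_subset by blast
  show ?case
  proof (cases "F \<subseteq> Z")
    case True
    then have "coatoms_above Z F = {}" by (auto simp: coatoms_above_def)
    then show ?thesis using flat_chain_upper[of "not_below F"] by (auto simp: not_below_def)
  next
    case False
    then obtain b where b: "b \<in> F" "b \<notin> Z" by auto
    let ?S = "coatoms_above (insert b Z) F"
    have "card (F - insert b Z) < card (F - Z)" using b finF by (intro psubset_card_mono) auto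
    then have IH: "flat_chain (flat_ideal (not_below F \<union> ?S))" by (rule less)
    have sub: "?S \<subseteq> coatoms_above Z F" by (auto simp: coatoms_above_def)
    have "flat_chain (flat_ideal (not_below F \<union> (?S \<union> D)))" if "finite D" "D \<subseteq> coatoms_above Z F - ?S" for D
      using that
    proof (induction D rule: finite_induct)
      case (insert Y D)
      have Y: "Y \<in> coatoms_above Z F" using insert by auto
      then have Y': "is_flat Y" "2 \<le> rk Y" using F by (auto simp: coatoms_above_def)
      then have YNF: "Y \<in> NF" using NF_iff_rk by auto
      have "flat_chain (flat_ideal (insert Y (not_below F \<union> (?S \<union> D))))"
      proof (rule flat_chain.step[OF _ _ YNF])
        show "not_below Y \<union> coatoms_above Z Y \<in> koszul_family" using YNF Y' by (auto simp: koszul_family_def)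
        show "flat_var Y * p \<in> flat_ideal (not_below F \<union> (?S \<union> D)) \<longleftrightarrow>
            p \<in> flat_ideal (not_below Y \<union> coatoms_above Z Y)" if "p \<in> flat_polys" for p
          using insert sub by (intro colon_coatom[OF F(1) b(1) _ _ Y _ YNF that]) auto
        show "not_below F \<union> (?S \<union> D) \<subseteq> {G. is_flat G}"
          using insert sub NF_flat by (auto simp: not_below_def coatoms_above_def)
      qed (use insert in auto)
      then show ?case by simp
    qed (use IH in simp)
    from this[of "coatoms_above Z F - ?S"]
    have "flat_chain (flat_ideal (not_below F \<union> (?S \<union> (coatoms_above Z F - ?S))))"
      using flats_finite by (auto simp: coatoms_above_def)
    then show ?thesis using sub by (simp add: Un_absorb1)
  qed
qed

text \<open>Below a flat of rank two the relations make every atom variable congruent to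
  \<open>- x_F\<close>. One atom in the ideal therefore brings in all variables.\<close>

lemma flat_ideal_rank_two:
  assumes F: "F \<in> NF" "rk F = 2" and Y: "Y \<in> coatoms_above Z F"
  shows "flat_ideal (not_below F \<union> coatoms_above Z F) = flat_ideal NF"
proof
  let ?V = "not_below F \<union> coatoms_above Z F"
  have tr: "trunc_flats F 1 = not_below F" using trunc_flats_full[OF F(1)] F(2) by simp
  have exch: "flat_var A + flat_var F \<in> flat_ideal ?V" if A: "is_flat A" "A \<subset> F" "rk A = 1" for A
    using unit_var_exchange[OF F(1) A flat_empty] tr flat_ideal_mono[of "not_below F" ?V] by (auto simp: unit_var_def)
  have Y': "is_flat Y" "Y \<subset> F" "rk Y = 1" using Y F by (auto simp: coatoms_above_def)
  then have "Y \<in> NF" using NF_iff_rk by auto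
  then have "(flat_var Y + flat_var F) - flat_var Y \<in> flat_ideal ?V"
    using Y by (intro flat_ideal_diff exch Y' flat_ideal_var) auto
  then have vF: "flat_var F \<in> flat_ideal ?V" by simp
  show "flat_ideal NF \<subseteq> flat_ideal ?V"
  proof (rule flat_ideal_subset)
    fix G assume G: "G \<in> NF"
    consider "G = F" | "\<not> G \<subseteq> F" | "G \<subset> F" by blast
    then show "unit_var G \<in> flat_ideal ?V"
    proof cases
      case 3
      have "rk G = 1" using rk_psubset[OF NF_flat[OF G] NF_flat[OF F(1)] 3] F(2) G NF_iff_rk[OF NF_flat[OF G]] by simp
      then have "(flat_var G + flat_var F) - flat_var F \<in> flat_ideal ?V"
        using 3 G NF_flat vF by (intro flat_ideal_diff exch) auto
      then show ?thesis using G by (simp add: unit_var_NF)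
    qed (use vF G in \<open>auto simp: unit_var_NF not_below_def intro: flat_ideal_var\<close>)
  qed
  have "?V \<subseteq> NF" using F by (auto simp: not_below_def coatoms_above_def NF_iff_rk)
  then show "flat_ideal ?V \<subseteq> flat_ideal NF" by (rule flat_ideal_mono)
qed

lemma flat_chain_koszul_family:
  assumes "V \<in> koszul_family" shows "flat_chain (flat_ideal V)"
proof -
  have top: "flat_chain (flat_ideal NF)" by (rule flat_chain_upper) auto
  from assms consider "V = NF" | F Z where "F \<in> NF" "2 \<le> rk F" "V = not_below F \<union> coatoms_above Z F"
    by (auto simp: koszul_family_def)
  then show ?thesis
  proof cases
    case (2 F Z)
    show ?thesis
    proof (cases "rk F = 2")
      case True
      show ?thesis
      proof (cases "coatoms_above Z F = {}")
        case True
        then show ?thesis using flat_chain_upper[of "not_below F"] 2 by (auto simp: not_below_def)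
      next
        case False
        then show ?thesis using flat_ideal_rank_two[OF 2(1) True] top 2 by auto
      qed
    next
      case False
      then show ?thesis using flat_chain_coatoms 2 by simp
    qed
  qed (simp add: top)
qed

end

section \<open>Linear resolutions from families of ideals with linear quotients\<close>

context cring
begin

abbreviation vectors :: "nat \<Rightarrow> (nat \<Rightarrow> 'a) set" where
  "vectors n \<equiv> {..<n} \<rightarrow>\<^sub>E carrier R"

text \<open>One operation that covers sums, multiples and differences, so that being a submodule is
  a single closure condition.\<close>

definition vec_axpy :: "nat \<Rightarrow> 'a \<Rightarrow> (nat \<Rightarrow> 'a) \<Rightarrow> (nat \<Rightarrow> 'a) \<Rightarrow> nat \<Rightarrow> 'a" where
  "vec_axpy n r w v = (\<lambda>k\<in>{..<n}. v k \<oplus> r \<otimes> w k)"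

definition vec_zero :: "nat \<Rightarrow> nat \<Rightarrow> 'a" where
  "vec_zero n = (\<lambda>k\<in>{..<n}. \<zero>)"

primrec lincomb :: "nat \<Rightarrow> (nat \<Rightarrow> 'a) \<Rightarrow> (nat \<Rightarrow> nat \<Rightarrow> 'a) \<Rightarrow> nat \<Rightarrow> 'a" where
  "lincomb 0 c W k = \<zero>"
| "lincomb (Suc t) c W k = lincomb t c W k \<oplus> c t \<otimes> W t k"

text \<open>\<open>D\<close> stands for the linear forms and \<open>FF\<close> for the family that
  has to contain the successive colon ideals.\<close>

inductive linear_quotients :: "'a set \<Rightarrow> 'a set set \<Rightarrow> 'a set \<Rightarrow> bool" for D FF where
  base: "linear_quotients D FF {\<zero>}"
| step: "linear_quotients D FF J \<Longrightarrow> l \<in> D \<Longrightarrow> {r \<in> carrier R. r \<otimes> l \<in> J} \<in> FF \<Longrightarrow>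
    linear_quotients D FF {a \<oplus> r \<otimes> l | a r. a \<in> J \<and> r \<in> carrier R}"

inductive vec_linear_quotients :: "'a set \<Rightarrow> 'a set set \<Rightarrow> nat \<Rightarrow> (nat \<Rightarrow> 'a) set \<Rightarrow> bool" for D FF n where
  base: "vec_linear_quotients D FF n {vec_zero n}"
| step: "vec_linear_quotients D FF n M \<Longrightarrow> w \<in> {..<n} \<rightarrow>\<^sub>E D \<Longrightarrow>
    {r \<in> carrier R. vec_axpy n r w (vec_zero n) \<in> M} \<in> FF \<Longrightarrow>
    vec_linear_quotients D FF n {vec_axpy n r w v | v r. v \<in> M \<and> r \<in> carrier R}"

text \<open>The leading position is the last one that may be nonzero, to match generators that are
  adjoined in increasing order.\<close>

definition leading_coeffs :: "nat \<Rightarrow> (nat \<Rightarrow> 'a) set \<Rightarrow> nat \<Rightarrow> 'a set" where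
  "leading_coeffs n K t = {v t | v. v \<in> K \<and> (\<forall>j. t < j \<longrightarrow> j < n \<longrightarrow> v j = \<zero>)}"

text \<open>The submodules of \<open>R\<^sup>n\<close> that occur as syzygies; \<open>h\<close> is the projection to the linear part of \<open>R\<close>.\<close>

definition triangular :: "('a \<Rightarrow> 'a) \<Rightarrow> 'a set set \<Rightarrow> nat \<Rightarrow> (nat \<Rightarrow> 'a) set \<Rightarrow> bool" where
  "triangular h FF n K \<longleftrightarrow> K \<subseteq> vectors n \<and> vec_zero n \<in> K \<and>
     (\<forall>v\<in>K. \<forall>w\<in>K. \<forall>r\<in>carrier R. vec_axpy n r w v \<in> K) \<and>
     (\<forall>v\<in>K. (\<lambda>k\<in>{..<n}. h (v k)) \<in> K) \<and> (\<forall>t<n. leading_coeffs n K t \<in> FF)"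

lemma linear_quotients_zero:
  assumes "linear_quotients D FF J" "D \<subseteq> carrier R"
  shows "J \<subseteq> carrier R \<and> \<zero> \<in> J"
  using assms(1)
proof induction
  case (step J l)
  have "\<zero> = \<zero> \<oplus> \<zero> \<otimes> l" "l \<in> carrier R" using step assms(2) by auto
  then show ?case using step by force
qed auto

lemma vec_axpy_closed: "v \<in> vectors n \<Longrightarrow> w \<in> vectors n \<Longrightarrow> r \<in> carrier R \<Longrightarrow> vec_axpy n r w v \<in> vectors n"
  by (auto simp: vec_axpy_def PiE_iff)

lemma vec_zero_closed: "vec_zero n \<in> vectors n"
  by (auto simp: vec_zero_def)

lemma vectors_eqI: "v \<in> vectors n \<Longrightarrow> w \<in> vectors n \<Longrightarrow> (\<And>k. k < n \<Longrightarrow> v k = w k) \<Longrightarrow> v = w"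
  by (rule PiE_ext) auto

lemma vec_axpy_apply: "k < n \<Longrightarrow> vec_axpy n r w v k = v k \<oplus> r \<otimes> w k"
  by (simp add: vec_axpy_def)

lemma vec_zero_apply: "k < n \<Longrightarrow> vec_zero n k = \<zero>"
  by (simp add: vec_zero_def)

lemma vectors_apply: "v \<in> vectors n \<Longrightarrow> k < n \<Longrightarrow> v k \<in> carrier R"
  by auto

text \<open>\<open>K\<close> is filtered by the last admissible coordinate. Each layer is governed
  by an ideal of leading coefficients, and its linear quotients lift: a multiple of the lifted
  vector lies in the part already built exactly if the same multiple of its leading entry lies in
  \<open>J\<close>.\<close>

lemma triangular_linear_quotients:
  assumes K: "triangular h FF n K" and FF: "\<And>J. J \<in> FF \<Longrightarrow> linear_quotients D FF J"
    and D: "D \<subseteq> carrier R" and h: "\<And>x. x \<in> carrier R \<Longrightarrow> h x \<in> D" "\<And>x. x \<in> D \<Longrightarrow> h x = x" "h \<zero> = \<zero>"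
  shows "vec_linear_quotients D FF n K"
proof -
  have Kvec: "\<And>v. v \<in> K \<Longrightarrow> v \<in> vectors n" and K0: "vec_zero n \<in> K"
    and Kadd: "\<And>v w r. v \<in> K \<Longrightarrow> w \<in> K \<Longrightarrow> r \<in> carrier R \<Longrightarrow> vec_axpy n r w v \<in> K"
    and Kh: "\<And>v. v \<in> K \<Longrightarrow> (\<lambda>k\<in>{..<n}. h (v k)) \<in> K"
    and KL: "\<And>t. t < n \<Longrightarrow> leading_coeffs n K t \<in> FF"
    using K unfolding triangular_def by blast+
  define trunc where "trunc m = {v \<in> K. \<forall>j. m \<le> j \<longrightarrow> j < n \<longrightarrow> v j = \<zero>}" for m
  have trunc_zero: "vec_zero n \<in> trunc m" for m using K0 by (auto simp: trunc_def vec_zero_apply)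
  have trunc_vec: "v \<in> vectors n" if "v \<in> trunc m" for v m using that Kvec by (auto simp: trunc_def)
  have trunc_axpy: "vec_axpy n r w v \<in> trunc m" if "v \<in> trunc m" "w \<in> trunc m" "r \<in> carrier R" for v w r m
    using that Kadd by (auto simp: trunc_def vec_axpy_apply)
  have "vec_linear_quotients D FF n (trunc m)" if "m \<le> n" for m
    using that
  proof (induction m)
    case 0
    have "trunc 0 = {vec_zero n}"
    proof -
      have "v = vec_zero n" if "v \<in> trunc 0" for v
        using that trunc_vec[OF that] by (intro vectors_eqI[OF _ vec_zero_closed]) (auto simp: trunc_def vec_zero_apply)
      then show ?thesis using trunc_zero by blast
    qed
    then show ?case by (simp add: vec_linear_quotients.base)
  next
    case (Suc m)
    let ?T = "trunc (Suc m)"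
    have m: "m < n" using Suc by simp
    have Tm: "v m \<in> carrier R" if "v \<in> ?T" for v using trunc_vec[OF that] m by auto
    have L: "leading_coeffs n K m = {v m | v. v \<in> ?T}"
      unfolding leading_coeffs_def trunc_def by (auto simp: Suc_le_eq)
    have part: "vec_linear_quotients D FF n {v \<in> ?T. v m \<in> J}"
      if "linear_quotients D FF J" "J \<subseteq> {v m | v. v \<in> ?T}" for J
      using that
    proof (induction J rule: linear_quotients.induct)
      case base
      have "{v \<in> ?T. v m \<in> {\<zero>}} = trunc m"
        using m by (auto simp: trunc_def Suc_le_eq) (metis le_neq_implies_less)
      then show ?case using Suc by simp
    next
      case (step J l)
      let ?J = "{a \<oplus> r \<otimes> l | a r. a \<in> J \<and> r \<in> carrier R}"
      have J: "J \<subseteq> carrier R" "\<zero> \<in> J" using linear_quotients_zero step D by auto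
      have l: "l \<in> carrier R" using step D by auto
      have "J \<subseteq> ?J"
      proof
        fix a assume a: "a \<in> J"
        then have "a = a \<oplus> \<zero> \<otimes> l" using l J by auto
        then show "a \<in> ?J" using a by blast
      qed
      then have IH: "vec_linear_quotients D FF n {v \<in> ?T. v m \<in> J}" using step by blast
      have "l = \<zero> \<oplus> \<one> \<otimes> l" using l by simp
      then have "l \<in> ?J" using J by blast
      \<comment> \<open>A vector of \<open>K\<close> with leading entry \<open>l\<close> exists, but
        its other entries may be arbitrary. Passing to the linear part \<open>w\<close> stays in
        \<open>K\<close> and keeps \<open>l\<close>, which is linear already.\<close>
      then obtain u where u: "u \<in> ?T" "u m = l" using step.prems by blast
      define w where "w = (\<lambda>k\<in>{..<n}. h (u k))"
      have wD: "w \<in> {..<n} \<rightarrow>\<^sub>E D" using trunc_vec[OF u(1)] h by (auto simp: w_def)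
      have wT: "w \<in> ?T" using u(1) Kh h(3) by (auto simp: w_def trunc_def)
      have wm: "w m = l" using m u h(2) step by (simp add: w_def)
      have "vec_linear_quotients D FF n {vec_axpy n r w v | v r. v \<in> {v \<in> ?T. v m \<in> J} \<and> r \<in> carrier R}"
      proof (rule vec_linear_quotients.step[OF IH wD])
        have "vec_axpy n r w (vec_zero n) \<in> {v \<in> ?T. v m \<in> J} \<longleftrightarrow> r \<otimes> l \<in> J" if "r \<in> carrier R" for r
          using that trunc_axpy[OF trunc_zero wT] m wm l by (simp add: vec_axpy_apply vec_zero_apply)
        then have "{r \<in> carrier R. vec_axpy n r w (vec_zero n) \<in> {v \<in> ?T. v m \<in> J}} = {r \<in> carrier R. r \<otimes> l \<in> J}"
          by blast
        then show "{r \<in> carrier R. vec_axpy n r w (vec_zero n) \<in> {v \<in> ?T. v m \<in> J}} \<in> FF"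
          using \<open>{r \<in> carrier R. r \<otimes> l \<in> J} \<in> FF\<close> by simp
      qed
      also have "{vec_axpy n r w v | v r. v \<in> {v \<in> ?T. v m \<in> J} \<and> r \<in> carrier R} = {v \<in> ?T. v m \<in> ?J}"
      proof (intro equalityI subsetI)
        fix x assume "x \<in> {vec_axpy n r w v | v r. v \<in> {v \<in> ?T. v m \<in> J} \<and> r \<in> carrier R}"
        then obtain v r where "x = vec_axpy n r w v" "v \<in> ?T" "v m \<in> J" "r \<in> carrier R" by blast
        then show "x \<in> {v \<in> ?T. v m \<in> ?J}" using trunc_axpy wT m wm by (auto simp: vec_axpy_apply)
      next
        fix x assume "x \<in> {v \<in> ?T. v m \<in> ?J}"
        then obtain a r where x: "x \<in> ?T" "x m = a \<oplus> r \<otimes> l" "a \<in> J" "r \<in> carrier R" by blast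
        let ?v = "vec_axpy n (\<ominus> r) w x"
        have v: "?v \<in> ?T" using trunc_axpy[OF x(1) wT] x by simp
        have "a \<in> carrier R" using x J by auto
        then have "?v m = a" using x wm m l by (simp add: vec_axpy_apply) algebra
        moreover have "x = vec_axpy n r w ?v"
        proof (rule vectors_eqI)
          fix k assume k: "k < n"
          have "x k \<in> carrier R" "w k \<in> carrier R"
            using k vectors_apply trunc_vec[OF x(1)] trunc_vec[OF wT] by auto
          then show "x k = vec_axpy n r w ?v k" using x(4) k by (simp add: vec_axpy_apply) algebra
        qed (use trunc_vec[OF x(1)] trunc_vec[OF v] trunc_vec[OF wT] x vec_axpy_closed in auto)
        ultimately show "x \<in> {vec_axpy n r w v | v r. v \<in> {v \<in> ?T. v m \<in> J} \<and> r \<in> carrier R}"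
          using v x by blast
      qed
      finally show ?case .
    qed
    have "linear_quotients D FF {v m | v. v \<in> ?T}" using FF[OF KL[OF m]] by (simp add: L)
    then have "vec_linear_quotients D FF n {v \<in> ?T. v m \<in> {v m | v. v \<in> ?T}}" using part by blast
    moreover have "{v \<in> ?T. v m \<in> {v m | v. v \<in> ?T}} = ?T" by blast
    ultimately show ?case by simp
  qed
  from this[of n] show ?thesis by (simp add: trunc_def)
qed

section \<open>Generators and their syzygies\<close>

lemma lincomb_closed:
  "(\<And>s. s < t \<Longrightarrow> c s \<in> carrier R) \<Longrightarrow> (\<And>s. s < t \<Longrightarrow> W s k \<in> carrier R) \<Longrightarrow> lincomb t c W k \<in> carrier R"
  by (induction t) auto

lemma lincomb_cong:
  "(\<And>s. s < t \<Longrightarrow> c s = c' s) \<Longrightarrow> (\<And>s. s < t \<Longrightarrow> W s k = W' s k) \<Longrightarrow> lincomb t c W k = lincomb t c' W' k"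
  by (induction t) auto

lemma lincomb_axpy:
  "(\<And>s. s < t \<Longrightarrow> c s \<in> carrier R) \<Longrightarrow> (\<And>s. s < t \<Longrightarrow> c' s \<in> carrier R) \<Longrightarrow> (\<And>s. s < t \<Longrightarrow> W s k \<in> carrier R) \<Longrightarrow>
    r \<in> carrier R \<Longrightarrow> lincomb t (\<lambda>s. c s \<oplus> r \<otimes> c' s) W k = lincomb t c W k \<oplus> r \<otimes> lincomb t c' W k"
proof (induction t)
  case (Suc t)
  have "lincomb t c W k \<in> carrier R" "lincomb t c' W k \<in> carrier R"
    using Suc by (auto intro!: lincomb_closed)
  moreover have "c t \<in> carrier R" "c' t \<in> carrier R" "W t k \<in> carrier R" "r \<in> carrier R" using Suc by auto
  moreover have "lincomb t (\<lambda>s. c s \<oplus> r \<otimes> c' s) W k = lincomb t c W k \<oplus> r \<otimes> lincomb t c' W k"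
    using Suc by auto
  ultimately show ?case by simp algebra
qed simp

lemma lincomb_zero:
  "(\<And>s. s < t \<Longrightarrow> c s = \<zero>) \<Longrightarrow> (\<And>s. s < t \<Longrightarrow> W s k \<in> carrier R) \<Longrightarrow> lincomb t c W k = \<zero>"
  by (induction t) auto

lemma lincomb_uminus:
  assumes "\<And>s. s < t \<Longrightarrow> c s \<in> carrier R" "\<And>s. s < t \<Longrightarrow> W s k \<in> carrier R"
  shows "lincomb t (\<lambda>s. \<ominus> c s) W k = \<ominus> lincomb t c W k"
  using assms
proof (induction t)
  case (Suc t)
  have "lincomb t c W k \<in> carrier R" using Suc by (auto intro!: lincomb_closed)
  moreover have "c t \<in> carrier R" "W t k \<in> carrier R" using Suc by auto
  moreover have "lincomb t (\<lambda>s. \<ominus> c s) W k = \<ominus> lincomb t c W k" using Suc by auto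
  ultimately show ?case by simp algebra
qed simp

text \<open>The adjoined vectors are recorded as the rows of \<open>W\<close>. A coefficient vector
  of length \<open>t\<close> uses only earlier rows, so the last clause is about the colon ideal of
  row \<open>t\<close> by its predecessors.\<close>

lemma vec_linear_quotients_generators:
  assumes "vec_linear_quotients D FF n M" and D: "D \<subseteq> carrier R"
  shows "\<exists>N W. (\<forall>t<N. W t \<in> {..<n} \<rightarrow>\<^sub>E D) \<and> M = (\<lambda>c. \<lambda>k\<in>{..<n}. lincomb N c W k) ` vectors N \<and>
    (\<forall>t<N. {r \<in> carrier R. \<exists>c\<in>vectors t. \<forall>k<n. r \<otimes> W t k = lincomb t c W k} \<in> FF)"
  using assms(1)
proof induction
  case base
  show ?case by (rule exI[of _ 0], rule exI[of _ "\<lambda>_. vec_zero n"]) (auto simp: vec_zero_def)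
next
  case (step M w)
  then obtain N W where W: "\<forall>t<N. W t \<in> {..<n} \<rightarrow>\<^sub>E D"
    and M: "M = (\<lambda>c. \<lambda>k\<in>{..<n}. lincomb N c W k) ` vectors N"
    and colon: "\<forall>t<N. {r \<in> carrier R. \<exists>c\<in>vectors t. \<forall>k<n. r \<otimes> W t k = lincomb t c W k} \<in> FF"
    by blast
  let ?W = "W(N := w)"
  have eq: "lincomb t c ?W k = lincomb t c W k" if "t \<le> N" for t c k
    using that by (intro lincomb_cong) auto
  have wR: "w k \<in> carrier R" if "k < n" for k using step(2) D that by auto
  show ?case
  proof (rule exI[of _ "Suc N"], rule exI[of _ ?W], intro conjI allI impI)
    fix t assume "t < Suc N"
    then show "?W t \<in> {..<n} \<rightarrow>\<^sub>E D" using W step(2) by (cases "t = N") auto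
  next
    show "{vec_axpy n r w v | v r. v \<in> M \<and> r \<in> carrier R} =
        (\<lambda>c. \<lambda>k\<in>{..<n}. lincomb (Suc N) c ?W k) ` vectors (Suc N)" (is "?A = ?B")
    proof (intro equalityI subsetI)
      fix x assume "x \<in> ?A"
      then obtain c r where c: "c \<in> vectors N" "r \<in> carrier R"
        "x = vec_axpy n r w (\<lambda>k\<in>{..<n}. lincomb N c W k)" unfolding M by blast
      let ?c = "\<lambda>s\<in>{..<Suc N}. if s = N then r else c s"
      have "?c \<in> vectors (Suc N)"
      proof (rule PiE_I)
        fix s assume "s \<in> {..<Suc N}"
        then show "?c s \<in> carrier R" using vectors_apply[OF c(1), of s] c(2) by (cases "s = N") auto
      qed auto
      moreover have "x = (\<lambda>k\<in>{..<n}. lincomb (Suc N) ?c ?W k)"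
      proof -
        have "lincomb N ?c W k = lincomb N c W k" for k by (intro lincomb_cong) auto
        then show ?thesis unfolding c(3) vec_axpy_def by (auto simp: eq)
      qed
      ultimately show "x \<in> ?B" by blast
    next
      fix x assume "x \<in> ?B"
      then obtain c where c: "c \<in> vectors (Suc N)" "x = (\<lambda>k\<in>{..<n}. lincomb (Suc N) c ?W k)" by blast
      have "lincomb N (restrict c {..<N}) W k = lincomb N c W k" for k by (intro lincomb_cong) auto
      then have "x = vec_axpy n (c N) w (\<lambda>k\<in>{..<n}. lincomb N (restrict c {..<N}) W k)"
        unfolding c(2) vec_axpy_def by (auto simp: eq)
      moreover have "restrict c {..<N} \<in> vectors N" "c N \<in> carrier R" using c(1) by (auto simp: PiE_iff)
      ultimately show "x \<in> ?A" unfolding M by blast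
    qed
  next
    fix t assume t: "t < Suc N"
    show "{r \<in> carrier R. \<exists>c\<in>vectors t. \<forall>k<n. r \<otimes> ?W t k = lincomb t c ?W k} \<in> FF"
    proof (cases "t = N")
      case True
      have "(\<exists>c\<in>vectors N. \<forall>k<n. r \<otimes> w k = lincomb N c W k) \<longleftrightarrow> vec_axpy n r w (vec_zero n) \<in> M"
        if r: "r \<in> carrier R" for r
      proof -
        have "vec_axpy n r w (vec_zero n) = (\<lambda>k\<in>{..<n}. r \<otimes> w k)"
          using r wR by (auto simp: vec_axpy_def vec_zero_def)
        moreover have "(\<lambda>k\<in>{..<n}. r \<otimes> w k) = (\<lambda>k\<in>{..<n}. lincomb N c W k) \<longleftrightarrow> (\<forall>k<n. r \<otimes> w k = lincomb N c W k)" for c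
          by (auto simp: restrict_def fun_eq_iff)
        ultimately show ?thesis unfolding M by auto
      qed
      then have "{r \<in> carrier R. \<exists>c\<in>vectors N. \<forall>k<n. r \<otimes> w k = lincomb N c W k} =
          {r \<in> carrier R. vec_axpy n r w (vec_zero n) \<in> M}" by blast
      then show ?thesis using step(3) True by (simp add: eq)
    next
      case False
      then show ?thesis using colon t by (simp add: eq less_Suc_eq)
    qed
  qed
qed

text \<open>In a syzygy ending at position \<open>t\<close>, the last coefficient multiplies
  \<open>W t\<close> into the span of the earlier rows; so the leading coefficients form the given
  colon ideals. If \<open>h'\<close> is the projection to degree two, applying \<open>h\<close> to a
  syzygy among linear vectors gives the degree-two part of the relation, which is zero
  again.\<close>

lemma kernel_triangular:
  assumes W: "\<And>t. t < N \<Longrightarrow> W t \<in> {..<n} \<rightarrow>\<^sub>E D" and D: "D \<subseteq> carrier R"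
    and colon: "\<And>t. t < N \<Longrightarrow> {r \<in> carrier R. \<exists>c\<in>vectors t. \<forall>k<n. r \<otimes> W t k = lincomb t c W k} \<in> FF"
    and h: "\<And>x. x \<in> carrier R \<Longrightarrow> h x \<in> D"
    and h': "h' \<zero> = \<zero>" "\<And>x y. x \<in> carrier R \<Longrightarrow> y \<in> carrier R \<Longrightarrow> h' (x \<oplus> y) = h' x \<oplus> h' y"
      "\<And>x l. x \<in> carrier R \<Longrightarrow> l \<in> D \<Longrightarrow> h' (x \<otimes> l) = h x \<otimes> l"
  shows "triangular h FF N {c \<in> vectors N. \<forall>k<n. lincomb N c W k = \<zero>}" (is "triangular h FF N ?K")
  unfolding triangular_def
proof (intro conjI ballI allI impI)
  have WD: "W t k \<in> D" if "t < N" "k < n" for t k using W[OF that(1)] that(2) by auto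
  have WR: "W t k \<in> carrier R" if "t < N" "k < n" for t k using WD that D by auto
  show "?K \<subseteq> vectors N" by auto
  show "vec_zero N \<in> ?K"
    using WR by (auto simp: vec_zero_closed intro!: lincomb_zero) (simp add: vec_zero_def)
  show "vec_axpy N r w v \<in> ?K" if v: "v \<in> ?K" and w: "w \<in> ?K" and r: "r \<in> carrier R" for v w r
  proof -
    have "lincomb N (vec_axpy N r w v) W k = \<zero>" if k: "k < n" for k
    proof -
      have "lincomb N (vec_axpy N r w v) W k = lincomb N (\<lambda>s. v s \<oplus> r \<otimes> w s) W k"
        by (intro lincomb_cong) (auto simp: vec_axpy_apply)
      also have "\<dots> = lincomb N v W k \<oplus> r \<otimes> lincomb N w W k"
        using v w r WR k by (intro lincomb_axpy) auto
      finally show ?thesis using v w r k by simp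
    qed
    then show ?thesis using v w r vec_axpy_closed by simp
  qed
  show "(\<lambda>k\<in>{..<N}. h (v k)) \<in> ?K" if v: "v \<in> ?K" for v
  proof -
    have "lincomb t (\<lambda>k\<in>{..<N}. h (v k)) W k = h' (lincomb t v W k)" if "t \<le> N" "k < n" for t k
      using that(1)
    proof (induction t)
      case (Suc t)
      have vR: "v s \<in> carrier R" if "s < N" for s using v that by auto
      have "lincomb t v W k \<in> carrier R" using Suc vR WR that by (intro lincomb_closed) auto
      then show ?case using Suc vR[of t] WD[of t k] WR[of t k] that h'(2,3) by simp
    qed (simp add: h')
    then show ?thesis using v h D h'(1) by (auto simp: PiE_iff)
  qed
  fix t assume t: "t < N"
  have "leading_coeffs N ?K t = {r \<in> carrier R. \<exists>c\<in>vectors t. \<forall>k<n. r \<otimes> W t k = lincomb t c W k}" (is "?L = ?C")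
  proof (intro equalityI subsetI)
    fix r assume "r \<in> ?L"
    then obtain c where c: "c \<in> vectors N" "\<forall>k<n. lincomb N c W k = \<zero>" "\<forall>j. t < j \<longrightarrow> j < N \<longrightarrow> c j = \<zero>" "r = c t"
      unfolding leading_coeffs_def by blast
    have ctR: "c s \<in> carrier R" if "s < N" for s using c(1) that by auto
    have trunc: "lincomb (Suc t + i) c W k = lincomb (Suc t) c W k" if "Suc t + i \<le> N" "k < n" for i k
      using that(1)
    proof (induction i)
      case (Suc i)
      have "lincomb (Suc t + i) c W k \<in> carrier R" using Suc ctR WR that by (intro lincomb_closed) auto
      then show ?case using Suc c(3) WR[of "Suc t + i" k] that by simp
    qed simp
    let ?c = "\<lambda>s\<in>{..<t}. \<ominus> c s"
    have "c t \<otimes> W t k = lincomb t ?c W k" if k: "k < n" for k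
    proof -
      have "lincomb (Suc t) c W k = \<zero>" using trunc[of "N - Suc t" k] t k c(2) by simp
      then have 0: "lincomb t c W k \<oplus> c t \<otimes> W t k = \<zero>" by simp
      have l: "lincomb t c W k \<in> carrier R" using ctR WR k t by (intro lincomb_closed) auto
      have "lincomb t ?c W k = lincomb t (\<lambda>s. \<ominus> c s) W k" by (intro lincomb_cong) auto
      also have "\<dots> = \<ominus> lincomb t c W k" using ctR WR k t by (intro lincomb_uminus) auto
      finally show ?thesis using 0 l ctR[OF t] WR[OF t k] by (metis m_closed minus_equality a_comm)
    qed
    moreover have "?c \<in> vectors t" using ctR t by auto
    ultimately show "r \<in> ?C" using c(4) ctR[OF t] by blast
  next
    fix r assume "r \<in> ?C"
    then obtain c where c: "r \<in> carrier R" "c \<in> vectors t" "\<forall>k<n. r \<otimes> W t k = lincomb t c W k" by blast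
    define d where "d = (\<lambda>s\<in>{..<N}. if s < t then \<ominus> c s else if s = t then r else \<zero>)"
    have d: "d t = r" "\<And>s. s < t \<Longrightarrow> d s = \<ominus> c s" "\<And>s. t < s \<Longrightarrow> s < N \<Longrightarrow> d s = \<zero>"
      using t by (auto simp: d_def)
    have cR: "c s \<in> carrier R" if "s < t" for s using c(2) that by auto
    have "lincomb (Suc t + i) d W k = \<zero>" if "Suc t + i \<le> N" "k < n" for i k
      using that(1)
    proof (induction i)
      case 0
      have "lincomb t d W k = lincomb t (\<lambda>s. \<ominus> c s) W k" using d by (intro lincomb_cong) auto
      also have "\<dots> = \<ominus> lincomb t c W k" using cR WR that t by (intro lincomb_uminus) auto
      finally have "lincomb t d W k = \<ominus> (r \<otimes> W t k)" using c(3) that by simp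
      then show ?case using t c(1) WR[OF t that(2)] d(1) by (simp add: l_neg)
    next
      case (Suc i)
      then show ?case using WR[of "Suc t + i" k] that d(3) by simp
    qed
    from this[of "N - Suc t"] have "\<forall>k<n. lincomb N d W k = \<zero>" using t by simp
    moreover have "d \<in> vectors N" using cR c(1) by (auto simp: d_def)
    moreover have "d t = r" by (rule d)
    moreover have "\<forall>j. t < j \<longrightarrow> j < N \<longrightarrow> d j = \<zero>" using d(3) by simp
    ultimately show "r \<in> ?L" unfolding leading_coeffs_def by blast
  qed
  then show "leading_coeffs N ?K t \<in> FF" using colon[OF t] by simp
qed

end

section \<open>Assembling the resolution\<close>

context graded_ring
begin

lemma gr_carrier: "x \<in> gr i \<Longrightarrow> x \<in> carrier R"
  using additive_subgroup.a_Hcarr[OF gr_subgroup] .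

lemma gr_zero: "\<zero> \<in> gr i"
  using additive_subgroup.zero_closed[OF gr_subgroup] .

lemma gr_add: "x \<in> gr i \<Longrightarrow> y \<in> gr i \<Longrightarrow> x \<oplus> y \<in> gr i"
  using additive_subgroup.a_closed[OF gr_subgroup] .

lemma gr_irrelevant:
  assumes "x \<in> gr i" "1 \<le> i"
  shows "x \<in> irrelevant_ideal R gr"
proof -
  let ?f = "\<lambda>j. if i = j then x else \<zero>"
  have "finsum R ?f {1..i} = x"
    using assms gr_carrier finsum_singleton[of i "{1..i}" "\<lambda>_. x"] by auto
  moreover have "\<forall>j\<in>{1..i}. ?f j \<in> gr j" using assms gr_zero by auto
  ultimately show ?thesis unfolding irrelevant_ideal_def
    by (intro CollectI exI[of _ ?f] exI[of _ i]) auto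
qed

lemma residue_module_simps:
  "carrier (residue_module R gr) = a_rcosets (irrelevant_ideal R gr)"
  "add (residue_module R gr) = set_add R"
  "ring.zero (residue_module R gr) = irrelevant_ideal R gr"
  "module.smult (residue_module R gr) r C = rcoset_mult R (irrelevant_ideal R gr) (irrelevant_ideal R gr +> r) C"
  by (simp_all add: residue_module_def Let_def ring.defs FactRing_def module.defs)

text \<open>Every syzygy module is \<open>triangular\<close> again and hence generated by vectors
  with linear entries. The matrices of the resolution consist of linear forms, which makes it both
  linear and minimal.\<close>

lemma linear_resolution:
  assumes ideal: "ideal (irrelevant_ideal R gr) R" and mem: "irrelevant_ideal R gr \<in> FF"
    and FF: "\<And>J. J \<in> FF \<Longrightarrow> linear_quotients (gr 1) FF J"
    and h: "\<And>x. x \<in> carrier R \<Longrightarrow> h x \<in> gr 1" "\<And>x. x \<in> gr 1 \<Longrightarrow> h x = x" "h \<zero> = \<zero>"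
    and h': "h' \<zero> = \<zero>" "\<And>x y. x \<in> carrier R \<Longrightarrow> y \<in> carrier R \<Longrightarrow> h' (x \<oplus> y) = h' x \<oplus> h' y"
      "\<And>x l. x \<in> carrier R \<Longrightarrow> l \<in> gr 1 \<Longrightarrow> h' (x \<otimes> l) = h x \<otimes> l"
  shows "\<exists>s d \<epsilon>. minimal_graded_free_resolution R gr (residue_module R gr) (residue_grading R gr) s d \<epsilon> \<and>
    (\<forall>i. set (s i) \<subseteq> {i})"
proof -
  let ?I = "irrelevant_ideal R gr"
  interpret I: ideal ?I R by (rule ideal)
  have D: "gr 1 \<subseteq> carrier R" using gr_carrier by auto
  define gens where "gens n K N W \<longleftrightarrow> (\<forall>t<N. W t \<in> {..<n} \<rightarrow>\<^sub>E gr 1) \<and>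
      K = (\<lambda>c. \<lambda>k\<in>{..<n}. lincomb N c W k) ` vectors N" for n K N and W :: "nat \<Rightarrow> nat \<Rightarrow> 'a"
  define ker where "ker n N W = {c \<in> vectors N. \<forall>k<n. lincomb N c W k = \<zero>}" for n N and W :: "nat \<Rightarrow> nat \<Rightarrow> 'a"
  have syz: "\<exists>N W. gens n K N W \<and> triangular h FF N (ker n N W)" if "triangular h FF n K" for n K
  proof -
    have "vec_linear_quotients (gr 1) FF n K"
      using triangular_linear_quotients[OF that FF D h] .
    from vec_linear_quotients_generators[OF this D] obtain N W where
      W: "\<forall>t<N. W t \<in> {..<n} \<rightarrow>\<^sub>E gr 1" "K = (\<lambda>c. \<lambda>k\<in>{..<n}. lincomb N c W k) ` vectors N"
        "\<forall>t<N. {r \<in> carrier R. \<exists>c\<in>vectors t. \<forall>k<n. r \<otimes> W t k = lincomb t c W k} \<in> FF"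
      by blast
    have "triangular h FF N {c \<in> vectors N. \<forall>k<n. lincomb N c W k = \<zero>}"
    proof (rule kernel_triangular[where h' = h' and D = "gr 1"])
      show "W t \<in> {..<n} \<rightarrow>\<^sub>E gr 1" if "t < N" for t using W(1) that by blast
      show "{r \<in> carrier R. \<exists>c\<in>vectors t. \<forall>k<n. r \<otimes> W t k = lincomb t c W k} \<in> FF" if "t < N" for t
        using W(3) that by blast
    qed (use D h(1) h' in simp_all)
    then show ?thesis using W unfolding gens_def ker_def by blast
  qed
  \<comment> \<open>The irrelevant ideal as a submodule of the free module of rank one: it is the
    kernel of the augmentation, so the first step is like all others.\<close>
  define K0 where "K0 = {v \<in> vectors 1. v 0 \<in> ?I}"
  have tri0: "triangular h FF 1 K0"
    unfolding triangular_def
  proof (intro conjI ballI allI impI)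
    show "K0 \<subseteq> vectors 1" by (auto simp: K0_def)
    show "vec_zero 1 \<in> K0" using vec_zero_closed[of 1] by (simp add: K0_def vec_zero_def)
    show "vec_axpy 1 r w v \<in> K0" if "v \<in> K0" "w \<in> K0" "r \<in> carrier R" for v w r
      using that vec_axpy_closed[of v 1 w r] I.I_l_closed by (auto simp: K0_def vec_axpy_apply)
    show "(\<lambda>k\<in>{..<1}. h (v k)) \<in> K0" if "v \<in> K0" for v
      using that h(1) D gr_irrelevant[OF h(1), of "v 0"] by (auto simp: K0_def PiE_iff)
    fix t :: nat assume "t < 1"
    have "leading_coeffs 1 K0 0 = ?I"
    proof (intro equalityI subsetI)
      fix x assume "x \<in> ?I"
      then have "(\<lambda>k\<in>{..<1}. x) \<in> K0" by (auto simp: K0_def)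
      then show "x \<in> leading_coeffs 1 K0 0" unfolding leading_coeffs_def
        by (intro CollectI exI[of _ "\<lambda>k\<in>{..<1}. x"]) simp
    qed (auto simp: leading_coeffs_def K0_def)
    then show "leading_coeffs 1 K0 t \<in> FF" using mem \<open>t < 1\<close> by simp
  qed
  \<comment> \<open>The state at stage \<open>i\<close> is the rank of the free module together with
    the submodule to be covered. A step chooses linear generators of this submodule, and their
    syzygies become the next state.\<close>
  have "\<exists>f. \<forall>i. (triangular h FF (fst (f i)) (snd (f i)) \<and> (i = 0 \<longrightarrow> f i = (1, K0))) \<and>
     (\<exists>W. gens (fst (f i)) (snd (f i)) (fst (f (Suc i))) W \<and>
          snd (f (Suc i)) = ker (fst (f i)) (fst (f (Suc i))) W)"
  proof (rule dependent_nat_choice)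
    fix x and i :: nat
    assume "triangular h FF (fst x) (snd x) \<and> (i = 0 \<longrightarrow> x = (1, K0))"
    then obtain N W where "gens (fst x) (snd x) N W" "triangular h FF N (ker (fst x) N W)"
      using syz by blast
    then show "\<exists>y. (triangular h FF (fst y) (snd y) \<and> (Suc i = 0 \<longrightarrow> y = (1, K0))) \<and>
        (\<exists>W. gens (fst x) (snd x) (fst y) W \<and> snd y = ker (fst x) (fst y) W)"
      by (intro exI[of _ "(N, ker (fst x) N W)"]) auto
  qed (use tri0 in auto)
  then obtain f where tri: "\<And>i. triangular h FF (fst (f i)) (snd (f i))" and f0: "f 0 = (1, K0)"
    and "\<And>i. \<exists>W. gens (fst (f i)) (snd (f i)) (fst (f (Suc i))) W \<and>
          snd (f (Suc i)) = ker (fst (f i)) (fst (f (Suc i))) W"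
    by metis
  then obtain W where W: "\<And>i. gens (fst (f i)) (snd (f i)) (fst (f (Suc i))) (W i)"
    and ker: "\<And>i. snd (f (Suc i)) = ker (fst (f i)) (fst (f (Suc i))) (W i)"
    by metis
  define b where "b i = fst (f i)" for i
  define s where "s i = replicate (b i) i" for i
  define d where "d i c = (\<lambda>k\<in>{..<b i}. lincomb (b (Suc i)) c (W i) k)" for i c
  define \<epsilon> where "\<epsilon> v = ?I +> v (0::nat)" for v
  have b0: "b 0 = 1" using f0 by (simp add: b_def)
  have len: "length (s i) = b i" for i by (simp add: s_def)
  have WD: "W i t k \<in> gr 1" if "t < b (Suc i)" "k < b i" for i t k
    using W[of i] that unfolding gens_def b_def by auto
  have WR: "W i t k \<in> carrier R" if "t < b (Suc i)" "k < b i" for i t k using WD[OF that] gr_carrier by blast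
  have free: "carrier (free_module R n) = vectors n" for n by (simp add: free_module_def)
  have free_add: "(x \<oplus>\<^bsub>free_module R n\<^esub> y) = (\<lambda>k\<in>{..<n}. x k \<oplus> y k)"
    and free_smult: "(r \<odot>\<^bsub>free_module R n\<^esub> x) = (\<lambda>k\<in>{..<n}. r \<otimes> x k)" for n r x y
    by (simp_all add: free_module_def)
  have image: "d i ` vectors (b (Suc i)) = snd (f i)" for i
    using W[of i] unfolding gens_def d_def b_def by auto
  have d_in: "d i c \<in> vectors (b i)" if "c \<in> vectors (b (Suc i))" for i c
    unfolding d_def using that WR by (auto intro!: lincomb_closed)
  have d_zero_iff: "d i c = ring.zero (free_module R (b i)) \<longleftrightarrow> (\<forall>k<b i. lincomb (b (Suc i)) c (W i) k = \<zero>)" for i c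
    by (auto simp: d_def free_module_def restrict_def fun_eq_iff)
  have d_kernel: "a_kernel (free_module R (b (Suc i))) (free_module R (b i)) (d i) = snd (f (Suc i))" for i
    unfolding a_kernel_def' ker ker_def b_def[symmetric] by (auto simp: free d_zero_iff)
  have \<epsilon>_kernel: "a_kernel (free_module R (b 0)) (residue_module R gr) \<epsilon> = snd (f 0)"
  proof -
    have "(?I +> x = ?I) \<longleftrightarrow> x \<in> ?I" if "x \<in> carrier R" for x
      using I.a_rcos_const[of x] I.a_rcos_self[OF that] by auto
    then show ?thesis unfolding a_kernel_def' f0 K0_def b0 by (auto simp: free residue_module_simps \<epsilon>_def)
  qed
  have \<epsilon>_hom: "graded_module_hom R (free_module R (b 0)) (free_grading R gr (s 0)) (residue_module R gr) (residue_grading R gr) \<epsilon>"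
    unfolding graded_module_hom_def
  proof (intro conjI ballI allI)
    show "\<epsilon> \<in> carrier (free_module R (b 0)) \<rightarrow> carrier (residue_module R gr)"
      using I.a_subset by (auto simp: free b0 residue_module_simps \<epsilon>_def intro!: a_rcosetsI)
  next
    fix x y assume "x \<in> carrier (free_module R (b 0))" "y \<in> carrier (free_module R (b 0))"
    then have xy: "x 0 \<in> carrier R" "y 0 \<in> carrier R" unfolding free b0 by auto
    have "(x \<oplus>\<^bsub>free_module R (b 0)\<^esub> y) 0 = x 0 \<oplus> y 0" by (simp add: free_module_def b0)
    then show "\<epsilon> (x \<oplus>\<^bsub>free_module R (b 0)\<^esub> y) = \<epsilon> x \<oplus>\<^bsub>residue_module R gr\<^esub> \<epsilon> y"
      unfolding \<epsilon>_def residue_module_simps I.a_rcos_sum[OF xy] by simp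
  next
    fix r x assume r: "r \<in> carrier R" and "x \<in> carrier (free_module R (b 0))"
    then have x: "x 0 \<in> carrier R" unfolding free b0 by auto
    have "(r \<odot>\<^bsub>free_module R (b 0)\<^esub> x) 0 = r \<otimes> x 0" by (simp add: free_module_def b0)
    then show "\<epsilon> (r \<odot>\<^bsub>free_module R (b 0)\<^esub> x) = r \<odot>\<^bsub>residue_module R gr\<^esub> \<epsilon> x"
      unfolding \<epsilon>_def residue_module_simps I.rcoset_mult_add[OF r x] by simp
  next
    fix j
    show "\<epsilon> ` free_grading R gr (s 0) j \<subseteq> residue_grading R gr j"
    proof
      fix y assume "y \<in> \<epsilon> ` free_grading R gr (s 0) j"
      then obtain x where x: "y = \<epsilon> x" "x \<in> vectors 1" "x 0 \<in> gr j"
        by (auto simp: free_grading_def len b0 free shifted_grading_def s_def)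
      show "y \<in> residue_grading R gr j"
      proof (cases "j = 0")
        case True
        then show ?thesis
          using x I.a_subset by (auto simp: residue_grading_def residue_module_simps \<epsilon>_def intro!: a_rcosetsI)
      next
        case False
        then have "x 0 \<in> ?I" using x gr_irrelevant by simp
        then show ?thesis using False x(1) I.a_rcos_const by (simp add: residue_grading_def residue_module_simps \<epsilon>_def)
      qed
    qed
  qed
  have d_hom: "graded_module_hom R (free_module R (b (Suc i))) (free_grading R gr (s (Suc i)))
      (free_module R (b i)) (free_grading R gr (s i)) (d i)" for i
    unfolding graded_module_hom_def
  proof (intro conjI ballI allI)
    show "d i \<in> carrier (free_module R (b (Suc i))) \<rightarrow> carrier (free_module R (b i))"
      using d_in by (auto simp: free)
  next
    fix x y assume x: "x \<in> carrier (free_module R (b (Suc i)))" and y: "y \<in> carrier (free_module R (b (Suc i)))"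
    let ?N = "b (Suc i)"
    have xR: "x t \<in> carrier R" "y t \<in> carrier R" if "t < ?N" for t
      using x y that unfolding free by auto
    have "lincomb ?N (\<lambda>t\<in>{..<?N}. x t \<oplus> y t) (W i) k = lincomb ?N x (W i) k \<oplus> lincomb ?N y (W i) k"
      if k: "k < b i" for k
    proof -
      have "lincomb ?N (\<lambda>t\<in>{..<?N}. x t \<oplus> y t) (W i) k = lincomb ?N (\<lambda>t. x t \<oplus> \<one> \<otimes> y t) (W i) k"
        using xR by (intro lincomb_cong) simp_all
      also have "\<dots> = lincomb ?N x (W i) k \<oplus> \<one> \<otimes> lincomb ?N y (W i) k"
        using xR WR k by (intro lincomb_axpy) simp_all
      also have "\<one> \<otimes> lincomb ?N y (W i) k = lincomb ?N y (W i) k"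
        using xR WR k by (intro l_one lincomb_closed) simp_all
      finally show ?thesis .
    qed
    then show "d i (x \<oplus>\<^bsub>free_module R ?N\<^esub> y) = d i x \<oplus>\<^bsub>free_module R (b i)\<^esub> d i y"
      unfolding d_def free_add by (auto simp only: restrict_def fun_eq_iff lessThan_iff if_True if_False split: if_split)
  next
    fix r x assume r: "r \<in> carrier R" and x: "x \<in> carrier (free_module R (b (Suc i)))"
    let ?N = "b (Suc i)"
    have xR: "x t \<in> carrier R" if "t < ?N" for t using x that unfolding free by auto
    have "lincomb ?N (\<lambda>t\<in>{..<?N}. r \<otimes> x t) (W i) k = r \<otimes> lincomb ?N x (W i) k" if k: "k < b i" for k
    proof -
      have "lincomb ?N (\<lambda>t\<in>{..<?N}. r \<otimes> x t) (W i) k = lincomb ?N (\<lambda>t. \<zero> \<oplus> r \<otimes> x t) (W i) k"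
        using xR r by (intro lincomb_cong) simp_all
      also have "\<dots> = lincomb ?N (\<lambda>_. \<zero>) (W i) k \<oplus> r \<otimes> lincomb ?N x (W i) k"
        using xR r WR k by (intro lincomb_axpy) simp_all
      also have "lincomb ?N (\<lambda>_. \<zero>) (W i) k = \<zero>"
        using WR k by (intro lincomb_zero) simp_all
      also have "\<zero> \<oplus> r \<otimes> lincomb ?N x (W i) k = r \<otimes> lincomb ?N x (W i) k"
        using xR r WR k by (intro l_zero m_closed lincomb_closed) simp_all
      finally show ?thesis .
    qed
    then show "d i (r \<odot>\<^bsub>free_module R ?N\<^esub> x) = r \<odot>\<^bsub>free_module R (b i)\<^esub> d i x"
      unfolding d_def free_smult by (auto simp only: restrict_def fun_eq_iff lessThan_iff if_True if_False split: if_split)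
  next
    fix j
    show "d i ` free_grading R gr (s (Suc i)) j \<subseteq> free_grading R gr (s i) j"
    proof
      fix y assume "y \<in> d i ` free_grading R gr (s (Suc i)) j"
      then obtain c where c: "y = d i c" "c \<in> vectors (b (Suc i))"
        "\<forall>t<b (Suc i). c t \<in> shifted_grading R gr (Suc i) j"
        by (auto simp: free_grading_def len free s_def)
      have "lincomb t c (W i) k \<in> shifted_grading R gr i j" if "t \<le> b (Suc i)" "k < b i" for t k
        using that(1)
      proof (induction t)
        case 0
        then show ?case using gr_zero by (simp add: shifted_grading_def)
      next
        case (Suc t)
        have ct: "c t \<in> shifted_grading R gr (Suc i) j" and w: "W i t k \<in> gr 1" "W i t k \<in> carrier R"
          using Suc c(3) WD[of t i k] WR[of t i k] that by auto
        \<comment> \<open>A linear entry raises the degree by one, which compensates the passage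
          from the shift by \<open>Suc i\<close> to the shift by \<open>i\<close>.\<close>
        have "c t \<otimes> W i t k \<in> shifted_grading R gr i j"
        proof (cases "Suc i \<le> j")
          case True
          then have "c t \<otimes> W i t k \<in> gr (j - Suc i + 1)"
            using ct w(1) by (intro gr_mult) (simp_all add: shifted_grading_def)
          then show ?thesis using True by (simp add: shifted_grading_def Suc_diff_Suc)
        next
          case False
          then have "c t = \<zero>" using ct by (simp add: shifted_grading_def)
          then show ?thesis using w gr_zero by (simp add: shifted_grading_def)
        qed
        then show ?case using Suc gr_add by (auto simp: shifted_grading_def)
      qed
      then show "y \<in> free_grading R gr (s i) j"
        using d_in[OF c(2)] by (auto simp: c(1) free_grading_def len free s_def) (auto simp: d_def)
    qed
  qed
  have "\<epsilon> ` carrier (free_module R (b 0)) = carrier (residue_module R gr)"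
  proof
    show "carrier (residue_module R gr) \<subseteq> \<epsilon> ` carrier (free_module R (b 0))"
    proof
      fix C assume "C \<in> carrier (residue_module R gr)"
      then obtain x where x: "x \<in> carrier R" "C = ?I +> x"
        by (auto simp: residue_module_simps A_RCOSETS_def')
      then have "(\<lambda>k\<in>{..<1}. x) \<in> vectors 1" "\<epsilon> (\<lambda>k\<in>{..<1}. x) = C" by (auto simp: \<epsilon>_def)
      then show "C \<in> \<epsilon> ` carrier (free_module R (b 0))" unfolding free b0 by blast
    qed
  qed (use \<epsilon>_hom in \<open>auto simp: graded_module_hom_def\<close>)
  moreover have "d i v k \<in> ?I" if v: "v \<in> vectors (b (Suc i))" and k: "k < b i" for i v k
  proof -
    have "lincomb t v (W i) k \<in> ?I" if "t \<le> b (Suc i)" for t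
      using that
    proof (induction t)
      case (Suc t)
      have "W i t k \<in> ?I" using gr_irrelevant[OF WD[of t i k]] Suc.prems k by simp
      moreover have "v t \<in> carrier R" using vectors_apply[OF v, of t] Suc.prems by simp
      ultimately have "v t \<otimes> W i t k \<in> ?I" by (rule I.I_l_closed)
      then show ?case using Suc by simp
    qed simp
    then show ?thesis using k by (simp add: d_def)
  qed
  ultimately have "minimal_graded_free_resolution R gr (residue_module R gr) (residue_grading R gr) s d \<epsilon>"
    unfolding minimal_graded_free_resolution_def Let_def len
    using \<epsilon>_hom d_hom image d_kernel \<epsilon>_kernel by (simp add: free)
  moreover have "set (s i) \<subseteq> {i}" for i by (auto simp: s_def)
  ultimately show ?thesis by blast
qed

end

section \<open>Homogeneous components\<close>

text \<open>The degree test sits inside the coefficient, so each summand is additive in it and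
  additivity holds termwise.\<close>

definition hom_part :: "nat \<Rightarrow> ('v, 'k::comm_ring_1) mpoly \<Rightarrow> ('v, 'k) mpoly" where
  "hom_part d p = (\<Sum>m \<in> Poly_Mapping.keys p.
     Poly_Mapping.single m (if monomial_degree m = d then Poly_Mapping.lookup p m else 0))"

lemma hom_part_zero [simp]: "hom_part d 0 = 0"
  by (simp add: hom_part_def)

lemma hom_part_add [simp]: "hom_part d (p + q) = hom_part d p + hom_part d q"
  unfolding hom_part_def
  by (rule setsum_keys_plus_distrib[of "\<lambda>m c. Poly_Mapping.single m (if monomial_degree m = d then c else 0)"])
    (auto simp: single_add[symmetric])

lemma hom_part_sum: "hom_part d (sum f A) = (\<Sum>a\<in>A. hom_part d (f a))"
  by (induction A rule: infinite_finite_induct) auto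

lemma lookup_hom_part:
  "Poly_Mapping.lookup (hom_part d p) m = (if monomial_degree m = d then Poly_Mapping.lookup p m else 0)"
proof (induction p rule: poly_mapping_add_induct)
  case (add k c p)
  have "hom_part d (Poly_Mapping.single k c) = Poly_Mapping.single k (if monomial_degree k = d then c else 0)"
    by (cases "c = 0") (auto simp: hom_part_def)
  then show ?case using add by (auto simp: lookup_add lookup_single when_def)
qed simp

lemma hom_part_homogeneous: "mpoly_homogeneous d (hom_part d p)"
  by (auto simp: mpoly_homogeneous_def in_keys_iff lookup_hom_part split: if_splits)

lemma hom_part_of_homogeneous:
  "mpoly_homogeneous e p \<Longrightarrow> hom_part d p = (if d = e then p else 0)"
  by (auto simp: mpoly_homogeneous_def lookup_hom_part in_keys_iff intro!: poly_mapping_eqI)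

lemma sum_hom_part:
  assumes "finite A" "monomial_degree ` Poly_Mapping.keys p \<subseteq> A"
  shows "(\<Sum>d\<in>A. hom_part d p) = p"
proof (rule poly_mapping_eqI)
  fix m
  show "Poly_Mapping.lookup (\<Sum>d\<in>A. hom_part d p) m = Poly_Mapping.lookup p m"
    using assms by (cases "m \<in> Poly_Mapping.keys p")
      (auto simp: lookup_sum lookup_hom_part sum.delta in_keys_iff)
qed

lemma keys_hom_part: "Poly_Mapping.keys (hom_part d p) \<subseteq> Poly_Mapping.keys p"
  by (auto simp: in_keys_iff lookup_hom_part split: if_splits)

lemma mpoly_homogeneous_mult:
  assumes "mpoly_homogeneous d p" "mpoly_homogeneous e q"
  shows "mpoly_homogeneous (d + e) (p * q)"
  using assms keys_mult[of p q] by (fastforce simp: mpoly_homogeneous_def)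

lemma mpoly_homogeneous_simps [simp]:
  "mpoly_homogeneous d 0" "mpoly_homogeneous 0 (mpoly_const c)" "mpoly_homogeneous 1 (mpoly_var v)"
  by (auto simp: mpoly_homogeneous_def mpoly_const_def mpoly_var_def split: if_splits)

lemma mpoly_homogeneous_add:
  "mpoly_homogeneous d p \<Longrightarrow> mpoly_homogeneous d q \<Longrightarrow> mpoly_homogeneous d (p + q)"
  using keys_add[of p q] by (auto simp: mpoly_homogeneous_def)

lemma mpoly_homogeneous_uminus: "mpoly_homogeneous d p \<Longrightarrow> mpoly_homogeneous d (- p)"
  by (simp add: mpoly_homogeneous_def)

lemma mpoly_homogeneous_sum:
  "(\<And>a. a \<in> A \<Longrightarrow> mpoly_homogeneous d (f a)) \<Longrightarrow> mpoly_homogeneous d (sum f A)"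
  by (induction A rule: infinite_finite_induct) (auto intro: mpoly_homogeneous_add)

lemma hom_part_mult:
  assumes "mpoly_homogeneous e q"
  shows "hom_part k (p * q) = (if e \<le> k then hom_part (k - e) p * q else 0)"
proof -
  \<comment> \<open>\<open>k - e\<close> is added so that the one surviving index is in range even
    if \<open>p\<close> has no term of that degree.\<close>
  let ?A = "insert (k - e) (monomial_degree ` Poly_Mapping.keys p)"
  have sum: "(\<Sum>d\<in>?A. hom_part d p) = p" by (rule sum_hom_part) auto
  have "p * q = (\<Sum>d\<in>?A. hom_part d p * q)"
    unfolding sum_distrib_right[symmetric] sum ..
  then have "hom_part k (p * q) = (\<Sum>d\<in>?A. hom_part k (hom_part d p * q))"
    by (simp only: hom_part_sum)
  also have "\<dots> = (\<Sum>d\<in>?A. if k = d + e then hom_part d p * q else 0)"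
    using mpoly_homogeneous_mult[OF hom_part_homogeneous assms]
    by (intro sum.cong refl) (simp add: hom_part_of_homogeneous)
  also have "\<dots> = (\<Sum>d\<in>?A. if d = k - e then (if e \<le> k then hom_part d p * q else 0) else 0)"
    by (intro sum.cong) auto
  also have "\<dots> = (if e \<le> k then hom_part (k - e) p * q else 0)"
    by (subst sum.delta) auto
  finally show ?thesis .
qed

lemma homogeneous_0_const: "mpoly_homogeneous 0 p \<Longrightarrow> p = mpoly_const (Poly_Mapping.lookup p 0)"
  by (rule poly_mapping_eqI)
    (auto simp: mpoly_const_def lookup_single when_def mpoly_homogeneous_def monomial_degree_eq_0_iff in_keys_iff)

lemma mpoly_generated_induct [consumes 1, case_names const var add mult]:
  fixes p :: "('v, 'k::comm_ring_1) mpoly"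
  assumes "\<forall>m \<in> Poly_Mapping.keys p. Poly_Mapping.keys m \<subseteq> V"
    and const: "\<And>c. P (mpoly_const c)" and var: "\<And>v. v \<in> V \<Longrightarrow> P (mpoly_var v)"
    and add: "\<And>p q. P p \<Longrightarrow> P q \<Longrightarrow> P (p + q)" and mult: "\<And>p q. P p \<Longrightarrow> P q \<Longrightarrow> P (p * q)"
  shows "P p"
proof -
  have mono: "P (Poly_Mapping.single m c)" if "Poly_Mapping.keys m \<subseteq> V" for m c
    using that
  proof (induction m rule: poly_mapping_add_induct)
    case zero
    show ?case using const[of c] by (simp add: mpoly_const_def)
  next
    case (add v k m)
    have keys: "Poly_Mapping.keys (Poly_Mapping.single v k + m) = insert v (Poly_Mapping.keys m)"
      using add(1,2) by (auto simp: in_keys_iff lookup_add lookup_single when_def split: if_splits)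
    then have IH: "P (Poly_Mapping.single m c)" and v: "v \<in> V" using add by auto
    have "P (Poly_Mapping.single (Poly_Mapping.single v k + m) c)"
    proof (induction k)
      case 0
      show ?case using IH by simp
    next
      case (Suc k)
      have "Poly_Mapping.single (Poly_Mapping.single v (Suc k) + m) c =
          mpoly_var v * Poly_Mapping.single (Poly_Mapping.single v k + m) c"
        by (simp add: mpoly_var_def mult_single single_add[symmetric] add.assoc[symmetric])
      then show ?case using mult[OF var[OF v] Suc] by simp
    qed
    then show ?case .
  qed
  show ?thesis
    using assms(1)
  proof (induction p rule: poly_mapping_add_induct)
    case zero
    show ?case using const[of 0] by (simp add: mpoly_const_simps)
  next
    case (add m c p)
    have keys: "Poly_Mapping.keys (Poly_Mapping.single m c + p) = insert m (Poly_Mapping.keys p)"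
      using add(1,2) by (auto simp: in_keys_iff lookup_add lookup_single when_def split: if_splits)
    then show ?case using add mono assms(4) by auto
  qed
qed

section \<open>The Chow ring as a graded algebra\<close>

context simple_matroid
begin

abbreviation "PR \<equiv> chow_poly_ring E indep"
abbreviation "CR \<equiv> chow_ring E indep"
abbreviation "CI \<equiv> chow_ideal E indep"
abbreviation "CG \<equiv> chow_grading E indep"

definition chow_class :: "('a set, rat) mpoly \<Rightarrow> ('a set, rat) mpoly set" where
  "chow_class p = CI +>\<^bsub>PR\<^esub> p"

lemma chow_poly_ring_simps [simp]:
  "carrier PR = flat_polys" "x \<otimes>\<^bsub>PR\<^esub> y = x * y" "x \<oplus>\<^bsub>PR\<^esub> y = x + y" "\<zero>\<^bsub>PR\<^esub> = 0" "\<one>\<^bsub>PR\<^esub> = 1"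
  by (simp_all add: chow_poly_ring_def mpoly_ring_def ring_of_type_algebra_def flat_polys_def)

lemma cring_poly: "cring PR"
proof (intro cringI abelian_groupI comm_monoidI)
  show "\<exists>y\<in>carrier PR. y \<oplus>\<^bsub>PR\<^esub> x = \<zero>\<^bsub>PR\<^esub>" if "x \<in> carrier PR" for x
    using that by (intro bexI[of _ "- x"]) auto
qed (auto simp: algebra_simps)

interpretation PR: cring PR by (rule cring_poly)

lemma ideal_ideal_span:
  assumes "S \<subseteq> flat_polys" shows "ideal (ideal_span flat_polys S) PR"
proof (rule idealI)
  show "ring PR" by unfold_locales
  have sub: "ideal_span flat_polys S \<subseteq> flat_polys"
  proof
    fix p assume "p \<in> ideal_span flat_polys S"
    then show "p \<in> flat_polys" using assms by (induction p rule: ideal_span.induct) auto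
  qed
  have mult: "r * p \<in> ideal_span flat_polys S" if "p \<in> ideal_span flat_polys S" "r \<in> flat_polys" for p r
    using ideal_span_mult[OF _ that] by auto
  show "subgroup (ideal_span flat_polys S) (add_monoid PR)"
  proof (rule PR.add.subgroupI)
    fix p assume p: "p \<in> ideal_span flat_polys S"
    have "p \<oplus>\<^bsub>PR\<^esub> - p = \<zero>\<^bsub>PR\<^esub>" by simp
    then have "\<ominus>\<^bsub>PR\<^esub> p = - p" using p sub by (intro PR.minus_equality) auto
    then show "\<ominus>\<^bsub>PR\<^esub> p \<in> ideal_span flat_polys S" using mult[OF p, of "- 1"] by simp
  qed (use sub ideal_span.zero in \<open>auto intro: ideal_span_add\<close>)
  show "x \<otimes>\<^bsub>PR\<^esub> a \<in> ideal_span flat_polys S" "a \<otimes>\<^bsub>PR\<^esub> x \<in> ideal_span flat_polys S"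
    if "a \<in> ideal_span flat_polys S" "x \<in> carrier PR" for a x
    using mult that by (auto simp: mult.commute)
qed

lemma genideal_ideal_span:
  assumes "S \<subseteq> flat_polys" shows "Idl\<^bsub>PR\<^esub> S = ideal_span flat_polys S"
proof
  have "S \<subseteq> ideal_span flat_polys S"
    using ideal_span.step[OF ideal_span.zero, of 1 flat_polys] by auto
  then show "Idl\<^bsub>PR\<^esub> S \<subseteq> ideal_span flat_polys S"
    using PR.genideal_minimal[OF ideal_ideal_span[OF assms]] by blast
  interpret J: ideal "Idl\<^bsub>PR\<^esub> S" PR using PR.genideal_ideal assms by simp
  show "ideal_span flat_polys S \<subseteq> Idl\<^bsub>PR\<^esub> S"
  proof
    fix p assume "p \<in> ideal_span flat_polys S"
    then show "p \<in> Idl\<^bsub>PR\<^esub> S"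
    proof (induction p rule: ideal_span.induct)
      case zero
      show ?case using J.zero_closed by simp
    next
      case (step p q g)
      have "g \<in> Idl\<^bsub>PR\<^esub> S" using PR.genideal_self[of S] assms step by auto
      then show ?case using J.a_closed[OF step.IH J.I_l_closed[of g q]] step by simp
    qed
  qed
qed

lemma chow_ideal_eq: "CI = flat_ideal {}"
proof -
  have lin: "linear_relations \<subseteq> flat_polys" by (auto simp: linear_relations_def)
  have inc: "incomparable_products \<subseteq> flat_polys" by (auto simp: incomparable_products_def)
  have "CI = ideal_span flat_polys linear_relations <+>\<^bsub>PR\<^esub> ideal_span flat_polys incomparable_products"
    using genideal_ideal_span[OF lin] genideal_ideal_span[OF inc]
    by (simp add: chow_ideal_def chow_linear_ideal_def chow_incomparable_ideal_def linear_relations_def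
        incomparable_products_def)
  also have "\<dots> = ideal_span flat_polys (linear_relations \<union> incomparable_products)" (is "?A = ?B")
  proof (intro equalityI subsetI)
    have mono: "p \<in> ideal_span flat_polys S \<Longrightarrow> S \<subseteq> T \<Longrightarrow> p \<in> ideal_span flat_polys T" for p S T
      by (induction p rule: ideal_span.induct) (auto intro: ideal_span.intros)
    fix p assume "p \<in> ?A"
    then obtain a b where "p = a + b" "a \<in> ideal_span flat_polys linear_relations"
      "b \<in> ideal_span flat_polys incomparable_products"
      by (auto simp: set_add_def')
    then show "p \<in> ?B" using mono by (auto intro!: ideal_span_add)
  next
    fix p assume "p \<in> ?B"
    then have "\<exists>a\<in>ideal_span flat_polys linear_relations. \<exists>b\<in>ideal_span flat_polys incomparable_products. p = a + b"
    proof (induction p rule: ideal_span.induct)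
      case zero
      show ?case using ideal_span.zero by force
    next
      case (step p q g)
      then obtain a b where ab: "a \<in> ideal_span flat_polys linear_relations"
        "b \<in> ideal_span flat_polys incomparable_products" "p = a + b" by blast
      from step(3) show ?case
      proof
        assume "g \<in> linear_relations"
        then have "a + q * g \<in> ideal_span flat_polys linear_relations" using ab step by (intro ideal_span.step) auto
        moreover have "p + q * g = (a + q * g) + b" using ab by simp
        ultimately show ?thesis using ab by blast
      next
        assume "g \<in> incomparable_products"
        then have "b + q * g \<in> ideal_span flat_polys incomparable_products" using ab step by (intro ideal_span.step) auto
        moreover have "p + q * g = a + (b + q * g)" using ab by simp
        ultimately show ?thesis using ab by blast
      qed
    qed
    then show "p \<in> ?A" by (auto simp: set_add_def')
  qed
  finally show ?thesis by (simp add: flat_ideal_def)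
qed

lemma ideal_CI: "ideal CI PR"
  unfolding chow_ideal_eq flat_ideal_def
  by (rule ideal_ideal_span) (auto simp: linear_relations_def incomparable_products_def)

interpretation CI: ideal CI PR by (rule ideal_CI)

lemma PR_a_inv: "p \<in> flat_polys \<Longrightarrow> \<ominus>\<^bsub>PR\<^esub> p = - p"
  using PR.minus_equality[of "- p" p] by simp

lemma chow_class_eq_iff:
  assumes "p \<in> flat_polys" "q \<in> flat_polys"
  shows "chow_class p = chow_class q \<longleftrightarrow> p - q \<in> flat_ideal {}"
proof -
  have "p \<in> CI +>\<^bsub>PR\<^esub> q \<longleftrightarrow> p - q \<in> CI"
    using CI.a_rcos_module[of q p] assms PR_a_inv by simp
  moreover have "chow_class p = chow_class q \<longleftrightarrow> p \<in> CI +>\<^bsub>PR\<^esub> q"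
    using CI.a_repr_independence'[of p q] CI.a_rcos_self[of p] assms by (auto simp: chow_class_def)
  ultimately show ?thesis by (simp add: chow_ideal_eq)
qed

lemma chow_ring_carrier: "carrier CR = chow_class ` flat_polys"
  by (auto simp: chow_ring_def Let_def ring.defs FactRing_def A_RCOSETS_def' chow_class_def)

lemma chow_ring_simps:
  assumes "p \<in> flat_polys" "q \<in> flat_polys"
  shows "chow_class p \<oplus>\<^bsub>CR\<^esub> chow_class q = chow_class (p + q)"
    "chow_class p \<otimes>\<^bsub>CR\<^esub> chow_class q = chow_class (p * q)"
  using assms CI.a_rcos_sum[of p q] CI.rcoset_mult_add[of p q]
  by (simp_all add: chow_ring_def Let_def ring.defs module.defs FactRing_def chow_class_def)

lemma chow_ring_smult: "p \<in> flat_polys \<Longrightarrow> c \<odot>\<^bsub>CR\<^esub> chow_class p = chow_class (mpoly_const c * p)"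
  using CI.rcoset_mult_add[of "mpoly_const c" p]
  by (simp add: chow_ring_def Let_def ring.defs module.defs FactRing_def chow_class_def)

lemma chow_ring_zero: "\<zero>\<^bsub>CR\<^esub> = chow_class 0" and chow_ring_one: "\<one>\<^bsub>CR\<^esub> = chow_class 1"
proof -
  have "CI = CI +>\<^bsub>PR\<^esub> 0" using CI.a_rcos_const[of 0] CI.zero_closed by simp
  then show "\<zero>\<^bsub>CR\<^esub> = chow_class 0" by (simp add: chow_ring_def Let_def ring.defs FactRing_def chow_class_def)
  show "\<one>\<^bsub>CR\<^esub> = chow_class 1" by (simp add: chow_ring_def Let_def ring.defs FactRing_def chow_class_def)
qed

lemma cring_chow: "cring CR"
proof (intro cringI abelian_groupI comm_monoidI)
  show "\<exists>y\<in>carrier CR. y \<oplus>\<^bsub>CR\<^esub> x = \<zero>\<^bsub>CR\<^esub>" if x: "x \<in> carrier CR" for x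
  proof -
    obtain p where "x = chow_class p" "p \<in> flat_polys" using x by (auto simp: chow_ring_carrier)
    then show ?thesis
      by (intro bexI[of _ "chow_class (- p)"]) (auto simp: chow_ring_carrier chow_ring_simps chow_ring_zero)
  qed
qed (auto simp: chow_ring_carrier chow_ring_simps chow_ring_zero chow_ring_one algebra_simps)

interpretation CR: cring CR by (rule cring_chow)

lemma chow_ring_uminus: "p \<in> flat_polys \<Longrightarrow> \<ominus>\<^bsub>CR\<^esub> chow_class p = chow_class (- p)"
  by (rule CR.minus_equality) (auto simp: chow_ring_carrier chow_ring_simps chow_ring_zero)

lemma chow_ring_finsum:
  assumes "finite A" "\<And>a. a \<in> A \<Longrightarrow> f a \<in> flat_polys"
  shows "finsum CR (\<lambda>a. chow_class (f a)) A = chow_class (\<Sum>a\<in>A. f a)"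
  using assms
proof (induction A rule: finite_induct)
  case empty
  then show ?case by (simp add: chow_ring_zero)
next
  case (insert a A)
  then show ?case by (subst CR.finsum_insert) (auto simp: chow_ring_carrier chow_ring_simps)
qed

section \<open>Homogeneity and the grading of the Chow ring\<close>

lemma chow_grading_iff: "x \<in> CG d \<longleftrightarrow> (\<exists>p\<in>flat_polys. mpoly_homogeneous d p \<and> x = chow_class p)"
  by (auto simp: chow_grading_def chow_class_def)

lemma chow_class_grading:
  "p \<in> flat_polys \<Longrightarrow> mpoly_homogeneous d p \<Longrightarrow> chow_class p \<in> CG d"
  unfolding chow_grading_iff by blast

lemma hom_part_flat_polys [simp, intro]: "p \<in> flat_polys \<Longrightarrow> hom_part d p \<in> flat_polys"
  using keys_hom_part[of d p] by (auto simp: flat_polys_def)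

lemma relations_homogeneous:
  assumes "g \<in> linear_relations \<union> incomparable_products \<union> unit_var ` V" "V \<subseteq> NF"
  shows "\<exists>e\<ge>1. mpoly_homogeneous e g"
proof -
  consider "g \<in> linear_relations" | "g \<in> incomparable_products" | "g \<in> unit_var ` V" using assms(1) by blast
  then show ?thesis
  proof cases
    case 1
    then have "mpoly_homogeneous 1 g"
      by (auto simp: linear_relations_def simp del: One_nat_def intro!: mpoly_homogeneous_sum)
    then show ?thesis by blast
  next
    case 2
    then obtain F G where g: "g = flat_var F * flat_var G" by (auto simp: incomparable_products_def)
    have "mpoly_homogeneous (1 + 1) g" unfolding g by (intro mpoly_homogeneous_mult mpoly_homogeneous_simps)
    then show ?thesis by (meson le_add1)
  next
    case 3
    then have "mpoly_homogeneous 1 g" using assms(2) by (auto simp: unit_var_NF simp del: One_nat_def)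
    then show ?thesis by blast
  qed
qed

text \<open>All generators are homogeneous of positive degree, which gives both claims in one
  induction. The empty flat, with its variable \<open>1\<close> of degree zero, has to be excluded
  from \<open>V\<close>.\<close>

lemma hom_part_flat_ideal:
  assumes "V \<subseteq> NF" "p \<in> flat_ideal V"
  shows "hom_part d p \<in> flat_ideal V \<and> hom_part 0 p = 0"
  using assms(2) unfolding flat_ideal_def
proof (induction p rule: ideal_span.induct)
  case (step p q g)
  obtain e where e: "e \<ge> 1" "mpoly_homogeneous e g" using relations_homogeneous[OF step(3) assms(1)] by blast
  have "g \<in> flat_ideal V" using step flat_ideal_gen by blast
  then have "hom_part (d - e) q * g \<in> flat_ideal V" using step flat_ideal_mult by blast
  then have "hom_part d (q * g) \<in> flat_ideal V" using e by (simp add: hom_part_mult)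
  moreover have "hom_part 0 (q * g) = 0" using e by (simp add: hom_part_mult)
  ultimately show ?case using step ideal_span_add unfolding flat_ideal_def by auto
qed (simp add: ideal_span.zero)

lemma flat_ideal_carrier_NF: "V \<subseteq> NF \<Longrightarrow> flat_ideal V \<subseteq> flat_polys"
  using NF_flat by (intro flat_ideal_carrier) auto

lemma flat_ideal_NF: "p \<in> flat_ideal NF \<longleftrightarrow> p \<in> flat_polys \<and> hom_part 0 p = 0"
proof
  assume "p \<in> flat_ideal NF"
  then show "p \<in> flat_polys \<and> hom_part 0 p = 0"
    using flat_ideal_carrier_NF[of NF] hom_part_flat_ideal[of NF p 0] by auto
next
  assume p: "p \<in> flat_polys \<and> hom_part 0 p = 0"
  have "Poly_Mapping.lookup p 0 = Poly_Mapping.lookup (hom_part 0 p) 0" by (simp add: lookup_hom_part)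
  then show "p \<in> flat_ideal NF"
    using flat_polys_constant_term[of p NF] p flat_ideal_var by (simp add: mpoly_const_simps)
qed

lemma chow_graded_ring: "graded_ring CR CG"
proof (intro graded_ring.intro graded_ring_axioms.intro cring_chow)
  fix i
  show "additive_subgroup (CG i) CR"
  proof (rule additive_subgroup.intro, rule CR.add.subgroupI)
    show "CG i \<subseteq> carrier CR" by (auto simp: chow_grading_iff chow_ring_carrier)
    show "CG i \<noteq> {}"
      using chow_grading_iff[of "chow_class 0" i] flat_polys_simps(1) mpoly_homogeneous_simps(1) by blast
    show "\<ominus>\<^bsub>CR\<^esub> x \<in> CG i" if "x \<in> CG i" for x
      using that by (auto simp: chow_grading_iff chow_ring_uminus intro: mpoly_homogeneous_uminus)
    show "x \<oplus>\<^bsub>CR\<^esub> y \<in> CG i"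
      if "x \<in> CG i" "y \<in> CG i" for x y
      using that by (auto simp: chow_grading_iff chow_ring_simps intro: mpoly_homogeneous_add)
  qed
next
  fix x y i j assume "x \<in> CG i" "y \<in> CG j"
  then show "x \<otimes>\<^bsub>CR\<^esub> y \<in> CG (i + j)"
    by (auto simp: chow_grading_iff chow_ring_simps intro: mpoly_homogeneous_mult)
next
  fix x assume "x \<in> carrier CR"
  then obtain p where p: "x = chow_class p" "p \<in> flat_polys" by (auto simp: chow_ring_carrier)
  let ?P = "\<lambda>f. (\<forall>i. f i \<in> CG i) \<and> finite {i. f i \<noteq> \<zero>\<^bsub>CR\<^esub>} \<and>
      x = (\<Oplus>\<^bsub>CR\<^esub>i\<in>{i. f i \<noteq> \<zero>\<^bsub>CR\<^esub>}. f i)"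
  let ?f = "\<lambda>i. chow_class (hom_part i p)"
  have zero_iff: "chow_class q = \<zero>\<^bsub>CR\<^esub> \<longleftrightarrow> q \<in> flat_ideal {}" if "q \<in> flat_polys" for q
    using chow_class_eq_iff[OF that, of 0] by (simp add: chow_ring_zero)
  show "\<exists>!f. ?P f"
  proof (rule ex1I[of _ ?f])
    \<comment> \<open>The required sum runs over the nonzero classes only. Components of
      \<open>p\<close> whose class is zero lie in the ideal and go into the difference.\<close>
    let ?D = "monomial_degree ` Poly_Mapping.keys p"
    let ?S = "{i. ?f i \<noteq> \<zero>\<^bsub>CR\<^esub>}"
    have "?f i = \<zero>\<^bsub>CR\<^esub>" if "i \<notin> ?D" for i
    proof -
      have "hom_part i p = 0"
        using that by (intro poly_mapping_eqI) (auto simp: lookup_hom_part in_keys_iff)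
      then show ?thesis by (simp add: chow_ring_zero)
    qed
    then have SD: "?S \<subseteq> ?D" by blast
    have finD: "finite ?D" by simp
    then have finS: "finite ?S" using SD finite_subset by blast
    have "p = (\<Sum>i\<in>?D. hom_part i p)" using sum_hom_part[OF finD order_refl] by (rule sym)
    also have "\<dots> = (\<Sum>i\<in>?D - ?S. hom_part i p) + (\<Sum>i\<in>?S. hom_part i p)"
      using sum.subset_diff[OF SD finD] .
    finally have "p - (\<Sum>i\<in>?S. hom_part i p) = (\<Sum>i\<in>?D - ?S. hom_part i p)"
      by (rule iffD2[OF diff_eq_eq])
    moreover have "(\<Sum>i\<in>?D - ?S. hom_part i p) \<in> flat_ideal {}"
      using zero_iff p(2) by (intro flat_ideal_sum) simp
    ultimately have diff: "p - (\<Sum>i\<in>?S. hom_part i p) \<in> flat_ideal {}" by (simp only:)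
    have sumP: "(\<Sum>i\<in>?S. hom_part i p) \<in> flat_polys"
      using p(2) by (intro flat_polys_sum) simp
    have "x = chow_class (\<Sum>i\<in>?S. hom_part i p)"
      unfolding p(1) chow_class_eq_iff[OF p(2) sumP] by (rule diff)
    then have "x = finsum CR ?f ?S"
      unfolding chow_ring_finsum[OF finS hom_part_flat_polys[OF p(2)]] .
    moreover have "?f i \<in> CG i" for i
      unfolding chow_grading_iff using p(2) hom_part_homogeneous hom_part_flat_polys by blast
    ultimately show "?P ?f" using finS by (intro conjI allI)
  next
    fix f assume f: "?P f"
    then have "\<forall>i. \<exists>q. q \<in> flat_polys \<and> mpoly_homogeneous i q \<and> f i = chow_class q"
      unfolding chow_grading_iff by blast
    then obtain q where q': "\<forall>i. q i \<in> flat_polys \<and> mpoly_homogeneous i (q i) \<and> f i = chow_class (q i)"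
      using choice by meson
    then have q: "\<And>i. q i \<in> flat_polys" "\<And>i. mpoly_homogeneous i (q i)" and fq: "f = (\<lambda>i. chow_class (q i))"
      by auto
    let ?S = "{i. f i \<noteq> \<zero>\<^bsub>CR\<^esub>}"
    have finS: "finite ?S" using f by blast
    have sumP: "(\<Sum>i\<in>?S. q i) \<in> flat_polys" using q(1) by (intro flat_polys_sum)
    have "x = finsum CR f ?S" using f by blast
    then have "x = finsum CR (\<lambda>i. chow_class (q i)) ?S" by (simp only: fq)
    then have "chow_class p = chow_class (\<Sum>i\<in>?S. q i)"
      unfolding p(1) chow_ring_finsum[OF finS q(1)] .
    then have diff: "p - (\<Sum>i\<in>?S. q i) \<in> flat_ideal {}"
      unfolding chow_class_eq_iff[OF p(2) sumP] .
    show "f = ?f"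
    proof
      fix j
      \<comment> \<open>The difference lies in a homogeneous ideal, hence so does its component of
        degree \<open>j\<close>; this determines the class of \<open>q j\<close>.\<close>
      have "hom_part j (p - (\<Sum>i\<in>?S. q i)) + hom_part j (\<Sum>i\<in>?S. q i) = hom_part j p"
        by (simp only: hom_part_add[symmetric] diff_add_cancel)
      then have "hom_part j p - hom_part j (\<Sum>i\<in>?S. q i) \<in> flat_ideal {}"
        using hom_part_flat_ideal[OF _ diff, of j] by (metis add_diff_cancel_right' empty_subsetI)
      moreover have "hom_part j (\<Sum>i\<in>?S. q i) = (if j \<in> ?S then q j else 0)"
      proof -
        have "hom_part j (q i) = (if j = i then q i else 0)" for i
          using hom_part_of_homogeneous[OF q(2)] by simp
        then show ?thesis using finS by (simp add: hom_part_sum)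
      qed
      moreover have "q j \<in> flat_ideal {}" if "j \<notin> ?S"
        using that zero_iff[OF q(1)] by (simp add: fq)
      ultimately have "hom_part j p - q j \<in> flat_ideal {}" by (cases "j \<in> ?S") auto
      then have "chow_class (hom_part j p) = chow_class (q j)"
        using chow_class_eq_iff[OF hom_part_flat_polys[OF p(2)] q(1)] by blast
      then show "f j = ?f j" by (simp add: fq)
    qed
  qed
qed

lemma chow_standard_graded:
  "standard_graded_algebra (ring_of_type_algebra :: rat ring) CR CG"
proof -
  let ?K = "ring_of_type_algebra :: rat ring"
  interpret CR: graded_ring CR CG by (rule chow_graded_ring)
  have K: "field ?K" by (rule field_from_type_algebra)
  have Ksimps: "carrier ?K = UNIV" "a \<oplus>\<^bsub>?K\<^esub> b = a + b" "a \<otimes>\<^bsub>?K\<^esub> b = a * b" "\<one>\<^bsub>?K\<^esub> = 1" for a b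
    by (simp_all add: ring_of_type_algebra_def)
  have alg: "algebra ?K CR"
    using cring_from_type_algebra cring_chow
    by (intro algebraI) (auto simp: Ksimps chow_ring_carrier chow_ring_simps chow_ring_smult mpoly_const_simps algebra_simps)
  have const: "c \<odot>\<^bsub>CR\<^esub> \<one>\<^bsub>CR\<^esub> = chow_class (mpoly_const c)" for c
    by (simp add: chow_ring_one chow_ring_smult)
  have "bij_betw (\<lambda>c. c \<odot>\<^bsub>CR\<^esub> \<one>\<^bsub>CR\<^esub>) (carrier ?K) (CG 0)"
  proof (rule bij_betw_imageI)
    show "inj_on (\<lambda>c. c \<odot>\<^bsub>CR\<^esub> \<one>\<^bsub>CR\<^esub>) (carrier ?K)"
    proof (rule inj_onI)
      fix c c' assume "c \<odot>\<^bsub>CR\<^esub> \<one>\<^bsub>CR\<^esub> = c' \<odot>\<^bsub>CR\<^esub> \<one>\<^bsub>CR\<^esub>"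
      then have "mpoly_const c - mpoly_const c' \<in> flat_ideal {}" by (simp add: const chow_class_eq_iff)
      moreover have "mpoly_const c - mpoly_const c' = (mpoly_const (c - c') :: ('a set, rat) mpoly)" by (simp add: mpoly_const_def single_diff)
      ultimately have mem: "mpoly_const (c - c') \<in> flat_ideal {}" by simp
      have "hom_part 0 (mpoly_const (c - c') :: ('a set, rat) mpoly) = 0"
        by (rule conjunct2[OF hom_part_flat_ideal[OF empty_subsetI mem]])
      then have "mpoly_const (c - c') = (0 :: ('a set, rat) mpoly)"
        by (simp add: hom_part_of_homogeneous[OF mpoly_homogeneous_simps(2)])
      then have "Poly_Mapping.lookup (mpoly_const (c - c') :: ('a set, rat) mpoly) 0 = 0" by simp
      then show "c = c'" by (simp add: mpoly_const_def)
    qed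
    show "(\<lambda>c. c \<odot>\<^bsub>CR\<^esub> \<one>\<^bsub>CR\<^esub>) ` carrier ?K = CG 0"
    proof (intro equalityI subsetI)
      fix x assume "x \<in> CG 0"
      then obtain p where "x = chow_class p" "mpoly_homogeneous 0 p" by (auto simp: chow_grading_iff)
      then have "x = Poly_Mapping.lookup p 0 \<odot>\<^bsub>CR\<^esub> \<one>\<^bsub>CR\<^esub>" using homogeneous_0_const const by metis
      then show "x \<in> (\<lambda>c. c \<odot>\<^bsub>CR\<^esub> \<one>\<^bsub>CR\<^esub>) ` carrier ?K" by (simp add: Ksimps)
    qed (auto simp: const intro: chow_class_grading)
  qed
  moreover have "\<exists>S. finite S \<and> S \<subseteq> CG 1 \<and> carrier CR = generate_ring CR (CG 0 \<union> S)"
  proof (intro exI conjI)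
    let ?S = "(\<lambda>F. chow_class (flat_var F)) ` NF"
    let ?H = "CG 0 \<union> ?S"
    show "finite ?S" using finite_nonempty_flats by simp
    show S1: "?S \<subseteq> CG 1"
      using chow_class_grading[OF flat_polys_simps(4) mpoly_homogeneous_simps(3)] by blast
    show "carrier CR = generate_ring CR ?H"
    proof
      have "?H \<subseteq> carrier CR" using S1 CR.gr_carrier by blast
      then show "generate_ring CR ?H \<subseteq> carrier CR" by (rule CR.generate_ring_incl)
      show "carrier CR \<subseteq> generate_ring CR ?H"
      proof
        fix x assume "x \<in> carrier CR"
        then obtain p where p: "x = chow_class p" "p \<in> flat_polys" by (auto simp: chow_ring_carrier)
        have "p \<in> flat_polys \<and> chow_class p \<in> generate_ring CR ?H"
          using p(2)[unfolded flat_polys_def, simplified]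
        proof (induction p rule: mpoly_generated_induct)
          case (const c)
          show ?case
            using generate_ring.incl[of "chow_class (mpoly_const c)" ?H CR]
              chow_class_grading[of "mpoly_const c" 0] by simp
        next
          case (var v)
          then show ?case by (auto intro!: generate_ring.incl)
        next
          case (add p q)
          then show ?case using generate_ring.eng_add[of "chow_class p" CR ?H "chow_class q"] by (simp add: chow_ring_simps)
        next
          case (mult p q)
          then show ?case using generate_ring.eng_mult[of "chow_class p" CR ?H "chow_class q"] by (simp add: chow_ring_simps)
        qed
        then show "x \<in> generate_ring CR ?H" using p by simp
      qed
    qed
  qed
  ultimately show ?thesis
    using K alg chow_graded_ring by (intro standard_graded_algebra.intro standard_graded_algebra_axioms.intro) auto
qed

end

section \<open>The Koszul property\<close>

context simple_matroid
begin

definition chow_component :: "nat \<Rightarrow> ('a set, rat) mpoly set \<Rightarrow> ('a set, rat) mpoly set" where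
  "chow_component d C = chow_class (hom_part d (SOME p. p \<in> flat_polys \<and> C = chow_class p))"

text \<open>The choice of representative is harmless because the ideal is homogeneous: two
  representatives have components that differ by a member of the ideal.\<close>

lemma chow_component_class:
  assumes p: "p \<in> flat_polys"
  shows "chow_component d (chow_class p) = chow_class (hom_part d p)"
proof -
  define q where "q = (SOME q. q \<in> flat_polys \<and> chow_class p = chow_class q)"
  have "q \<in> flat_polys \<and> chow_class p = chow_class q"
    unfolding q_def by (rule someI[of _ p]) (simp add: p)
  then have q: "q \<in> flat_polys" "q - p \<in> flat_ideal {}"
    using chow_class_eq_iff[of q p] p by auto
  have "hom_part d (q - p) + hom_part d p = hom_part d q"
    by (simp only: hom_part_add[symmetric] diff_add_cancel)
  then have "hom_part d q - hom_part d p = hom_part d (q - p)" by (simp add: algebra_simps)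
  also have "\<dots> \<in> flat_ideal {}" by (rule conjunct1[OF hom_part_flat_ideal[OF empty_subsetI q(2)]])
  finally show ?thesis
    unfolding chow_component_def q_def[symmetric] using chow_class_eq_iff q(1) p by simp
qed

text \<open>\<open>flat_ideal V\<close> contains the defining ideal of the Chow ring, so membership
  does not depend on the representative; this carries colon ideals over from polynomials.\<close>

lemma chow_class_flat_ideal_iff:
  assumes "p \<in> flat_polys" "\<And>G. G \<in> V \<Longrightarrow> is_flat G"
  shows "chow_class p \<in> chow_class ` flat_ideal V \<longleftrightarrow> p \<in> flat_ideal V"
proof
  assume "chow_class p \<in> chow_class ` flat_ideal V"
  then obtain q where q: "q \<in> flat_ideal V" "chow_class p = chow_class q" by auto
  have "q \<in> flat_polys" using q flat_ideal_carrier[of V] assms by blast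
  then have "p - q \<in> flat_ideal {}" using chow_class_eq_iff assms q by simp
  then have "p - q \<in> flat_ideal V" using flat_ideal_mono[of "{}" V] by blast
  then show "p \<in> flat_ideal V" using q flat_ideal_diff_iff by blast
qed auto

lemma koszul_family_flats: "V \<in> koszul_family \<Longrightarrow> G \<in> V \<Longrightarrow> is_flat G"
  by (auto simp: koszul_family_def not_below_def coatoms_above_def NF_flat)

lemma koszul_family_linear_quotients:
  defines "FF \<equiv> (\<lambda>V. chow_class ` flat_ideal V) ` koszul_family"
  assumes "J \<in> FF"
  shows "cring.linear_quotients CR (CG 1) FF J"
proof -
  interpret CR: cring CR by (rule cring_chow)
  have "CR.linear_quotients (CG 1) FF (chow_class ` K)" if "flat_chain K" for K
    using that
  proof (induction K rule: flat_chain.induct)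
    case base
    have "chow_class ` flat_ideal {} = {\<zero>\<^bsub>CR\<^esub>}"
    proof -
      have "chow_class p = \<zero>\<^bsub>CR\<^esub>" if "p \<in> flat_ideal {}" for p
        using that flat_ideal_carrier[of "{}"] chow_class_eq_iff[of p 0] by (auto simp: chow_ring_zero)
      then show ?thesis using flat_ideal_zero[of "{}"] by blast
    qed
    then show ?case using CR.linear_quotients.base by metis
  next
    case (step V F V')
    let ?l = "chow_class (flat_var F)"
    have Fp: "flat_var F \<in> flat_polys" using step(3) by simp
    have Vflat: "is_flat G" if "G \<in> V" for G using that step(2) by blast
    have Vp: "flat_ideal V \<subseteq> flat_polys" using flat_ideal_carrier[OF Vflat] .
    have l: "?l \<in> CG 1"
      by (rule chow_class_grading[OF Fp mpoly_homogeneous_simps(3)])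
    have colon: "{r \<in> carrier CR. r \<otimes>\<^bsub>CR\<^esub> ?l \<in> chow_class ` flat_ideal V} = chow_class ` flat_ideal V'"
    proof -
      have V'flat: "is_flat G" if "G \<in> V'" for G using koszul_family_flats[OF step(4) that] .
      have iff: "chow_class p \<otimes>\<^bsub>CR\<^esub> ?l \<in> chow_class ` flat_ideal V \<longleftrightarrow> p \<in> flat_ideal V'" if p: "p \<in> flat_polys" for p
        using step(5)[OF p] chow_class_flat_ideal_iff[OF _ Vflat, of "p * flat_var F"] p Fp
        by (simp add: chow_ring_simps mult.commute)
      have "flat_ideal V' \<subseteq> flat_polys" using flat_ideal_carrier[OF V'flat] .
      then show ?thesis using iff unfolding chow_ring_carrier by blast
    qed
    have "CR.linear_quotients (CG 1) FF
        {a \<oplus>\<^bsub>CR\<^esub> r \<otimes>\<^bsub>CR\<^esub> ?l | a r. a \<in> chow_class ` flat_ideal V \<and> r \<in> carrier CR}"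
    proof (rule CR.linear_quotients.step[OF step.IH l])
      show "{r \<in> carrier CR. r \<otimes>\<^bsub>CR\<^esub> ?l \<in> chow_class ` flat_ideal V} \<in> FF"
        unfolding colon FF_def using step(4) by blast
    qed
    also have "{a \<oplus>\<^bsub>CR\<^esub> r \<otimes>\<^bsub>CR\<^esub> ?l | a r. a \<in> chow_class ` flat_ideal V \<and> r \<in> carrier CR} =
        chow_class ` flat_ideal (insert F V)" (is "?A = ?B")
    proof (intro equalityI subsetI)
      fix x assume "x \<in> ?A"
      then obtain p q where pq: "p \<in> flat_ideal V" "q \<in> flat_polys" "x = chow_class p \<oplus>\<^bsub>CR\<^esub> chow_class q \<otimes>\<^bsub>CR\<^esub> ?l"
        unfolding chow_ring_carrier by blast
      have "p \<in> flat_polys" using pq Vp by blast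
      then have "x = chow_class (p + q * flat_var F)" using pq Fp by (simp add: chow_ring_simps)
      moreover have "p \<in> flat_ideal (insert F V)" using pq flat_ideal_mono[of V "insert F V"] by blast
      moreover have "q * flat_var F \<in> flat_ideal (insert F V)"
        using pq step(3) by (intro flat_ideal_mult flat_ideal_var) auto
      ultimately show "x \<in> ?B" by blast
    next
      fix x assume "x \<in> ?B"
      then obtain p where p: "x = chow_class p" "p \<in> flat_ideal (insert F V)" by blast
      then obtain q where q: "q \<in> flat_polys" "p - q * flat_var F \<in> flat_ideal V"
        using flat_ideal_insert[of p F V] step(3) by (auto simp: unit_var_NF)
      have "p - q * flat_var F \<in> flat_polys" using q Vp by blast
      then have "x = chow_class (p - q * flat_var F) \<oplus>\<^bsub>CR\<^esub> chow_class q \<otimes>\<^bsub>CR\<^esub> ?l"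
        using p q Fp by (simp add: chow_ring_simps)
      then show "x \<in> ?A" using q unfolding chow_ring_carrier by blast
    qed
    finally show ?case .
  qed
  then show ?thesis using assms(2) flat_chain_koszul_family unfolding FF_def by blast
qed

text \<open>Modulo the relations, sums of classes of positive degree are the classes without
  constant term, and these are generated by all variables. So the irrelevant ideal belongs to the
  family, as the member \<open>NF\<close>.\<close>

lemma chow_irrelevant_ideal:
  "irrelevant_ideal CR CG = chow_class ` flat_ideal NF" (is "?A = ?B")
proof (intro equalityI subsetI)
  fix x assume "x \<in> ?A"
  then obtain f n where f: "x = finsum CR f {1..n}" "\<forall>i\<in>{1..n}. f i \<in> CG i"
    unfolding irrelevant_ideal_def by blast
  then have "\<forall>i\<in>{1..n}. \<exists>q. q \<in> flat_polys \<and> mpoly_homogeneous i q \<and> f i = chow_class q"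
    unfolding chow_grading_iff by blast
  then obtain q where q: "\<forall>i\<in>{1..n}. q i \<in> flat_polys \<and> mpoly_homogeneous i (q i) \<and> f i = chow_class (q i)"
    using bchoice by meson
  interpret CR: cring CR by (rule cring_chow)
  have "x = finsum CR (\<lambda>i. chow_class (q i)) {1..n}"
    unfolding f(1) using q by (intro CR.finsum_cong') (auto simp: chow_ring_carrier)
  also have "\<dots> = chow_class (\<Sum>i\<in>{1..n}. q i)" using q by (intro chow_ring_finsum) auto
  finally have x: "x = chow_class (\<Sum>i\<in>{1..n}. q i)" .
  have "q i \<in> flat_ideal NF" if "i \<in> {1..n}" for i
  proof -
    have "hom_part 0 (q i) = 0" using hom_part_of_homogeneous[of i "q i" 0] q that by auto
    then show ?thesis using flat_ideal_NF q that by blast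
  qed
  then have "(\<Sum>i\<in>{1..n}. q i) \<in> flat_ideal NF" by (intro flat_ideal_sum)
  then show "x \<in> ?B" using x by blast
next
  fix x assume "x \<in> ?B"
  then obtain p where p: "x = chow_class p" "p \<in> flat_polys" "hom_part 0 p = 0"
    using flat_ideal_NF by blast
  let ?n = "Max (insert 0 (monomial_degree ` Poly_Mapping.keys p))"
  have "(\<Sum>i\<in>{0..?n}. hom_part i p) = p" by (rule sum_hom_part) auto
  moreover have "{0..?n} = insert 0 {1..?n}" by auto
  ultimately have sum: "(\<Sum>i\<in>{1..?n}. hom_part i p) = p" using p(3) by simp
  have "finsum CR (\<lambda>i. chow_class (hom_part i p)) {1..?n} = x"
    using chow_ring_finsum[of "{1..?n}" "\<lambda>i. hom_part i p"] p sum by simp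
  moreover have "\<forall>i\<in>{1..?n}. chow_class (hom_part i p) \<in> CG i"
    unfolding chow_grading_iff using p(2) hom_part_homogeneous hom_part_flat_polys by blast
  ultimately show "x \<in> ?A" unfolding irrelevant_ideal_def by blast
qed

lemma chow_irrelevant_is_ideal: "ideal (irrelevant_ideal CR CG) CR"
  unfolding chow_irrelevant_ideal
proof (rule idealI)
  interpret CR: cring CR by (rule cring_chow)
  show "ring CR" by unfold_locales
  have sub: "p \<in> flat_polys" if "p \<in> flat_ideal NF" for p using that flat_ideal_NF by blast
  show "subgroup (chow_class ` flat_ideal NF) (add_monoid CR)"
  proof (rule CR.add.subgroupI)
    show "chow_class ` flat_ideal NF \<subseteq> carrier CR" using sub by (auto simp: chow_ring_carrier)
    show "chow_class ` flat_ideal NF \<noteq> {}" using flat_ideal_zero by blast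
    show "\<ominus>\<^bsub>CR\<^esub> x \<in> chow_class ` flat_ideal NF" if "x \<in> chow_class ` flat_ideal NF" for x
      using that sub by (auto simp: chow_ring_uminus)
    show "x \<oplus>\<^bsub>CR\<^esub> y \<in> chow_class ` flat_ideal NF"
      if "x \<in> chow_class ` flat_ideal NF" "y \<in> chow_class ` flat_ideal NF" for x y
      using that sub by (auto simp: chow_ring_simps)
  qed
  show "x \<otimes>\<^bsub>CR\<^esub> a \<in> chow_class ` flat_ideal NF" "a \<otimes>\<^bsub>CR\<^esub> x \<in> chow_class ` flat_ideal NF"
    if a: "a \<in> chow_class ` flat_ideal NF" and x: "x \<in> carrier CR" for a x
    using a x sub by (auto simp: chow_ring_carrier chow_ring_simps intro: flat_ideal_mult flat_ideal_mult_right)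
qed

text \<open>The components of degrees one and two serve as \<open>h\<close> and \<open>h'\<close>:
  multiplying by a linear form carries the first to the second.\<close>

lemma chow_ring_koszul:
  "koszul_algebra (ring_of_type_algebra :: rat ring) CR CG"
proof -
  interpret CR: graded_ring CR CG by (rule chow_graded_ring)
  let ?FF = "(\<lambda>V. chow_class ` flat_ideal V) ` koszul_family"
  have one: "chow_component 1 x \<in> CG 1" if x: "x \<in> carrier CR" for x
  proof -
    obtain p where p: "x = chow_class p" "p \<in> flat_polys" using x unfolding chow_ring_carrier by blast
    show ?thesis
      unfolding p(1) chow_component_class[OF p(2)] chow_grading_iff
      using hom_part_homogeneous hom_part_flat_polys[OF p(2)] by blast
  qed
  have id: "chow_component 1 x = x" if x: "x \<in> CG 1" for x
  proof -
    obtain p where p: "p \<in> flat_polys" "mpoly_homogeneous 1 p" "x = chow_class p"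
      using x unfolding chow_grading_iff by blast
    show ?thesis unfolding p(3) chow_component_class[OF p(1)] using hom_part_of_homogeneous[OF p(2)] by simp
  qed
  have zero: "chow_component d \<zero>\<^bsub>CR\<^esub> = \<zero>\<^bsub>CR\<^esub>" for d
    by (simp add: chow_ring_zero chow_component_class)
  have add: "chow_component d (x \<oplus>\<^bsub>CR\<^esub> y) = chow_component d x \<oplus>\<^bsub>CR\<^esub> chow_component d y"
    if "x \<in> carrier CR" "y \<in> carrier CR" for x y d
    using that by (auto simp: chow_ring_carrier chow_ring_simps chow_component_class)
  have mult: "chow_component 2 (x \<otimes>\<^bsub>CR\<^esub> l) = chow_component 1 x \<otimes>\<^bsub>CR\<^esub> l"
    if x: "x \<in> carrier CR" and l: "l \<in> CG 1" for x l
  proof -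
    obtain p where p: "x = chow_class p" "p \<in> flat_polys" using x unfolding chow_ring_carrier by blast
    obtain q where q: "q \<in> flat_polys" "mpoly_homogeneous 1 q" "l = chow_class q"
      using l unfolding chow_grading_iff by blast
    have "hom_part 2 (p * q) = hom_part 1 p * q"
      using hom_part_mult[OF q(2), of 2 p] by simp
    then show ?thesis using p q by (simp add: chow_ring_simps chow_component_class)
  qed
  have mem: "irrelevant_ideal CR CG \<in> ?FF"
    unfolding chow_irrelevant_ideal by (rule imageI) (simp add: koszul_family_def)
  have "\<exists>s d \<epsilon>. minimal_graded_free_resolution CR CG (residue_module CR CG)
      (residue_grading CR CG) s d \<epsilon> \<and> (\<forall>i. set (s i) \<subseteq> {i})"
    by (rule CR.linear_resolution[OF chow_irrelevant_is_ideal mem koszul_family_linear_quotients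
          one id zero zero add mult])
  then show ?thesis using chow_standard_graded unfolding koszul_algebra_def by blast
qed

end

theorem theorem1p1:
  fixes E :: "'a set" and indep :: "'a set \<Rightarrow> bool"
  assumes "simple_matroid E indep"
  shows "koszul_algebra (ring_of_type_algebra :: rat ring) (chow_ring E indep) (chow_grading E indep)"
  using assms by (rule simple_matroid.chow_ring_koszul)

end
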